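(* Let $\mathcal{G}$ and $\mathcal{H}$ be second-countable ample Hausdorff groupoids with $\sigma$-compact unit spaces. Suppose that the pair $\mathcal{G}$, $\mathcal{H}$ satisfies any one of the following eight (equivalent) conditions: (1) $\mathcal{G}$ and $\mathcal{H}$ are similar; (2) they are Morita equivalent; (3) there exist an ample Hausdorff groupoid $\mathcal{L}$ and a decomposition $\mathcal{L}^{(0)}=X\sqcup Y$ into complementary full clopen subsets with $\mathcal{L}|_X\cong\mathcal{G}$ and $\mathcal{L}|_Y\cong\mathcal{H}$; (4) they are equivalent in the sense of Renault; (5) they admit isomorphic ampliations; (6) $\mathcal{G}\times\mathcal{R}\cong\mathcal{H}\times\mathcal{R}$, where $\mathcal{R}=\mathbb{N}\times\mathbb{N}$ is the discrete full equivalence relation; (7) they are Kakutani equivalent; (8) they are weakly Kakutani equivalent. Then $H_n(\mathcal{G})\cong H_n(\mathcal{H})$ for all $n\ge 0$. In particular, if $\rho:\mathcal{G}\to\mathcal{H}$ is a similarity, then it induces an isomorphism $\rho_*:H_n(\mathcal{G})\cong H_n(\mathcal{H})$. If $X$ is a full open subset of $\mathcal{G}^{(0)}$, then the inclusion $\mathcal{G}|_X\subseteq\mathcal{G}$ is a similarity and induces an isomorphism $H_*(\mathcal{G}|_X)\cong H_*(\mathcal{G})$.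
   Context: Groupoids. A groupoid $\mathcal{G}$ is a small category with inverses, with unit space $\mathcal{G}^{(0)}$ and range and source maps $r,s$; $\gamma_1\gamma_2$ is defined when $s(\gamma_1)=r(\gamma_2)$. A topological groupoid carries a locally compact topology making all operations continuous, with $\mathcal{G}^{(0)}$ Hausdorff. It is Hausdorff if the topology of $\mathcal{G}$ is Hausdorff; étale if $\mathcal{G}^{(0)}$ is open and $r,s$ are local homeomorphisms; ample if it is étale and $\mathcal{G}^{(0)}$ is zero-dimensional (has a basis of compact open sets). The orbit of $u\in\mathcal{G}^{(0)}$ is $[u]=\{r(\gamma):s(\gamma)=u\}$; $U\subseteq\mathcal{G}^{(0)}$ is full if it meets every orbit. $\mathcal{G}|_U=\{\gamma: r(\gamma),s(\gamma)\in U\}$. Homology. For a local homeomorphism $\psi:Y\to X$ of locally compact Hausdorff zero-dimensional spaces, $\psi_*:C_c(Y,\mathbb{Z})\to C_c(X,\mathbb{Z})$ is $\psi_*(f)(x)=\sum_{\psi(y)=x}f(y)$. Let $\mathcal{G}^{(n)}$ be the space of composable $n$-tuples ($n\ge1$). For $n\ge2$, $d_0(g_1,\dots,g_n)=(g_2,\dots,g_n)$, $d_i(g_1,\dots,g_n)=(g_1,\dots,g_ig_{i+1},\dots,g_n)$ for $1\le i\le n-1$, $d_n(g_1,\dots,g_n)=(g_1,\dots,g_{n-1})$. Put $\partial_0=0$, $\partial_1=s_*-r_*$ and $\partial_n=\sum_{i=0}^n(-1)^i(d_i)_*$ for $n\ge2$; $H_*(\mathcal{G})$ is the homology of the complex $(C_c(\mathcal{G}^{(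 * )},\mathbb{Z}),\partial_* )$. An étale homomorphism (a groupoid homomorphism that is a local homeomorphism) $\phi:\mathcal{G}\to\mathcal{H}$ induces $\phi_*:H_n(\mathcal{G})\to H_n(\mathcal{H})$ via the maps $\phi^{(n)}_*:C_c(\mathcal{G}^{(n)},\mathbb{Z})\to C_c(\mathcal{H}^{(n)},\mathbb{Z})$. Similarity. Continuous homomorphisms $\rho,\sigma:\mathcal{G}\to\mathcal{H}$ are similar if there is a continuous map $\theta:\mathcal{G}^{(0)}\to\mathcal{H}$ with $\theta(r(g))\rho(g)=\sigma(g)\theta(s(g))$ for all $g$. $\mathcal{G}$ and $\mathcal{H}$ are similar if there are étale homomorphisms $\rho:\mathcal{G}\to\mathcal{H}$, $\sigma:\mathcal{H}\to\mathcal{G}$ with $\sigma\circ\rho$ similar to $\mathrm{id}_{\mathcal{G}}$ and $\rho\circ\sigma$ similar to $\mathrm{id}_{\mathcal{H}}$; then each of $\rho,\sigma$ is called a similarity. Morita equivalence. A continuous functor $\varphi:\mathcal{G}\to\mathcal{H}$ is a weak equivalence if (i) the map $\{(u,\gamma)\in\mathcal{G}^{(0)}\times\mathcal{H}:\varphi(u)=r(\gamma)\}\to\mathcal{H}^{(0)}$, $(u,\gamma)\mapsto s(\gamma)$, is a surjective local homeomorphism, and (ii) $g\mapsto(r(g),\varphi(g),s(g))$ is an isomorphism of $\mathcal{G}$ onto $\{(u,\gamma,v)\in\mathcal{G}^{(0)}\times\mathcal{H}\times\mathcal{G}^{(0)}: r(\gamma)=\varphi(u),\ s(\gamma)=\varphi(v)\}$.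 $\mathcal{G}$ and $\mathcal{H}$ are Morita equivalent if there are a (Hausdorff étale) groupoid $\mathcal{K}$ and weak equivalences $\mathcal{K}\to\mathcal{G}$, $\mathcal{K}\to\mathcal{H}$. Renault equivalence. A left $\mathcal{G}$-space is a locally compact Hausdorff space $Z$ with a continuous open map $r:Z\to\mathcal{G}^{(0)}$ and a continuous pairing from $\mathcal{G}*Z=\{(g,z):s(g)=r(z)\}$ to $Z$ with $r(g\cdot z)=r(g)$, $(gh)\cdot z=g\cdot(h\cdot z)$, $r(z)\cdot z=z$; it is free and proper if $(g,z)\mapsto(g\cdot z,z)$ is a proper injection $\mathcal{G}*Z\to Z\times Z$. Right spaces are analogous. $\mathcal{G}$ and $\mathcal{H}$ are equivalent in the sense of Renault if some locally compact Hausdorff $Z$ is a free and proper left $\mathcal{G}$-space (fibre map $r$) and a free and proper right $\mathcal{H}$-space (fibre map $s:Z\to\mathcal{H}^{(0)}$) with commuting actions such that $r$ induces a homeomorphism $Z/\mathcal{H}\to\mathcal{G}^{(0)}$ and $s$ induces a homeomorphism $\mathcal{G}\backslash Z\to\mathcal{H}^{(0)}$. Ampliations. For a (surjective) local homeomorphism $\psi:X\to\mathcal{G}^{(0)}$ from a locally compact Hausdorff space, $\mathcal{G}^\psi=\{(x,\gamma,y)\in X\times\mathcal{G}\times X:\psi(x)=r(\gamma),\psi(y)=s(\gamma)\}$ with relative topology and operations $(x,\gamma,y)(y,\eta,z)=(x,\gamma\eta,z)$, $(x,\gamma,y)^{-1}=(y,\gamma^{-1},x)$. $\mathcal{G}$,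 $\mathcal{H}$ admit isomorphic ampliations if some ampliation of one is isomorphic to some ampliation of the other. Kakutani equivalence. $\mathcal{G}$ and $\mathcal{H}$ are weakly Kakutani equivalent if there are full open $X\subseteq\mathcal{G}^{(0)}$, $Y\subseteq\mathcal{H}^{(0)}$ with $\mathcal{G}|_X\cong\mathcal{H}|_Y$; Kakutani equivalent if $X,Y$ can be chosen clopen. *)

theory Defs
  imports "HOL-Analysis.Analysis" "HOL-Algebra.Coset"
begin

section \<open>Topological preliminaries\<close>

definition local_homeomorphism :: "'a topology \<Rightarrow> 'b topology \<Rightarrow> ('a \<Rightarrow> 'b) \<Rightarrow> bool" where
  "local_homeomorphism X Y f \<longleftrightarrow>
     (\<forall>x\<in>topspace X. \<exists>U. openin X U \<and> x \<in> U \<and> openin Y (f ` U) \<and>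
        homeomorphic_map (subtopology X U) (subtopology Y (f ` U)) f)"

definition zero_dimensional_space :: "'a topology \<Rightarrow> bool" where
  "zero_dimensional_space X \<longleftrightarrow>
     openin X = arbitrary union_of (\<lambda>K. openin X K \<and> compactin X K)"

definition sigma_compact_space :: "'a topology \<Rightarrow> bool" where
  "sigma_compact_space X \<longleftrightarrow>
     (\<exists>\<K>. countable \<K> \<and> (\<forall>K\<in>\<K>. compactin X K) \<and> \<Union>\<K> = topspace X)"

definition quotient_topology :: "'a topology \<Rightarrow> ('a \<Rightarrow> 'b) \<Rightarrow> 'b topology" where
  "quotient_topology X q =
     topology (\<lambda>U. U \<subseteq> q ` topspace X \<and> openin X {x \<in> topspace X. q x \<in> U})"

lemma openin_quotient_topology:
  "openin (quotient_topology X q) U \<longleftrightarrow>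
     U \<subseteq> q ` topspace X \<and> openin X {x \<in> topspace X. q x \<in> U}"
proof -
  let ?L = "\<lambda>U. U \<subseteq> q ` topspace X \<and> openin X {x \<in> topspace X. q x \<in> U}"
  have "?L (S \<inter> T)" if "?L S" "?L T" for S T
  proof -
    have "{x \<in> topspace X. q x \<in> S \<inter> T} =
          {x \<in> topspace X. q x \<in> S} \<inter> {x \<in> topspace X. q x \<in> T}" by blast
    with that show ?thesis by (metis (no_types, lifting) openin_Int le_infI1)
  qed
  moreover have "?L (\<Union>\<K>)" if "\<forall>K\<in>\<K>. ?L K" for \<K>
  proof -
    have "{x \<in> topspace X. q x \<in> \<Union>\<K>} = (\<Union>K\<in>\<K>. {x \<in> topspace X. q x \<in> K})" by blast
    with that show ?thesis by (metis (no_types, lifting) openin_Union imageE Sup_least)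
  qed
  ultimately have "istopology ?L"
    unfolding istopology_def by blast
  then show ?thesis
    by (simp add: quotient_topology_def)
qed


section \<open>Groupoids\<close>

text \<open>
  The set of arrows is \<open>topspace (gtop G)\<close>, and objects are identified with their identity arrows,
  so that the unit space is a subset of the arrows.  The operations are total functions whose
  values matter only on arrows; a product \<open>gmul G g h\<close> is meaningful only if
  \<open>src G g = rng G h\<close>.
\<close>

record 'a groupoid =
  gtop :: "'a topology"
  rng :: "'a \<Rightarrow> 'a"
  src :: "'a \<Rightarrow> 'a"
  gmul :: "'a \<Rightarrow> 'a \<Rightarrow> 'a"
  ginv :: "'a \<Rightarrow> 'a"

abbreviation arrows :: "'a groupoid \<Rightarrow> 'a set" where
  "arrows G \<equiv> topspace (gtop G)"

definition units :: "'a groupoid \<Rightarrow> 'a set" where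
  "units G = {u \<in> arrows G. rng G u = u \<and> src G u = u}"

definition unit_space :: "'a groupoid \<Rightarrow> 'a topology" where
  "unit_space G = subtopology (gtop G) (units G)"

locale groupoid =
  fixes G :: "'a groupoid"
  assumes rng_unit: "g \<in> arrows G \<Longrightarrow> rng G g \<in> units G"
    and src_unit: "g \<in> arrows G \<Longrightarrow> src G g \<in> units G"
    and gmul_closed: "\<lbrakk>g \<in> arrows G; h \<in> arrows G; src G g = rng G h\<rbrakk> \<Longrightarrow> gmul G g h \<in> arrows G"
    and rng_gmul: "\<lbrakk>g \<in> arrows G; h \<in> arrows G; src G g = rng G h\<rbrakk> \<Longrightarrow> rng G (gmul G g h) = rng G g"
    and src_gmul: "\<lbrakk>g \<in> arrows G; h \<in> arrows G; src G g = rng G h\<rbrakk> \<Longrightarrow> src G (gmul G g h) = src G h"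
    and gmul_assoc: "\<lbrakk>g \<in> arrows G; h \<in> arrows G; k \<in> arrows G; src G g = rng G h; src G h = rng G k\<rbrakk>
        \<Longrightarrow> gmul G (gmul G g h) k = gmul G g (gmul G h k)"
    and rng_gmul_left: "g \<in> arrows G \<Longrightarrow> gmul G (rng G g) g = g"
    and src_gmul_right: "g \<in> arrows G \<Longrightarrow> gmul G g (src G g) = g"
    and ginv_closed: "g \<in> arrows G \<Longrightarrow> ginv G g \<in> arrows G"
    and rng_ginv: "g \<in> arrows G \<Longrightarrow> rng G (ginv G g) = src G g"
    and src_ginv: "g \<in> arrows G \<Longrightarrow> src G (ginv G g) = rng G g"
    and gmul_ginv_right: "g \<in> arrows G \<Longrightarrow> gmul G g (ginv G g) = rng G g"
    and gmul_ginv_left: "g \<in> arrows G \<Longrightarrow> gmul G (ginv G g) g = src G g"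

locale topological_groupoid = groupoid +
  assumes locally_compact: "locally_compact_space (gtop G)"
    and Hausdorff_units: "Hausdorff_space (unit_space G)"
    and continuous_rng: "continuous_map (gtop G) (gtop G) (rng G)"
    and continuous_src: "continuous_map (gtop G) (gtop G) (src G)"
    and continuous_ginv: "continuous_map (gtop G) (gtop G) (ginv G)"
    and continuous_gmul:
      "continuous_map
         (subtopology (prod_topology (gtop G) (gtop G)) {(g, h). src G g = rng G h})
         (gtop G) (\<lambda>(g, h). gmul G g h)"

locale etale_groupoid = topological_groupoid +
  assumes open_units: "openin (gtop G) (units G)"
    and local_homeomorphism_rng: "local_homeomorphism (gtop G) (unit_space G) (rng G)"
    and local_homeomorphism_src: "local_homeomorphism (gtop G) (unit_space G) (src G)"

locale ample_groupoid = etale_groupoid +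
  assumes zero_dimensional_units: "zero_dimensional_space (unit_space G)"

definition Hausdorff_groupoid :: "'a groupoid \<Rightarrow> bool" where
  "Hausdorff_groupoid G \<longleftrightarrow> topological_groupoid G \<and> Hausdorff_space (gtop G)"

definition orbit :: "'a groupoid \<Rightarrow> 'a \<Rightarrow> 'a set" where
  "orbit G u = {rng G g | g. g \<in> arrows G \<and> src G g = u}"

definition full :: "'a groupoid \<Rightarrow> 'a set \<Rightarrow> bool" where
  "full G U \<longleftrightarrow> U \<subseteq> units G \<and> (\<forall>u\<in>units G. orbit G u \<inter> U \<noteq> {})"

definition restriction :: "'a groupoid \<Rightarrow> 'a set \<Rightarrow> 'a groupoid" where
  "restriction G U =
     G\<lparr>gtop := subtopology (gtop G) {g \<in> arrows G. rng G g \<in> U \<and> src G g \<in> U}\<rparr>"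

definition groupoid_hom :: "'a groupoid \<Rightarrow> 'b groupoid \<Rightarrow> ('a \<Rightarrow> 'b) \<Rightarrow> bool" where
  "groupoid_hom G H \<phi> \<longleftrightarrow>
     (\<forall>g\<in>arrows G. \<phi> g \<in> arrows H \<and> rng H (\<phi> g) = \<phi> (rng G g) \<and> src H (\<phi> g) = \<phi> (src G g)) \<and>
     (\<forall>g\<in>arrows G. \<forall>h\<in>arrows G. src G g = rng G h \<longrightarrow> \<phi> (gmul G g h) = gmul H (\<phi> g) (\<phi> h))"

definition continuous_hom :: "'a groupoid \<Rightarrow> 'b groupoid \<Rightarrow> ('a \<Rightarrow> 'b) \<Rightarrow> bool" where
  "continuous_hom G H \<phi> \<longleftrightarrow> groupoid_hom G H \<phi> \<and> continuous_map (gtop G) (gtop H) \<phi>"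

definition etale_hom :: "'a groupoid \<Rightarrow> 'b groupoid \<Rightarrow> ('a \<Rightarrow> 'b) \<Rightarrow> bool" where
  "etale_hom G H \<phi> \<longleftrightarrow> groupoid_hom G H \<phi> \<and> local_homeomorphism (gtop G) (gtop H) \<phi>"

definition groupoid_iso :: "'a groupoid \<Rightarrow> 'b groupoid \<Rightarrow> ('a \<Rightarrow> 'b) \<Rightarrow> bool" where
  "groupoid_iso G H \<phi> \<longleftrightarrow> groupoid_hom G H \<phi> \<and> homeomorphic_map (gtop G) (gtop H) \<phi>"

definition isomorphic_groupoids :: "'a groupoid \<Rightarrow> 'b groupoid \<Rightarrow> bool" where
  "isomorphic_groupoids G H \<longleftrightarrow> (\<exists>\<phi>. groupoid_iso G H \<phi>)"


section \<open>Similarity\<close>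

definition similar_homs :: "'a groupoid \<Rightarrow> 'b groupoid \<Rightarrow> ('a \<Rightarrow> 'b) \<Rightarrow> ('a \<Rightarrow> 'b) \<Rightarrow> bool" where
  "similar_homs G H \<rho> \<sigma> \<longleftrightarrow>
     continuous_hom G H \<rho> \<and> continuous_hom G H \<sigma> \<and>
     (\<exists>\<theta>. continuous_map (unit_space G) (gtop H) \<theta> \<and>
        (\<forall>g\<in>arrows G.
           src H (\<theta> (rng G g)) = rng H (\<rho> g) \<and>
           src H (\<sigma> g) = rng H (\<theta> (src G g)) \<and>
           gmul H (\<theta> (rng G g)) (\<rho> g) = gmul H (\<sigma> g) (\<theta> (src G g))))"

definition similarity :: "'a groupoid \<Rightarrow> 'b groupoid \<Rightarrow> ('a \<Rightarrow> 'b) \<Rightarrow> bool" where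
  "similarity G H \<rho> \<longleftrightarrow>
     etale_hom G H \<rho> \<and>
     (\<exists>\<sigma>. etale_hom H G \<sigma> \<and> similar_homs G G (\<sigma> \<circ> \<rho>) id \<and> similar_homs H H (\<rho> \<circ> \<sigma>) id)"

definition similar_groupoids :: "'a groupoid \<Rightarrow> 'b groupoid \<Rightarrow> bool" where
  "similar_groupoids G H \<longleftrightarrow> (\<exists>\<rho>. similarity G H \<rho>)"


section \<open>Ampliations and Morita equivalence\<close>

text \<open>
  \<open>pullback_groupoid X \<psi> G\<close> is the groupoid written \<open>G\<^sup>\<psi>\<close>; it is called an ampliation when \<open>\<psi>\<close> is a
  surjective local homeomorphism.  The general case serves for the target groupoid in the
  definition of a weak equivalence.
\<close>

definition pullback_groupoid :: "'x topology \<Rightarrow> ('x \<Rightarrow> 'a) \<Rightarrow> 'a groupoid \<Rightarrow> ('x \<times> 'a \<times> 'x) groupoid" where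
  "pullback_groupoid X \<psi> G =
     \<lparr>gtop = subtopology (prod_topology X (prod_topology (gtop G) X))
               {(x, g, y). \<psi> x = rng G g \<and> \<psi> y = src G g},
      rng = (\<lambda>(x, g, y). (x, rng G g, x)),
      src = (\<lambda>(x, g, y). (y, src G g, y)),
      gmul = (\<lambda>(x, g, y) (y', h, z). (x, gmul G g h, z)),
      ginv = (\<lambda>(x, g, y). (y, ginv G g, x))\<rparr>"

definition ampliation_map :: "'x topology \<Rightarrow> 'a groupoid \<Rightarrow> ('x \<Rightarrow> 'a) \<Rightarrow> bool" where
  "ampliation_map X G \<psi> \<longleftrightarrow>
     locally_compact_space X \<and> Hausdorff_space X \<and>
     local_homeomorphism X (unit_space G) \<psi> \<and> \<psi> ` topspace X = units G"

text \<open>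
  The \<open>itself\<close> arguments here and below carry the type over which the auxiliary object is
  existentially quantified.  When such a notion is used as a hypothesis with a type variable
  that is otherwise unconstrained, the auxiliary object ranges over all types.
\<close>

definition isomorphic_ampliations ::
    "'x itself \<Rightarrow> 'y itself \<Rightarrow> 'a groupoid \<Rightarrow> 'b groupoid \<Rightarrow> bool" where
  "isomorphic_ampliations tyx tyy G H \<longleftrightarrow>
     (\<exists>(X :: 'x topology) \<psi> (Y :: 'y topology) \<eta>. ampliation_map X G \<psi> \<and> ampliation_map Y H \<eta> \<and>
        isomorphic_groupoids (pullback_groupoid X \<psi> G) (pullback_groupoid Y \<eta> H))"

definition weak_equivalence :: "'a groupoid \<Rightarrow> 'b groupoid \<Rightarrow> ('a \<Rightarrow> 'b) \<Rightarrow> bool" where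
  "weak_equivalence G H \<phi> \<longleftrightarrow>
     continuous_hom G H \<phi> \<and>
     (let P = subtopology (prod_topology (unit_space G) (gtop H)) {(u, h). \<phi> u = rng H h} in
        local_homeomorphism P (unit_space H) (\<lambda>(u, h). src H h) \<and>
        (\<lambda>(u, h). src H h) ` topspace P = units H) \<and>
     groupoid_iso G (pullback_groupoid (unit_space G) \<phi> H) (\<lambda>g. (rng G g, \<phi> g, src G g))"

definition morita_equivalent :: "'k itself \<Rightarrow> 'a groupoid \<Rightarrow> 'b groupoid \<Rightarrow> bool" where
  "morita_equivalent tyk G H \<longleftrightarrow>
     (\<exists>(K :: 'k groupoid) \<phi> \<psi>. etale_groupoid K \<and> Hausdorff_groupoid K \<and>
        weak_equivalence K G \<phi> \<and> weak_equivalence K H \<psi>)"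

definition linking_equivalent :: "'l itself \<Rightarrow> 'a groupoid \<Rightarrow> 'b groupoid \<Rightarrow> bool" where
  "linking_equivalent tyl G H \<longleftrightarrow>
     (\<exists>(L :: 'l groupoid) X Y. ample_groupoid L \<and> Hausdorff_groupoid L \<and>
        X \<union> Y = units L \<and> X \<inter> Y = {} \<and>
        openin (unit_space L) X \<and> closedin (unit_space L) X \<and> full L X \<and>
        openin (unit_space L) Y \<and> closedin (unit_space L) Y \<and> full L Y \<and>
        isomorphic_groupoids (restriction L X) G \<and> isomorphic_groupoids (restriction L Y) H)"


section \<open>Equivalence in the sense of Renault\<close>

definition left_pairs :: "'a groupoid \<Rightarrow> 'z topology \<Rightarrow> ('z \<Rightarrow> 'a) \<Rightarrow> ('a \<times> 'z) topology" where
  "left_pairs G Z r = subtopology (prod_topology (gtop G) Z) {(g, z). src G g = r z}"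

definition left_space :: "'a groupoid \<Rightarrow> 'z topology \<Rightarrow> ('z \<Rightarrow> 'a) \<Rightarrow> ('a \<Rightarrow> 'z \<Rightarrow> 'z) \<Rightarrow> bool" where
  "left_space G Z r act \<longleftrightarrow>
     locally_compact_space Z \<and> Hausdorff_space Z \<and>
     continuous_map Z (unit_space G) r \<and> open_map Z (unit_space G) r \<and>
     continuous_map (left_pairs G Z r) Z (\<lambda>(g, z). act g z) \<and>
     (\<forall>g\<in>arrows G. \<forall>z\<in>topspace Z. src G g = r z \<longrightarrow> r (act g z) = rng G g) \<and>
     (\<forall>g\<in>arrows G. \<forall>h\<in>arrows G. \<forall>z\<in>topspace Z. src G g = rng G h \<longrightarrow> src G h = r z \<longrightarrow>
        act (gmul G g h) z = act g (act h z)) \<and>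
     (\<forall>z\<in>topspace Z. act (r z) z = z)"

definition free_proper_left_space ::
    "'a groupoid \<Rightarrow> 'z topology \<Rightarrow> ('z \<Rightarrow> 'a) \<Rightarrow> ('a \<Rightarrow> 'z \<Rightarrow> 'z) \<Rightarrow> bool" where
  "free_proper_left_space G Z r act \<longleftrightarrow>
     left_space G Z r act \<and>
     inj_on (\<lambda>(g, z). (act g z, z)) (topspace (left_pairs G Z r)) \<and>
     proper_map (left_pairs G Z r) (prod_topology Z Z) (\<lambda>(g, z). (act g z, z))"

definition left_orbit :: "'a groupoid \<Rightarrow> ('z \<Rightarrow> 'a) \<Rightarrow> ('a \<Rightarrow> 'z \<Rightarrow> 'z) \<Rightarrow> 'z \<Rightarrow> 'z set" where
  "left_orbit G r act z = {act g z | g. g \<in> arrows G \<and> src G g = r z}"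

definition right_pairs :: "'b groupoid \<Rightarrow> 'z topology \<Rightarrow> ('z \<Rightarrow> 'b) \<Rightarrow> ('z \<times> 'b) topology" where
  "right_pairs H Z s = subtopology (prod_topology Z (gtop H)) {(z, h). s z = rng H h}"

definition right_space :: "'b groupoid \<Rightarrow> 'z topology \<Rightarrow> ('z \<Rightarrow> 'b) \<Rightarrow> ('z \<Rightarrow> 'b \<Rightarrow> 'z) \<Rightarrow> bool" where
  "right_space H Z s act \<longleftrightarrow>
     locally_compact_space Z \<and> Hausdorff_space Z \<and>
     continuous_map Z (unit_space H) s \<and> open_map Z (unit_space H) s \<and>
     continuous_map (right_pairs H Z s) Z (\<lambda>(z, h). act z h) \<and>
     (\<forall>z\<in>topspace Z. \<forall>h\<in>arrows H. s z = rng H h \<longrightarrow> s (act z h) = src H h) \<and>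
     (\<forall>z\<in>topspace Z. \<forall>h\<in>arrows H. \<forall>k\<in>arrows H. s z = rng H h \<longrightarrow> src H h = rng H k \<longrightarrow>
        act z (gmul H h k) = act (act z h) k) \<and>
     (\<forall>z\<in>topspace Z. act z (s z) = z)"

definition free_proper_right_space ::
    "'b groupoid \<Rightarrow> 'z topology \<Rightarrow> ('z \<Rightarrow> 'b) \<Rightarrow> ('z \<Rightarrow> 'b \<Rightarrow> 'z) \<Rightarrow> bool" where
  "free_proper_right_space H Z s act \<longleftrightarrow>
     right_space H Z s act \<and>
     inj_on (\<lambda>(z, h). (z, act z h)) (topspace (right_pairs H Z s)) \<and>
     proper_map (right_pairs H Z s) (prod_topology Z Z) (\<lambda>(z, h). (z, act z h))"

definition right_orbit :: "'b groupoid \<Rightarrow> ('z \<Rightarrow> 'b) \<Rightarrow> ('z \<Rightarrow> 'b \<Rightarrow> 'z) \<Rightarrow> 'z \<Rightarrow> 'z set" where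
  "right_orbit H s act z = {act z h | h. h \<in> arrows H \<and> s z = rng H h}"

text \<open>
  Commutation of the actions includes invariance of each fibre map under the other action;
  otherwise the two sides of \<open>(g \<cdot> z) \<cdot> h = g \<cdot> (z \<cdot> h)\<close> need not both be defined.
\<close>

definition commuting_actions ::
    "'a groupoid \<Rightarrow> 'b groupoid \<Rightarrow> 'z topology \<Rightarrow> ('z \<Rightarrow> 'a) \<Rightarrow> ('z \<Rightarrow> 'b) \<Rightarrow>
     ('a \<Rightarrow> 'z \<Rightarrow> 'z) \<Rightarrow> ('z \<Rightarrow> 'b \<Rightarrow> 'z) \<Rightarrow> bool" where
  "commuting_actions G H Z r s lact ract \<longleftrightarrow>
     (\<forall>g\<in>arrows G. \<forall>z\<in>topspace Z. src G g = r z \<longrightarrow> s (lact g z) = s z) \<and>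
     (\<forall>z\<in>topspace Z. \<forall>h\<in>arrows H. s z = rng H h \<longrightarrow> r (ract z h) = r z) \<and>
     (\<forall>g\<in>arrows G. \<forall>z\<in>topspace Z. \<forall>h\<in>arrows H. src G g = r z \<longrightarrow> s z = rng H h \<longrightarrow>
        ract (lact g z) h = lact g (ract z h))"

text \<open>\<open>f\<close> descends along \<open>q\<close> to a homeomorphism from the quotient of \<open>Z\<close> onto \<open>Y\<close>.\<close>

definition induces_homeomorphism ::
    "'z topology \<Rightarrow> ('z \<Rightarrow> 'q) \<Rightarrow> 'y topology \<Rightarrow> ('z \<Rightarrow> 'y) \<Rightarrow> bool" where
  "induces_homeomorphism Z q Y f \<longleftrightarrow>
     (\<exists>f'. homeomorphic_map (quotient_topology Z q) Y f' \<and> (\<forall>z\<in>topspace Z. f' (q z) = f z))"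

definition renault_equivalent :: "'z itself \<Rightarrow> 'a groupoid \<Rightarrow> 'b groupoid \<Rightarrow> bool" where
  "renault_equivalent tyz G H \<longleftrightarrow>
     (\<exists>(Z :: 'z topology) r s lact ract.
        free_proper_left_space G Z r lact \<and> free_proper_right_space H Z s ract \<and>
        commuting_actions G H Z r s lact ract \<and>
        induces_homeomorphism Z (right_orbit H s ract) (unit_space G) r \<and>
        induces_homeomorphism Z (left_orbit G r lact) (unit_space H) s)"


section \<open>Stable isomorphism and Kakutani equivalence\<close>

definition product_groupoid :: "'a groupoid \<Rightarrow> 'b groupoid \<Rightarrow> ('a \<times> 'b) groupoid" where
  "product_groupoid G H =
     \<lparr>gtop = prod_topology (gtop G) (gtop H),
      rng = (\<lambda>(g, h). (rng G g, rng H h)),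
      src = (\<lambda>(g, h). (src G g, src H h)),
      gmul = (\<lambda>(g, h) (g', h'). (gmul G g g', gmul H h h')),
      ginv = (\<lambda>(g, h). (ginv G g, ginv H h))\<rparr>"

definition full_equivalence_relation :: "(nat \<times> nat) groupoid" where
  "full_equivalence_relation =
     \<lparr>gtop = discrete_topology UNIV,
      rng = (\<lambda>(m, n). (m, m)),
      src = (\<lambda>(m, n). (n, n)),
      gmul = (\<lambda>(m, n) (n', p). (m, p)),
      ginv = (\<lambda>(m, n). (n, m))\<rparr>"

definition weakly_kakutani_equivalent :: "'a groupoid \<Rightarrow> 'b groupoid \<Rightarrow> bool" where
  "weakly_kakutani_equivalent G H \<longleftrightarrow>
     (\<exists>X Y. openin (unit_space G) X \<and> full G X \<and> openin (unit_space H) Y \<and> full H Y \<and>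
        isomorphic_groupoids (restriction G X) (restriction H Y))"

definition kakutani_equivalent :: "'a groupoid \<Rightarrow> 'b groupoid \<Rightarrow> bool" where
  "kakutani_equivalent G H \<longleftrightarrow>
     (\<exists>X Y. openin (unit_space G) X \<and> closedin (unit_space G) X \<and> full G X \<and>
        openin (unit_space H) Y \<and> closedin (unit_space H) Y \<and> full H Y \<and>
        isomorphic_groupoids (restriction G X) (restriction H Y))"


section \<open>Groupoid homology\<close>

text \<open>
  Elements of \<open>C\<^sub>c(X, \<int>)\<close> are represented by their extension by zero to the whole type, so that
  equality of functions is equality in \<open>C\<^sub>c(X, \<int>)\<close>.
\<close>

definition compactly_supported :: "'x topology \<Rightarrow> ('x \<Rightarrow> int) set" where
  "compactly_supported X =
     {f. continuous_map X (discrete_topology UNIV) f \<and>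
         compactin X (X closure_of {x \<in> topspace X. f x \<noteq> 0}) \<and>
         (\<forall>x. x \<notin> topspace X \<longrightarrow> f x = 0)}"

text \<open>
  The sum runs over the part of the fibre where \<open>f\<close> does not vanish: this set is finite when \<open>f\<close>
  is compactly supported and \<open>\<psi>\<close> is a local homeomorphism, whereas the fibre may be infinite,
  in which case a sum over it would be \<open>0\<close> by convention.
\<close>

definition pushforward :: "'y topology \<Rightarrow> ('y \<Rightarrow> 'x) \<Rightarrow> ('y \<Rightarrow> int) \<Rightarrow> 'x \<Rightarrow> int" where
  "pushforward Y \<psi> f x = (\<Sum>y | y \<in> topspace Y \<and> \<psi> y = x \<and> f y \<noteq> 0. f y)"

text \<open>
  A composable tuple \<open>(g\<^sub>1, \<dots>, g\<^sub>n)\<close> is a function on \<open>{1..n}\<close>.  So that all degrees share one type,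
  the unit space (degree \<open>0\<close>) is represented by the \<open>1\<close>-tuples whose entry is a unit.
\<close>

definition nerve :: "'a groupoid \<Rightarrow> nat \<Rightarrow> (nat \<Rightarrow> 'a) set" where
  "nerve G n =
     (if n = 0 then {1..1} \<rightarrow>\<^sub>E units G
      else {g \<in> {1..n} \<rightarrow>\<^sub>E arrows G. \<forall>i\<in>{1..<n}. src G (g i) = rng G (g (i + 1))})"

definition nerve_space :: "'a groupoid \<Rightarrow> nat \<Rightarrow> (nat \<Rightarrow> 'a) topology" where
  "nerve_space G n = subtopology (product_topology (\<lambda>_. gtop G) {1..max 1 n}) (nerve G n)"

definition nerve_map :: "nat \<Rightarrow> ('a \<Rightarrow> 'b) \<Rightarrow> (nat \<Rightarrow> 'a) \<Rightarrow> (nat \<Rightarrow> 'b)" where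
  "nerve_map n \<phi> g = (\<lambda>k\<in>{1..max 1 n}. \<phi> (g k))"

text \<open>
  The face map \<open>d\<^sub>i\<close> on composable \<open>n\<close>-tuples for \<open>n \<ge> 2\<close>; for \<open>i = 0\<close> and \<open>i = n\<close> the middle case
  does not occur, and the first or the last entry is dropped.
\<close>

definition face :: "'a groupoid \<Rightarrow> nat \<Rightarrow> nat \<Rightarrow> (nat \<Rightarrow> 'a) \<Rightarrow> (nat \<Rightarrow> 'a)" where
  "face G n i g =
     (\<lambda>k\<in>{1..n - 1}. if k < i then g k else if k = i then gmul G (g i) (g (i + 1)) else g (k + 1))"

definition boundary :: "'a groupoid \<Rightarrow> nat \<Rightarrow> ((nat \<Rightarrow> 'a) \<Rightarrow> int) \<Rightarrow> ((nat \<Rightarrow> 'a) \<Rightarrow> int)" where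
  "boundary G n f =
     (if n = 0 then (\<lambda>x. 0)
      else if n = 1 then
        (\<lambda>x. pushforward (nerve_space G 1) (nerve_map 0 (src G)) f x
           - pushforward (nerve_space G 1) (nerve_map 0 (rng G)) f x)
      else (\<lambda>x. \<Sum>i=0..n. (-1) ^ i * pushforward (nerve_space G n) (face G n i) f x))"

definition chain_group :: "'a groupoid \<Rightarrow> nat \<Rightarrow> ((nat \<Rightarrow> 'a) \<Rightarrow> int) monoid" where
  "chain_group G n =
     \<lparr>carrier = compactly_supported (nerve_space G n),
      monoid.mult = (\<lambda>f f' x. f x + f' x),
      one = (\<lambda>x. 0)\<rparr>"

definition cycle_group :: "'a groupoid \<Rightarrow> nat \<Rightarrow> ((nat \<Rightarrow> 'a) \<Rightarrow> int) monoid" where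
  "cycle_group G n =
     (chain_group G n)\<lparr>carrier := {f \<in> carrier (chain_group G n). boundary G n f = (\<lambda>x. 0)}\<rparr>"

definition boundaries :: "'a groupoid \<Rightarrow> nat \<Rightarrow> ((nat \<Rightarrow> 'a) \<Rightarrow> int) set" where
  "boundaries G n = boundary G (n + 1) ` carrier (chain_group G (n + 1))"

definition homology_group :: "'a groupoid \<Rightarrow> nat \<Rightarrow> ((nat \<Rightarrow> 'a) \<Rightarrow> int) set monoid" where
  "homology_group G n = cycle_group G n Mod boundaries G n"

text \<open>
  The class of a cycle \<open>f\<close> is sent to the class of its pushforward; for an etale homomorphism all
  members of the union coincide.
\<close>

definition homology_map ::
    "'a groupoid \<Rightarrow> 'b groupoid \<Rightarrow> ('a \<Rightarrow> 'b) \<Rightarrow> nat \<Rightarrow>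
     ((nat \<Rightarrow> 'a) \<Rightarrow> int) set \<Rightarrow> ((nat \<Rightarrow> 'b) \<Rightarrow> int) set" where
  "homology_map G H \<phi> n c =
     (\<Union>f\<in>c. boundaries H n #>\<^bsub>cycle_group H n\<^esub> pushforward (nerve_space G n) (nerve_map n \<phi>) f)"

end

theory Submission
  imports Defs
begin

text \<open>
  The eight relations are reduced to one notion: an etale homomorphism \<open>\<phi> : K \<rightarrow> G\<close> that is fully
  faithful and essentially surjective.  If the unit space of \<open>G\<close> is zero-dimensional and
  \<open>\<sigma>\<close>-compact, then the surjective local homeomorphism \<open>(u, g) \<mapsto> s(g)\<close> from
  \<open>{(u, g). \<phi>(u) = r(g)}\<close> to the units of \<open>G\<close> has a continuous section, because a countable cover by
  compact open sets can be made disjoint.  Conjugation by the section is an inverse of \<open>\<phi>\<close> up to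
  similarity.  Each relation yields a groupoid \<open>K\<close> with such maps to both \<open>G\<close> and \<open>H\<close>, or, for a
  linking groupoid \<open>L\<close>, such maps from \<open>L|X\<close> to \<open>G\<close> and \<open>L\<close> and from \<open>L|Y\<close> to \<open>L\<close> and \<open>H\<close>.

  A similarity is a natural transformation, so it gives prism operators between the nerves and hence
  a chain homotopy.  Faces, prisms and induced maps are continuous, and followed by a vertex map of
  the nerve they are local homeomorphisms; as the vertex maps are local homeomorphisms too, so are
  all these maps, and they can be pushed forward along.
\<close>


section \<open>Local homeomorphisms\<close>

text \<open>Functions can be pushed forward only along local homeomorphisms, so it is not enough
  that the functors and homotopies are continuous. The remedy is cancellation: if f is continuous
  and both p and p after f are local homeomorphisms, then so is f. Besides the maps into a nerve, it
  treats the section t over the units of G: a projection after t is the identity, so t is a local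
  homeomorphism, and this makes the quasi-inverse built from t etale. A second obstacle is
  continuity of lifts. Full faithfulness gives arrows only pointwise; they vary continuously because
  \<phi> is locally injective on units, which pins down the endpoints of a nearby preimage. In a
  Renault equivalence the fibre maps are only given as open maps. That they are local homeomorphisms
  is extracted from freeness, properness and openness of the units, and then the ampliation along r
  can serve as the common groupoid. For a linking groupoid, \<sigma>-compactness of the units has to
  be assembled from the two pieces, which are copies of the units of G and of H.\<close>

text \<open>Splitting the notion into continuity, openness and local injectivity lets each of the
  three be carried through composition, restriction and pullback on its own.\<close>

lemma local_homeomorphism_iff:
  "local_homeomorphism X Y f \<longleftrightarrow>
     continuous_map X Y f \<and> open_map X Y f \<and>
     (\<forall>x\<in>topspace X. \<exists>U. openin X U \<and> x \<in> U \<and> inj_on f U)"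
  (is "_ \<longleftrightarrow> ?R")
proof
  assume L: "local_homeomorphism X Y f"
  have nbhd: "\<exists>U. openin X U \<and> x \<in> U \<and> openin Y (f ` U) \<and>
        homeomorphic_map (subtopology X U) (subtopology Y (f ` U)) f" if "x \<in> topspace X" for x
    using L that by (auto simp: local_homeomorphism_def)
  have om: "open_map X Y f"
    unfolding open_map_def
  proof (intro allI impI)
    fix O1 assume O1: "openin X O1"
    show "openin Y (f ` O1)"
    proof (subst openin_subopen, intro ballI)
      fix y assume "y \<in> f ` O1"
      then obtain x where x: "x \<in> O1" "y = f x" by blast
      with O1 nbhd[of x] obtain U where U: "openin X U" "x \<in> U" "openin Y (f ` U)"
        "homeomorphic_map (subtopology X U) (subtopology Y (f ` U)) f"
        using openin_subset by blast
      have "openin (subtopology X U) (O1 \<inter> U)"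
        by (simp add: O1 openin_subtopology_Int)
      then have "openin (subtopology Y (f ` U)) (f ` (O1 \<inter> U))"
        using homeomorphic_imp_open_map[OF U(4)] by (simp add: open_map_def)
      then have "openin Y (f ` (O1 \<inter> U))"
        using U(3) openin_trans_full by blast
      then show "\<exists>T. openin Y T \<and> y \<in> T \<and> T \<subseteq> f ` O1"
        using x U(2) by blast
    qed
  qed
  moreover have "continuous_map X Y f"
  proof -
    have "openin X {x \<in> topspace X. f x \<in> V}" if V: "openin Y V" for V
    proof (subst openin_subopen, intro ballI)
      fix x assume "x \<in> {x \<in> topspace X. f x \<in> V}"
      then have x: "x \<in> topspace X" "f x \<in> V" by auto
      with nbhd[of x] obtain U where U: "openin X U" "x \<in> U" "openin Y (f ` U)"
        "homeomorphic_map (subtopology X U) (subtopology Y (f ` U)) f" by blast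
      have "continuous_map (subtopology X U) Y f"
        using U(4) homeomorphic_imp_continuous_map continuous_map_into_fulltopology by blast
      then have "openin (subtopology X U) {x \<in> topspace (subtopology X U). f x \<in> V}"
        using V openin_continuous_map_preimage by blast
      then have "openin X {x \<in> topspace (subtopology X U). f x \<in> V}"
        using U(1) openin_trans_full by blast
      then show "\<exists>T. openin X T \<and> x \<in> T \<and> T \<subseteq> {x \<in> topspace X. f x \<in> V}"
        using x U(2) by (intro exI[of _ "{x \<in> topspace (subtopology X U). f x \<in> V}"]) auto
    qed
    then show ?thesis
      using open_map_imp_subset_topspace[OF om] by (auto simp: continuous_map)
  qed
  moreover have "\<forall>x\<in>topspace X. \<exists>U. openin X U \<and> x \<in> U \<and> inj_on f U"
  proof
    fix x assume "x \<in> topspace X"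
    with nbhd[of x] obtain U where U: "openin X U" "x \<in> U" 
        "homeomorphic_map (subtopology X U) (subtopology Y (f ` U)) f" by blast
    moreover have "inj_on f U"
      using homeomorphic_imp_injective_map[OF U(3)] openin_subset[OF U(1)]
      by (simp add: Int_absorb1)
    ultimately show "\<exists>U. openin X U \<and> x \<in> U \<and> inj_on f U" by blast
  qed
  ultimately show ?R by blast
next
  assume R: ?R
  show "local_homeomorphism X Y f"
    unfolding local_homeomorphism_def
  proof
    fix x assume "x \<in> topspace X"
    with R obtain U where U: "openin X U" "x \<in> U" "inj_on f U" by blast
    have o: "openin Y (f ` U)"
      using R U(1) by (simp add: open_map_def)
    have "open_map (subtopology X U) (subtopology Y (f ` U)) f"
      by (rule open_map_into_subtopology) (use R U(1) open_map_from_subtopology in auto)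
    moreover have "continuous_map (subtopology X U) (subtopology Y (f ` U)) f"
      by (rule continuous_map_into_subtopology) (use R continuous_map_from_subtopology in auto)
    moreover have "topspace (subtopology X U) = U" "topspace (subtopology Y (f ` U)) = f ` U"
      using openin_subset[OF U(1)] openin_subset[OF o] by (auto simp: Int_absorb1)
    ultimately have "homeomorphic_map (subtopology X U) (subtopology Y (f ` U)) f"
      using U(3) by (auto intro!: bijective_open_imp_homeomorphic_map)
    with U o show "\<exists>U. openin X U \<and> x \<in> U \<and> openin Y (f ` U) \<and>
        homeomorphic_map (subtopology X U) (subtopology Y (f ` U)) f" by blast
  qed
qed

lemma local_homeomorphismI:
  assumes "continuous_map X Y f" "open_map X Y f"
    and "\<And>x. x \<in> topspace X \<Longrightarrow> \<exists>U. openin X U \<and> x \<in> U \<and> inj_on f U"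
  shows "local_homeomorphism X Y f"
  using assms by (auto simp: local_homeomorphism_iff)

lemma local_homeomorphism_imp_continuous_map:
  "local_homeomorphism X Y f \<Longrightarrow> continuous_map X Y f"
  by (simp add: local_homeomorphism_iff)

lemma local_homeomorphism_imp_open_map:
  "local_homeomorphism X Y f \<Longrightarrow> open_map X Y f"
  by (simp add: local_homeomorphism_iff)

lemma local_homeomorphism_locally_inj:
  assumes "local_homeomorphism X Y f" "x \<in> topspace X"
  obtains U where "openin X U" "x \<in> U" "inj_on f U" "openin Y (f ` U)"
  using assms unfolding local_homeomorphism_iff open_map_def by blast

lemma local_homeomorphism_apply:
  "local_homeomorphism X Y f \<Longrightarrow> x \<in> topspace X \<Longrightarrow> f x \<in> topspace Y"
  using local_homeomorphism_imp_continuous_map continuous_map_image_subset_topspace by blast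

lemma local_homeomorphism_compose:
  assumes f: "local_homeomorphism X Y f" and g: "local_homeomorphism Y Z g"
  shows "local_homeomorphism X Z (g \<circ> f)"
proof (rule local_homeomorphismI)
  show "continuous_map X Z (g \<circ> f)" "open_map X Z (g \<circ> f)"
    using f g by (auto simp: local_homeomorphism_iff intro: continuous_map_compose open_map_compose)
  fix x assume x: "x \<in> topspace X"
  obtain U where U: "openin X U" "x \<in> U" "inj_on f U"
    using local_homeomorphism_locally_inj[OF f x] by blast
  obtain V where V: "openin Y V" "f x \<in> V" "inj_on g V"
    using local_homeomorphism_locally_inj[OF g local_homeomorphism_apply[OF f x]] by blast
  have "openin X (U \<inter> {x \<in> topspace X. f x \<in> V})"
    using U V f by (intro openin_Int openin_continuous_map_preimage) (auto simp: local_homeomorphism_iff)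
  moreover have "inj_on (g \<circ> f) (U \<inter> {x \<in> topspace X. f x \<in> V})"
    using U(3) V(3) by (auto simp: inj_on_def)
  ultimately show "\<exists>U. openin X U \<and> x \<in> U \<and> inj_on (g \<circ> f) U"
    using x U V by blast
qed

lemma local_homeomorphism_compose':
  assumes "local_homeomorphism X Y f" "local_homeomorphism Y Z g"
  shows "local_homeomorphism X Z (\<lambda>x. g (f x))"
  using local_homeomorphism_compose[OF assms] by (simp add: o_def)

lemma local_homeomorphism_eq:
  assumes "local_homeomorphism X Y f" "\<And>x. x \<in> topspace X \<Longrightarrow> f x = g x"
  shows "local_homeomorphism X Y g"
proof (rule local_homeomorphismI)
  show "continuous_map X Y g" 
    using assms continuous_map_eq local_homeomorphism_imp_continuous_map by metis
  show "open_map X Y g"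
    using assms open_map_eq local_homeomorphism_imp_open_map by metis
  fix x assume "x \<in> topspace X"
  then obtain U where U: "openin X U" "x \<in> U" "inj_on f U"
    using local_homeomorphism_locally_inj[OF assms(1)] by blast
  moreover have "inj_on g U"
    using U(3) assms(2) openin_subset[OF U(1)] inj_on_cong[of U f g] by blast
  ultimately show "\<exists>U. openin X U \<and> x \<in> U \<and> inj_on g U" by blast
qed

text \<open>Near a point, f is a local inverse of p applied to p after f. If p is injective on an
  open W around f x, then the points of W whose p-value is attained by p after f on the part of U
  that f sends into W all lie in f(U); this gives openness. Injectivity of p after f forces that of
  f.\<close>

lemma local_homeomorphism_cancel:
  assumes pf: "local_homeomorphism X Z (\<lambda>x. p (f x))" and p: "local_homeomorphism Y Z p"
    and f: "continuous_map X Y f"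
  shows "local_homeomorphism X Y f"
proof (rule local_homeomorphismI[OF f])
  show "open_map X Y f"
    unfolding open_map_def
  proof (intro allI impI)
    fix U assume U: "openin X U"
    show "openin Y (f ` U)"
    proof (subst openin_subopen, intro ballI)
      fix y assume "y \<in> f ` U"
      then obtain x where x: "x \<in> U" "y = f x" by blast
      then have "x \<in> topspace X" using U openin_subset by blast
      then have "y \<in> topspace Y"
        using f x continuous_map_image_subset_topspace by blast
      then obtain W where W: "openin Y W" "y \<in> W" "inj_on p W"
        using local_homeomorphism_locally_inj[OF p] by blast
      define U' where "U' = U \<inter> {x \<in> topspace X. f x \<in> W}"
      have "openin X U'"
        unfolding U'_def using U W f by (intro openin_Int openin_continuous_map_preimage)
      then have "openin Z ((\<lambda>x. p (f x)) ` U')"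
        using pf unfolding local_homeomorphism_iff open_map_def by blast
      then have "openin Y {y \<in> topspace Y. p y \<in> (\<lambda>x. p (f x)) ` U'}"
        using p local_homeomorphism_imp_continuous_map openin_continuous_map_preimage by blast
      then have "openin Y (W \<inter> {y \<in> topspace Y. p y \<in> (\<lambda>x. p (f x)) ` U'})"
        using W(1) by blast
      moreover have "W \<inter> {y \<in> topspace Y. p y \<in> (\<lambda>x. p (f x)) ` U'} \<subseteq> f ` U"
        using W(3) by (auto simp: U'_def inj_on_def) 
      moreover have "x \<in> U'"
        using x W \<open>x \<in> topspace X\<close> by (auto simp: U'_def)
      then have "y \<in> W \<inter> {y \<in> topspace Y. p y \<in> (\<lambda>x. p (f x)) ` U'}"
        using x(2) W(2) \<open>y \<in> topspace Y\<close> by blast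
      ultimately show "\<exists>T. openin Y T \<and> y \<in> T \<and> T \<subseteq> f ` U" by blast
    qed
  qed
  fix x assume "x \<in> topspace X"
  then obtain U where U: "openin X U" "x \<in> U" "inj_on (\<lambda>x. p (f x)) U"
    using local_homeomorphism_locally_inj[OF pf] by blast
  then show "\<exists>U. openin X U \<and> x \<in> U \<and> inj_on f U"
    by (metis (no_types, lifting) inj_on_def)
qed

lemma homeomorphic_imp_local_homeomorphism:
  assumes "homeomorphic_map X Y f"
  shows "local_homeomorphism X Y f"
proof (rule local_homeomorphismI)
  show "continuous_map X Y f" "open_map X Y f"
    using assms homeomorphic_imp_continuous_map homeomorphic_imp_open_map by blast+
  show "\<exists>U. openin X U \<and> x \<in> U \<and> inj_on f U" if "x \<in> topspace X" for x
    using that assms homeomorphic_imp_injective_map by blast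
qed

lemma local_homeomorphism_from_open_subtopology:
  assumes f: "local_homeomorphism X Y f" and U: "openin X U"
  shows "local_homeomorphism (subtopology X U) Y f"
proof (rule local_homeomorphismI)
  show "continuous_map (subtopology X U) Y f" "open_map (subtopology X U) Y f"
    using f U by (auto simp: local_homeomorphism_iff continuous_map_from_subtopology open_map_from_subtopology)
  fix x assume "x \<in> topspace (subtopology X U)"
  then have x: "x \<in> topspace X" "x \<in> U" by auto
  obtain V where V: "openin X V" "x \<in> V" "inj_on f V"
    using local_homeomorphism_locally_inj[OF f x(1)] by blast
  have "openin (subtopology X U) (V \<inter> U)"
    using V openin_subtopology_Int by blast
  moreover have "inj_on f (V \<inter> U)"
    using V(3) inj_on_subset by blast
  ultimately show "\<exists>V. openin (subtopology X U) V \<and> x \<in> V \<and> inj_on f V"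
    using V x by blast
qed

lemma local_homeomorphism_into_subtopology:
  assumes f: "local_homeomorphism X Y f" and S: "\<And>x. x \<in> topspace X \<Longrightarrow> f x \<in> S"
  shows "local_homeomorphism X (subtopology Y S) f"
  using assms
  by (auto simp: local_homeomorphism_iff continuous_map_in_subtopology intro!: open_map_into_subtopology)

lemma local_homeomorphism_into_fulltopology:
  assumes "local_homeomorphism X (subtopology Y S) f" "openin Y S"
  shows "local_homeomorphism X Y f"
  using assms open_map_from_open_subtopology
  by (auto simp: local_homeomorphism_iff continuous_map_in_subtopology)

text \<open>Base change. The image of a small rectangle U x V contains the points of V that f sends
  into \<psi>(U), an open set because \<psi> is open. Once \<psi> is injective on U, a pair (x, y)
  with x in U is determined by y. Nerves, ampliations and the space of pairs (u, g) with \<phi>(u) =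
  r(g) are all such pullbacks.\<close>

lemma local_homeomorphism_pullback:
  assumes \<psi>: "local_homeomorphism X Z \<psi>" and f: "continuous_map Y Z f"
  shows "local_homeomorphism (subtopology (prod_topology X Y) {(x, y). \<psi> x = f y}) Y snd"
    (is "local_homeomorphism ?P _ _")
proof (rule local_homeomorphismI)
  show "continuous_map ?P Y snd"
    by (simp add: continuous_map_from_subtopology continuous_map_snd)
  show "open_map ?P Y snd"
    unfolding open_map_def
  proof (intro allI impI)
    fix W assume "openin ?P W"
    then obtain W' where W': "openin (prod_topology X Y) W'" "W = W' \<inter> {(x, y). \<psi> x = f y}"
      by (auto simp: openin_subtopology)
    show "openin Y (snd ` W)"
    proof (subst openin_subopen, intro ballI)
      fix y assume "y \<in> snd ` W"
      then obtain x where xy: "(x, y) \<in> W'" "\<psi> x = f y"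
        using W' by auto
      then obtain U V where UV: "openin X U" "openin Y V" "x \<in> U" "y \<in> V" "U \<times> V \<subseteq> W'"
        using W'(1) unfolding openin_prod_topology_alt by meson
      have "openin Z (\<psi> ` U)"
        using \<psi> UV(1) by (auto simp: local_homeomorphism_iff open_map_def)
      then have "openin Y (V \<inter> {y \<in> topspace Y. f y \<in> \<psi> ` U})"
        using f UV openin_continuous_map_preimage by blast
      moreover have "y \<in> V \<inter> {y \<in> topspace Y. f y \<in> \<psi> ` U}"
        using UV xy openin_subset[OF UV(2)] by (auto intro: image_eqI[of _ _ x])
      moreover have "V \<inter> {y \<in> topspace Y. f y \<in> \<psi> ` U} \<subseteq> snd ` W"
      proof
        fix v assume v: "v \<in> V \<inter> {y \<in> topspace Y. f y \<in> \<psi> ` U}"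
        then obtain u where u: "u \<in> U" "f v = \<psi> u" by blast
        then have "(u, v) \<in> W"
          using v UV W' by auto
        then show "v \<in> snd ` W" by force
      qed
      ultimately show "\<exists>T. openin Y T \<and> y \<in> T \<and> T \<subseteq> snd ` W" by blast
    qed
  qed
  fix p assume p: "p \<in> topspace ?P"
  obtain U where U: "openin X U" "fst p \<in> U" "inj_on \<psi> U"
    by (rule local_homeomorphism_locally_inj[OF \<psi>, of "fst p"]) (use p in auto)
  have "openin ?P ((U \<times> topspace Y) \<inter> {(x, y). \<psi> x = f y})"
    using U by (intro openin_subtopology_Int) (simp add: openin_prod_Times_iff)
  moreover have "inj_on snd ((U \<times> topspace Y) \<inter> {(x, y). \<psi> x = f y})"
  proof (rule inj_onI)
    fix a b assume "a \<in> (U \<times> topspace Y) \<inter> {(x, y). \<psi> x = f y}" 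
      "b \<in> (U \<times> topspace Y) \<inter> {(x, y). \<psi> x = f y}" "snd a = snd b"
    then have "\<psi> (fst a) = \<psi> (fst b)" "fst a \<in> U" "fst b \<in> U" by auto
    with U(3) \<open>snd a = snd b\<close> show "a = b" by (auto dest: inj_onD intro: prod_eqI)
  qed
  ultimately show "\<exists>U. openin ?P U \<and> p \<in> U \<and> inj_on snd U"
    using p U(2) by (intro exI[of _ "(U \<times> topspace Y) \<inter> {(x, y). \<psi> x = f y}"] conjI) auto
qed

lemma local_homeomorphism_pullback_fst:
  assumes \<psi>: "local_homeomorphism X Z \<psi>" and f: "continuous_map Y Z f"
  shows "local_homeomorphism (subtopology (prod_topology Y X) {(y, x). f y = \<psi> x}) Y fst"
proof -
  let ?P = "subtopology (prod_topology Y X) {(y, x). f y = \<psi> x}"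
  let ?Q = "subtopology (prod_topology X Y) {(x, y). \<psi> x = f y}"
  have "homeomorphic_map ?P ?Q prod.swap"
  proof (rule homeomorphic_maps_imp_map)
    show "homeomorphic_maps ?P ?Q prod.swap prod.swap"
      unfolding homeomorphic_maps_def prod.swap_def
      by (auto simp: continuous_map_in_subtopology
        intro!: continuous_map_pairedI continuous_map_from_subtopology continuous_map_fst continuous_map_snd)
  qed
  then have "local_homeomorphism ?P Y (\<lambda>z. snd (prod.swap z))"
    by (intro local_homeomorphism_compose'[OF homeomorphic_imp_local_homeomorphism local_homeomorphism_pullback[OF assms]])
  then show ?thesis by (simp add: prod.swap_def)
qed

lemma local_homeomorphism_prod:
  assumes f: "local_homeomorphism X X' f" and g: "local_homeomorphism Y Y' g"
  shows "local_homeomorphism (prod_topology X Y) (prod_topology X' Y') (\<lambda>(x, y). (f x, g y))"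
proof (rule local_homeomorphismI)
  show "continuous_map (prod_topology X Y) (prod_topology X' Y') (\<lambda>(x, y). (f x, g y))"
    using f g by (auto simp: case_prod_unfold local_homeomorphism_iff
        intro!: continuous_map_pairedI continuous_map_compose[OF continuous_map_fst, unfolded o_def]
         continuous_map_compose[OF continuous_map_snd, unfolded o_def])
  show "open_map (prod_topology X Y) (prod_topology X' Y') (\<lambda>(x, y). (f x, g y))"
    unfolding open_map_def
  proof (intro allI impI)
    fix W assume W: "openin (prod_topology X Y) W"
    show "openin (prod_topology X' Y') ((\<lambda>(x, y). (f x, g y)) ` W)"
      unfolding openin_prod_topology_alt
    proof (intro allI impI)
      fix a b assume "(a, b) \<in> (\<lambda>(x, y). (f x, g y)) ` W"
      then obtain x y where xy: "(x, y) \<in> W" "a = f x" "b = g y" by auto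
      then obtain U V where UV: "openin X U" "openin Y V" "x \<in> U" "y \<in> V" "U \<times> V \<subseteq> W"
        using W unfolding openin_prod_topology_alt by meson
      have "openin X' (f ` U)" "openin Y' (g ` V)"
        using f g UV by (auto simp: local_homeomorphism_iff open_map_def)
      moreover have "f ` U \<times> g ` V \<subseteq> (\<lambda>(x, y). (f x, g y)) ` W"
        using UV(5) by force
      ultimately show "\<exists>U V. openin X' U \<and> openin Y' V \<and> a \<in> U \<and> b \<in> V \<and> U \<times> V \<subseteq> (\<lambda>(x, y). (f x, g y)) ` W"
        using xy UV by blast
    qed
  qed
  fix p assume p: "p \<in> topspace (prod_topology X Y)"
  obtain U where U: "openin X U" "fst p \<in> U" "inj_on f U"
    by (rule local_homeomorphism_locally_inj[OF f, of "fst p"]) (use p in auto)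
  obtain V where V: "openin Y V" "snd p \<in> V" "inj_on g V"
    by (rule local_homeomorphism_locally_inj[OF g, of "snd p"]) (use p in auto)
  show "\<exists>U. openin (prod_topology X Y) U \<and> p \<in> U \<and> inj_on (\<lambda>(x, y). (f x, g y)) U"
    using U V by (intro exI[of _ "U \<times> V"]) (auto simp: openin_prod_Times_iff inj_on_def mem_Times_iff)
qed

text \<open>Compact open subsets of a Hausdorff space are closed, so removing the earlier members
  from each member of a countable compact open cover leaves open, pairwise disjoint pieces. Each
  piece uses its own local inverse of q, and disjointness leaves nothing to check for
  gluing.\<close>

lemma local_homeomorphism_section:
  assumes q: "local_homeomorphism P B q" and surj: "q ` topspace P = topspace B"
    and B: "Hausdorff_space B" "zero_dimensional_space B" "sigma_compact_space B"
  obtains t where "continuous_map B P t" "\<And>b. b \<in> topspace B \<Longrightarrow> q (t b) = b"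
proof -
  have ex: "\<exists>V U. openin B V \<and> compactin B V \<and> b \<in> V \<and> openin P U \<and> inj_on q U \<and> V \<subseteq> q ` U"
    if b: "b \<in> topspace B" for b
  proof -
    have "b \<in> q ` topspace P" using b surj by simp
    then obtain p where p: "p \<in> topspace P" "q p = b" by blast
    then obtain U where U: "openin P U" "p \<in> U" "inj_on q U" "openin B (q ` U)"
      using local_homeomorphism_locally_inj[OF q] by blast
    then have "(arbitrary union_of (\<lambda>K. openin B K \<and> compactin B K)) (q ` U)"
      using B(2) unfolding zero_dimensional_space_def by metis
    then obtain \<U> where "\<U> \<subseteq> {K. openin B K \<and> compactin B K}" "\<Union>\<U> = q ` U"
      by (auto simp: union_of_def)
    then have "b \<in> \<Union>\<U>" using p U(2) by auto
    then obtain V where V: "V \<in> \<U>" "b \<in> V" by blast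
    then have "openin B V" "compactin B V" "V \<subseteq> q ` U" 
      using \<open>\<U> \<subseteq> _\<close> \<open>\<Union>\<U> = q ` U\<close> by auto
    with U(1,3) V(2) show ?thesis by (intro exI[of _ V] exI[of _ U] conjI)
  qed
  define good where "good = {(V, U). openin B V \<and> compactin B V \<and> openin P U \<and> inj_on q U \<and> V \<subseteq> q ` U}"
  obtain \<K> where \<K>: "countable \<K>" "\<And>K. K \<in> \<K> \<Longrightarrow> compactin B K" "\<Union>\<K> = topspace B"
    using B(3) by (auto simp: sigma_compact_space_def)
  have fin: "\<exists>F. finite F \<and> F \<subseteq> good \<and> K \<subseteq> \<Union>(fst ` F)" if K: "K \<in> \<K>" for K
  proof -
    have "K \<subseteq> \<Union>(fst ` good)"
    proof
      fix b assume "b \<in> K"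
      then have "b \<in> topspace B" using \<K>(3) K by auto
      from ex[OF this] obtain V U where "(V, U) \<in> good" "b \<in> V" unfolding good_def by auto
      then show "b \<in> \<Union>(fst ` good)" by force
    qed
    moreover have "\<And>V. V \<in> fst ` good \<Longrightarrow> openin B V" by (auto simp: good_def)
    ultimately obtain \<F> where "finite \<F>" "\<F> \<subseteq> fst ` good" "K \<subseteq> \<Union>\<F>"
      using compactinD[OF \<K>(2)[OF K], of "fst ` good"] by blast
    then obtain F where "F \<subseteq> good" "finite F" "\<F> = fst ` F"
      by (meson finite_subset_image)
    with \<open>K \<subseteq> \<Union>\<F>\<close> show ?thesis by (intro exI[of _ F]) simp
  qed
  then obtain F where F: "\<And>K. K \<in> \<K> \<Longrightarrow> finite (F K) \<and> F K \<subseteq> good \<and> K \<subseteq> \<Union>(fst ` F K)"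
    by metis
  \<comment> \<open>The pair of empty sets keeps C nonempty, so that \<open>from_nat_into\<close>
    enumerates C even when B has no points.\<close>
  define C where "C = insert ({}, {}) (\<Union>K\<in>\<K>. F K)"
  have C: "countable C" "C \<noteq> {}" "C \<subseteq> good" "topspace B \<subseteq> \<Union>(fst ` C)"
  proof -
    show "countable C" unfolding C_def
      by (intro countable_insert countable_UN \<K>(1)) (use F countable_finite in blast)
    have "({}, {}) \<in> good" by (auto simp: good_def)
    then show "C \<subseteq> good" using F by (auto simp: C_def)
    show "topspace B \<subseteq> \<Union>(fst ` C)"
    proof
      fix b assume "b \<in> topspace B"
      then obtain K where K: "K \<in> \<K>" "b \<in> K" using \<K>(3) by auto
      then have "b \<in> \<Union>(fst ` F K)" using F[OF K(1)] by auto
      then show "b \<in> \<Union>(fst ` C)" using K(1) by (auto simp: C_def)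
    qed
  qed (simp add: C_def)
  define V where "V n = fst (from_nat_into C n)" for n :: nat
  define U where "U n = snd (from_nat_into C n)" for n :: nat
  have VU: "openin B (V n)" "compactin B (V n)" "openin P (U n)" "inj_on q (U n)" "V n \<subseteq> q ` U n" for n
  proof -
    have "(V n, U n) \<in> good" using C(3) from_nat_into[OF C(2), of n] by (auto simp: V_def U_def)
    then show "openin B (V n)" "compactin B (V n)" "openin P (U n)" "inj_on q (U n)" "V n \<subseteq> q ` U n"
      by (simp_all add: good_def)
  qed
  have cover: "\<exists>n. b \<in> V n" if "b \<in> topspace B" for b
  proof -
    obtain c where "c \<in> C" "b \<in> fst c" using \<open>b \<in> topspace B\<close> C(4) by auto
    moreover obtain n where "from_nat_into C n = c" using from_nat_into_surj[OF C(1) \<open>c \<in> C\<close>] by auto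
    ultimately show ?thesis by (auto simp: V_def)
  qed
  define i where "i b = (LEAST n. b \<in> V n)" for b
  have i: "b \<in> V (i b)" if "b \<in> topspace B" for b
    unfolding i_def using cover[OF that] by (meson LeastI)
  define t where "t b = inv_into (U (i b)) q b" for b
  have tU: "t b \<in> U (i b)" and qt: "q (t b) = b" if "b \<in> topspace B" for b
  proof -
    have "b \<in> q ` U (i b)" using i[OF that] VU(5) by auto
    then show "t b \<in> U (i b)" "q (t b) = b"
      by (simp_all add: t_def inv_into_into f_inv_into_f)
  qed
  \<comment> \<open>\<open>W n\<close> consists of the points with first index n, as
    \<open>Wi\<close> and \<open>iW\<close> record; on it \<open>t\<close> is the inverse of q
    restricted to \<open>U n\<close>.\<close>
  define W where "W n = V n - (\<Union>m<n. V m)" for n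
  have Wo: "openin B (W n)" for n
    unfolding W_def
    by (intro openin_diff VU closedin_Union) (auto intro!: compactin_imp_closedin B VU)
  have Wi: "b \<in> W (i b)" if "b \<in> topspace B" for b
  proof -
    have "b \<notin> V m" if "m < i b" for m
      using that unfolding i_def by (rule not_less_Least)
    with i[OF that] show ?thesis by (simp add: W_def)
  qed
  have iW: "i b = n" if "b \<in> W n" for b n
    unfolding i_def
  proof (rule Least_equality)
    show "b \<in> V n" using that by (simp add: W_def)
    show "n \<le> m" if "b \<in> V m" for m
      using that \<open>b \<in> W n\<close> by (auto simp: W_def not_less[symmetric])
  qed
  show ?thesis
  proof
    show "continuous_map B P t"
    proof -
      have "openin B {b \<in> topspace B. t b \<in> O1}" if O1: "openin P O1" for O1
      proof -
        have "{b \<in> topspace B. t b \<in> O1} = (\<Union>n. W n \<inter> q ` (U n \<inter> O1))"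
        proof (intro equalityI subsetI)
          fix b assume "b \<in> {b \<in> topspace B. t b \<in> O1}"
          then have b: "b \<in> topspace B" "t b \<in> O1" by auto
          then have "b \<in> q ` (U (i b) \<inter> O1)"
            using tU[OF b(1)] qt[OF b(1)] by (metis IntI imageI)
          then show "b \<in> (\<Union>n. W n \<inter> q ` (U n \<inter> O1))" using Wi[OF b(1)] by blast
        next
          fix b assume "b \<in> (\<Union>n. W n \<inter> q ` (U n \<inter> O1))"
          then obtain n p where n: "b \<in> W n" "p \<in> U n" "p \<in> O1" "b = q p" by blast
          then have b: "b \<in> topspace B" using openin_subset[OF Wo] by blast
          have "t b = p"
            using tU[OF b] qt[OF b] iW[OF n(1)] n(2,4) inj_onD[OF VU(4)] by metis
          then show "b \<in> {b \<in> topspace B. t b \<in> O1}" using b n by blast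
        qed
        moreover have "openin B (W n \<inter> q ` (U n \<inter> O1))" for n
          using local_homeomorphism_imp_open_map[OF q] Wo O1 VU(3) by (simp add: open_map_def openin_Int)
        ultimately show ?thesis by auto
      qed
      moreover have "t ` topspace B \<subseteq> topspace P"
        using tU openin_subset[OF VU(3)] by blast
      ultimately show ?thesis by (simp add: continuous_map)
    qed
  qed (use qt in auto)
qed


section \<open>Compactly supported functions and their pushforward\<close>

text \<open>The integers are discrete, so the set where f is nonzero is clopen. It equals its
  closure, and compactness of the support becomes compactness of this set.\<close>

lemma compactly_supportedD:
  assumes "f \<in> compactly_supported X"
  shows "\<And>A. openin X {x \<in> topspace X. f x \<in> A}" "compactin X {x \<in> topspace X. f x \<noteq> 0}"
    "\<And>x. x \<notin> topspace X \<Longrightarrow> f x = 0"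
proof -
  have cont: "continuous_map X (discrete_topology UNIV) f"
    using assms by (simp add: compactly_supported_def)
  show op: "openin X {x \<in> topspace X. f x \<in> A}" for A
    using openin_continuous_map_preimage[OF cont, of A] by simp
  have "closedin X {x \<in> topspace X. f x \<in> - {0}}"
    using closedin_continuous_map_preimage[OF cont, of "- {0}"] by simp
  then have "X closure_of {x \<in> topspace X. f x \<noteq> 0} = {x \<in> topspace X. f x \<noteq> 0}"
    by (simp add: closure_of_closedin)
  then show "compactin X {x \<in> topspace X. f x \<noteq> 0}"
    using assms by (simp add: compactly_supported_def)
  show "f x = 0" if "x \<notin> topspace X" for x
    using assms that by (simp add: compactly_supported_def)
qed

text \<open>Open level sets give continuity into a discrete space, and the nonzero points then form
  a closed subset of K. As K lies in the space, f vanishes off the space.\<close>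

lemma compactly_supportedI:
  assumes level: "\<And>c. openin X {x \<in> topspace X. f x = c}"
    and K: "compactin X K" "\<And>x. f x \<noteq> 0 \<Longrightarrow> x \<in> K"
  shows "f \<in> compactly_supported X"
proof -
  have "openin X {x \<in> topspace X. f x \<in> A}" for A
  proof -
    have "{x \<in> topspace X. f x \<in> A} = (\<Union>c\<in>A. {x \<in> topspace X. f x = c})" by auto
    then show ?thesis using level by auto
  qed
  then have cont: "continuous_map X (discrete_topology UNIV) f"
    by (simp add: continuous_map)
  then have "closedin X {x \<in> topspace X. f x \<in> - {0}}"
    using closedin_continuous_map_preimage[OF cont, of "- {0}"] by simp
  then have cl: "closedin X {x \<in> topspace X. f x \<noteq> 0}" by simp
  have "compactin X {x \<in> topspace X. f x \<noteq> 0}"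
    by (rule closed_compactin[OF K(1) _ cl]) (use K(2) in auto)
  moreover have "f x = 0" if "x \<notin> topspace X" for x
    using K that compactin_subset_topspace[OF K(1)] by blast
  ultimately show ?thesis
    using cl cont by (simp add: compactly_supported_def closure_of_closedin)
qed

lemma zero_compactly_supported: "(\<lambda>x. 0) \<in> compactly_supported X"
proof (rule compactly_supportedI[where K = "{}"])
  show "openin X {x \<in> topspace X. 0 = c}" for c :: int by (cases "c = 0") auto
qed auto

lemma linear_compactly_supported:
  assumes f: "f \<in> compactly_supported X" and g: "g \<in> compactly_supported X"
  shows "(\<lambda>x. a * f x + b * g x) \<in> compactly_supported X"
proof (rule compactly_supportedI)
  let ?K = "{x \<in> topspace X. f x \<noteq> 0} \<union> {x \<in> topspace X. g x \<noteq> 0}"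
  show "compactin X ?K"
    by (intro compactin_Un compactly_supportedD f g)
  show "x \<in> ?K" if "a * f x + b * g x \<noteq> 0" for x
    using that compactly_supportedD(3)[OF f, of x] compactly_supportedD(3)[OF g, of x]
    by (cases "x \<in> topspace X") auto
  fix c
  have "{x \<in> topspace X. a * f x + b * g x = c} =
    (\<Union>u. {x \<in> topspace X. f x \<in> {u}} \<inter> {x \<in> topspace X. g x \<in> {v. a * u + b * v = c}})"
    by auto
  moreover have "openin X ({x \<in> topspace X. f x \<in> {u}} \<inter> {x \<in> topspace X. g x \<in> {v. a * u + b * v = c}})" for u
    by (intro openin_Int compactly_supportedD f g)
  then have "openin X (\<Union>u. {x \<in> topspace X. f x \<in> {u}} \<inter> {x \<in> topspace X. g x \<in> {v. a * u + b * v = c}})"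
    by (intro openin_Union) blast
  ultimately show "openin X {x \<in> topspace X. a * f x + b * g x = c}" by simp
qed

lemma add_compactly_supported:
  "f \<in> compactly_supported X \<Longrightarrow> g \<in> compactly_supported X \<Longrightarrow>
    (\<lambda>x. f x + g x) \<in> compactly_supported X"
  using linear_compactly_supported[of f X g 1 1] by simp

lemma uminus_compactly_supported:
  "f \<in> compactly_supported X \<Longrightarrow> (\<lambda>x. - f x) \<in> compactly_supported X"
  using linear_compactly_supported[of f X f "-1" 0] by simp

lemma sum_compactly_supported:
  assumes "\<And>j. j \<in> J \<Longrightarrow> F j \<in> compactly_supported X"
  shows "(\<lambda>x. \<Sum>j\<in>J. c j * F j x) \<in> compactly_supported X"
  using assms
proof (induction J rule: infinite_finite_induct)
  case (insert j J)
  then show ?case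
    using linear_compactly_supported[of "F j" X "\<lambda>x. \<Sum>j\<in>J. c j * F j x" "c j" 1] by simp
qed (simp_all add: zero_compactly_supported)

text \<open>Finitely many open sets on which \<psi> is injective cover the compact support, and each
  of them contains at most one point of the fibre.\<close>

lemma finite_fibre:
  assumes \<psi>: "local_homeomorphism Y X \<psi>" and f: "f \<in> compactly_supported Y"
  shows "finite {y \<in> topspace Y. \<psi> y = x \<and> f y \<noteq> 0}"
proof -
  let ?S = "{y \<in> topspace Y. f y \<noteq> 0}"
  have "\<exists>U. openin Y U \<and> y \<in> U \<and> inj_on \<psi> U" if "y \<in> ?S" for y
    using \<psi> that by (auto simp: local_homeomorphism_iff)
  then obtain U where U: "\<And>y. y \<in> ?S \<Longrightarrow> openin Y (U y) \<and> y \<in> U y \<and> inj_on \<psi> (U y)"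
    by metis
  obtain \<F> where \<F>: "finite \<F>" "\<F> \<subseteq> U ` ?S" "?S \<subseteq> \<Union>\<F>"
    using compactinD[OF compactly_supportedD(2)[OF f], of "U ` ?S"] U by blast
  have "finite {y \<in> T. \<psi> y = x}" if "T \<in> \<F>" for T
  proof -
    have "inj_on \<psi> {y \<in> T. \<psi> y = x}"
      using that \<F>(2) U by (auto simp: inj_on_def)
    moreover have "\<psi> ` {y \<in> T. \<psi> y = x} \<subseteq> {x}" by auto
    ultimately show ?thesis by (meson finite.intros finite_imageD finite_subset)
  qed
  then have "finite (\<Union>T\<in>\<F>. {y \<in> T. \<psi> y = x})" using \<F>(1) by blast
  moreover have "{y \<in> topspace Y. \<psi> y = x \<and> f y \<noteq> 0} \<subseteq> (\<Union>T\<in>\<F>. {y \<in> T. \<psi> y = x})"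
    using \<F>(3) by auto
  ultimately show ?thesis by (rule rev_finite_subset)
qed

text \<open>The sum may run over any finite part of the fibre that contains the nonzero points. This
  permits one index set for several functions, whose nonzero points differ.\<close>

lemma pushforward_eq_sum:
  assumes "finite A" "{y \<in> topspace Y. \<psi> y = x \<and> f y \<noteq> 0} \<subseteq> A" "A \<subseteq> {y \<in> topspace Y. \<psi> y = x}"
  shows "pushforward Y \<psi> f x = (\<Sum>y\<in>A. f y)"
  unfolding pushforward_def using assms by (intro sum.mono_neutral_left) auto

lemma pushforward_cong:
  "(\<And>y. y \<in> topspace Y \<Longrightarrow> \<psi> y = \<psi>' y) \<Longrightarrow> pushforward Y \<psi> f = pushforward Y \<psi>' f"
  unfolding pushforward_def by (intro ext sum.cong) auto

lemma pushforward_ident: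
  assumes "f \<in> compactly_supported Y" "\<And>y. y \<in> topspace Y \<Longrightarrow> \<psi> y = y"
  shows "pushforward Y \<psi> f = f"
proof
  fix x
  show "pushforward Y \<psi> f x = f x"
  proof (cases "x \<in> topspace Y")
    case True
    then show ?thesis
      by (subst pushforward_eq_sum[of "{x}"]) (use assms(2) in auto)
  next
    case False
    then have "{y \<in> topspace Y. \<psi> y = x \<and> f y \<noteq> 0} = {}" using assms(2) by auto
    then show ?thesis
      using compactly_supportedD(3)[OF assms(1) False] unfolding pushforward_def
      by (simp only: sum.empty)
  qed
qed

lemma pushforward_sum:
  assumes \<psi>: "local_homeomorphism Y X \<psi>" and J: "finite J"
    and F: "\<And>j. j \<in> J \<Longrightarrow> F j \<in> compactly_supported Y"
  shows "pushforward Y \<psi> (\<lambda>y. \<Sum>j\<in>J. c j * F j y) x = (\<Sum>j\<in>J. c j * pushforward Y \<psi> (F j) x)"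
proof -
  \<comment> \<open>The combination can vanish at points of A by cancellation, so the union of the
    supports in the fibre is taken as index set instead of the support of the combination.\<close>
  define A where "A = (\<Union>j\<in>J. {y \<in> topspace Y. \<psi> y = x \<and> F j y \<noteq> 0})"
  have A: "finite A" "A \<subseteq> {y \<in> topspace Y. \<psi> y = x}"
    using J F finite_fibre[OF \<psi>] by (auto simp: A_def)
  have "pushforward Y \<psi> (\<lambda>y. \<Sum>j\<in>J. c j * F j y) x = (\<Sum>y\<in>A. \<Sum>j\<in>J. c j * F j y)"
  proof (rule pushforward_eq_sum[OF A(1) _ A(2)], rule subsetI)
    fix y assume y: "y \<in> {y \<in> topspace Y. \<psi> y = x \<and> (\<Sum>j\<in>J. c j * F j y) \<noteq> 0}"
    then have "(\<Sum>j\<in>J. c j * F j y) \<noteq> 0" by simp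
    then obtain j where "j \<in> J" "F j y \<noteq> 0"
      by (metis (no_types, lifting) mult_zero_right sum.neutral)
    with y show "y \<in> A" by (auto simp: A_def)
  qed
  also have "\<dots> = (\<Sum>j\<in>J. \<Sum>y\<in>A. c j * F j y)" by (rule sum.swap)
  also have "\<dots> = (\<Sum>j\<in>J. c j * pushforward Y \<psi> (F j) x)"
  proof (rule sum.cong[OF refl])
    fix j assume j: "j \<in> J"
    have "pushforward Y \<psi> (F j) x = (\<Sum>y\<in>A. F j y)"
      using j by (intro pushforward_eq_sum A) (auto simp: A_def)
    then show "(\<Sum>y\<in>A. c j * F j y) = c j * pushforward Y \<psi> (F j) x"
      by (simp add: sum_distrib_left)
  qed
  finally show ?thesis .
qed

lemma pushforward_linear:
  assumes "local_homeomorphism Y X \<psi>" "f \<in> compactly_supported Y" "g \<in> compactly_supported Y"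
  shows "pushforward Y \<psi> (\<lambda>y. a * f y + b * g y) x = a * pushforward Y \<psi> f x + b * pushforward Y \<psi> g x"
  using pushforward_sum[OF assms(1), of "UNIV :: bool set" "\<lambda>j. if j then f else g" "\<lambda>j. if j then a else b" x] assms(2,3)
  by (simp add: UNIV_bool add.commute)

lemma pushforward_add:
  assumes "local_homeomorphism Y X \<psi>" "f \<in> compactly_supported Y" "g \<in> compactly_supported Y"
  shows "pushforward Y \<psi> (\<lambda>y. f y + g y) = (\<lambda>x. pushforward Y \<psi> f x + pushforward Y \<psi> g x)"
  using pushforward_linear[OF assms, of 1 1] by auto

lemma pushforward_zero: "pushforward Y \<psi> (\<lambda>y. 0) = (\<lambda>x. 0)"
  by (rule ext) (simp add: pushforward_def)

text \<open>The sum over the fibre of the composite is regrouped by the value of \<psi>. That the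
  composite is a local homeomorphism supplies the finiteness of the set E being regrouped.\<close>

lemma pushforward_compose:
  assumes \<psi>: "\<And>y. y \<in> topspace Y \<Longrightarrow> \<psi> y \<in> topspace X"
    and \<phi>\<psi>: "local_homeomorphism Y Z (\<lambda>y. \<phi> (\<psi> y))" and f: "f \<in> compactly_supported Y"
  shows "pushforward X \<phi> (pushforward Y \<psi> f) = pushforward Y (\<lambda>y. \<phi> (\<psi> y)) f"
proof
  fix x
  define E where "E = {y \<in> topspace Y. \<phi> (\<psi> y) = x \<and> f y \<noteq> 0}"
  have E: "finite E" unfolding E_def by (rule finite_fibre[OF \<phi>\<psi> f])
  have inner: "pushforward Y \<psi> f z = (\<Sum>y\<in>{y \<in> E. \<psi> y = z}. f y)" if "\<phi> z = x" for z
    using that by (intro pushforward_eq_sum finite_subset[OF _ E]) (auto simp: E_def)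
  have "pushforward X \<phi> (pushforward Y \<psi> f) x = (\<Sum>z\<in>\<psi> ` E. pushforward Y \<psi> f z)"
  proof (rule pushforward_eq_sum)
    show "\<psi> ` E \<subseteq> {y \<in> topspace X. \<phi> y = x}" using \<psi> by (auto simp: E_def)
    \<comment> \<open>Only an inclusion holds: the contributions over a point of \<psi>(E) may
      cancel.\<close>
    show "{z \<in> topspace X. \<phi> z = x \<and> pushforward Y \<psi> f z \<noteq> 0} \<subseteq> \<psi> ` E"
    proof
      fix z assume "z \<in> {z \<in> topspace X. \<phi> z = x \<and> pushforward Y \<psi> f z \<noteq> 0}"
      then have "(\<Sum>y\<in>{y \<in> E. \<psi> y = z}. f y) \<noteq> 0" using inner by auto
      then have "{y \<in> E. \<psi> y = z} \<noteq> {}" by (metis sum.empty)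
      then show "z \<in> \<psi> ` E" by auto
    qed
  qed (use E in simp)
  also have "\<dots> = (\<Sum>z\<in>\<psi> ` E. \<Sum>y\<in>{y \<in> E. \<psi> y = z}. f y)"
    by (intro sum.cong refl inner) (auto simp: E_def)
  also have "\<dots> = (\<Sum>y\<in>E. f y)" by (rule sum.image_gen[OF E, symmetric])
  finally show "pushforward X \<phi> (pushforward Y \<psi> f) x = pushforward Y (\<lambda>y. \<phi> (\<psi> y)) f x"
    by (simp add: E_def pushforward_def)
qed

section \<open>Local constancy of pushforwards\<close>

lemma Hausdorff_space_disjoint_nbhds:
  assumes "Hausdorff_space X" "finite F" "F \<subseteq> topspace X"
  obtains U where "\<And>x. x \<in> F \<Longrightarrow> openin X (U x) \<and> x \<in> U x"
    "\<And>x y. x \<in> F \<Longrightarrow> y \<in> F \<Longrightarrow> x \<noteq> y \<Longrightarrow> U x \<inter> U y = {}"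
proof -
  have "\<exists>U V. openin X U \<and> openin X V \<and> x \<in> U \<and> y \<in> V \<and> U \<inter> V = {}"
    if "x \<in> F" "y \<in> F" "x \<noteq> y" for x y
    using assms(1,3) that unfolding Hausdorff_space_def disjnt_def by blast
  then obtain A B where AB: "\<And>x y. x \<in> F \<Longrightarrow> y \<in> F \<Longrightarrow> x \<noteq> y \<Longrightarrow>
      openin X (A x y) \<and> openin X (B x y) \<and> x \<in> A x y \<and> y \<in> B x y \<and> A x y \<inter> B x y = {}"
    by metis
  \<comment> \<open>The factor \<open>topspace X\<close> is all that remains of the intersection
    when x is the only point of F.\<close>
  define U where "U x = topspace X \<inter> \<Inter>((\<lambda>y. A x y \<inter> B y x) ` (F - {x}))" for x
  show ?thesis
  proof
    fix x assume x: "x \<in> F"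
    have "openin X (A x y \<inter> B y x) \<and> x \<in> A x y \<inter> B y x" if "y \<in> F - {x}" for y
      using AB[of x y] AB[of y x] x that by blast
    then have "openin X (U x)" "x \<in> U x"
      unfolding U_def using assms(2,3) x by (auto intro!: openin_Int_Inter)
    then show "openin X (U x) \<and> x \<in> U x" ..
  next
    fix x y assume xy: "x \<in> F" "y \<in> F" "x \<noteq> y"
    then have "U x \<subseteq> A x y" "U y \<subseteq> B x y" by (auto simp: U_def)
    with AB[OF xy] show "U x \<inter> U y = {}" by blast
  qed
qed

text \<open>The fibre of x meets the support in finitely many points. Disjoint open sheets
  \<open>W y\<close> around them map injectively, with f constant on each. The rest K of the support
  is compact, so its image is closed in the Hausdorff space X, and it misses x. Over the
  neighbourhood N the support has exactly one point in each sheet, with the same value of f as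
  before.\<close>

lemma pushforward_locally_constant:
  assumes \<psi>: "local_homeomorphism Y X \<psi>" and Y: "Hausdorff_space Y" and X: "Hausdorff_space X"
    and f: "f \<in> compactly_supported Y" and x: "x \<in> topspace X"
  shows "\<exists>N. openin X N \<and> x \<in> N \<and> (\<forall>x'\<in>N. pushforward Y \<psi> f x' = pushforward Y \<psi> f x)"
proof -
  define F where "F = {y \<in> topspace Y. \<psi> y = x \<and> f y \<noteq> 0}"
  have F: "finite F" "F \<subseteq> topspace Y" unfolding F_def using finite_fibre[OF \<psi> f] by auto
  obtain U where U: "\<And>y. y \<in> F \<Longrightarrow> openin Y (U y) \<and> y \<in> U y"
    "\<And>y z. y \<in> F \<Longrightarrow> z \<in> F \<Longrightarrow> y \<noteq> z \<Longrightarrow> U y \<inter> U z = {}"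
    using Hausdorff_space_disjoint_nbhds[OF Y F] by metis
  have "\<exists>V. openin Y V \<and> y \<in> V \<and> inj_on \<psi> V" if "y \<in> F" for y
    using \<psi> that F(2) by (auto simp: local_homeomorphism_iff)
  then obtain V where V: "\<And>y. y \<in> F \<Longrightarrow> openin Y (V y) \<and> y \<in> V y \<and> inj_on \<psi> (V y)"
    by metis
  define W where "W y = U y \<inter> V y \<inter> {z \<in> topspace Y. f z \<in> {f y}}" for y
  have W: "openin Y (W y)" "y \<in> W y" "inj_on \<psi> (W y)" if "y \<in> F" for y
  proof -
    show "openin Y (W y)"
      unfolding W_def using U(1)[OF that] V[OF that] by (intro openin_Int compactly_supportedD(1)[OF f]) auto
    show "y \<in> W y" using U(1)[OF that] V[OF that] F(2) that by (auto simp: W_def)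
    show "inj_on \<psi> (W y)" using V[OF that] by (auto simp: W_def intro: inj_on_subset)
  qed
  have Wf: "f z = f y" if "z \<in> W y" for y z using that by (simp add: W_def)
  have Wdisj: "W y \<inter> W z = {}" if "y \<in> F" "z \<in> F" "y \<noteq> z" for y z
    using U(2)[OF that] by (auto simp: W_def)
  define S where "S = {y \<in> topspace Y. f y \<noteq> 0}"
  define K where "K = S \<inter> (topspace Y - (\<Union>y\<in>F. W y))"
  have "closedin Y (topspace Y - (\<Union>y\<in>F. W y))" using W(1) by blast
  then have "compactin Y K"
    unfolding K_def S_def by (rule compact_Int_closedin[OF compactly_supportedD(2)[OF f]])
  then have K: "closedin X (\<psi> ` K)"
    using image_compactin compactin_imp_closedin X local_homeomorphism_imp_continuous_map[OF \<psi>] by metis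
  have xK: "x \<notin> \<psi> ` K"
  proof
    assume "x \<in> \<psi> ` K"
    then obtain y where "y \<in> K" "\<psi> y = x" by blast
    then have "y \<in> F" "y \<notin> (\<Union>y\<in>F. W y)" by (auto simp: K_def S_def F_def)
    then show False using W(2) by blast
  qed
  \<comment> \<open>When f vanishes on the fibre of x, the set F is empty and the factor
    \<open>topspace X\<close> stands for the empty intersection.\<close>
  define N where "N = topspace X \<inter> \<Inter>((\<lambda>y. \<psi> ` W y) ` F) \<inter> (topspace X - \<psi> ` K)"
  have "openin X N"
  proof -
    have "openin X (\<psi> ` W y)" if "y \<in> F" for y
      using local_homeomorphism_imp_open_map[OF \<psi>] W(1)[OF that] by (simp add: open_map_def)
    then have "openin X (topspace X \<inter> \<Inter>((\<lambda>y. \<psi> ` W y) ` F))"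
      using F(1) by (intro openin_Int_Inter) auto
    then show ?thesis unfolding N_def by (rule openin_Int[OF _ openin_diff[OF openin_topspace K]])
  qed
  moreover have "x \<in> N"
  proof -
    have "x \<in> \<psi> ` W y" if "y \<in> F" for y
      using W(2)[OF that] that by (auto simp: F_def)
    then show ?thesis using x xK by (auto simp: N_def)
  qed
  moreover have "pushforward Y \<psi> f x' = pushforward Y \<psi> f x" if x': "x' \<in> N" for x'
  proof -
    have "\<exists>z. z \<in> W y \<and> \<psi> z = x'" if "y \<in> F" for y
    proof -
      have "x' \<in> \<psi> ` W y" using x' that by (auto simp: N_def)
      then show ?thesis by auto
    qed
    then obtain h where h: "\<And>y. y \<in> F \<Longrightarrow> h y \<in> W y \<and> \<psi> (h y) = x'" by metis
    have fh: "f (h y) = f y" if "y \<in> F" for y using Wf h[OF that] by blast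
    have inj: "inj_on h F"
    proof (rule inj_onI, rule ccontr)
      fix y z assume "y \<in> F" "z \<in> F" "h y = h z" "y \<noteq> z"
      then show False using Wdisj[of y z] h[of y] h[of z] by (metis IntI empty_iff)
    qed
    have im: "{z \<in> topspace Y. \<psi> z = x' \<and> f z \<noteq> 0} \<subseteq> h ` F"
    proof
      fix z assume z: "z \<in> {z \<in> topspace Y. \<psi> z = x' \<and> f z \<noteq> 0}"
      have "z \<notin> K" using x' z by (auto simp: N_def)
      then obtain y where y: "y \<in> F" "z \<in> W y" using z by (auto simp: K_def S_def)
      then have "z = h y" using h[OF y(1)] z inj_onD[OF W(3)[OF y(1)], of z "h y"] by auto
      then show "z \<in> h ` F" using y by blast
    qed
    have "pushforward Y \<psi> f x' = (\<Sum>z\<in>h ` F. f z)"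
    proof (rule pushforward_eq_sum[OF _ im])
      show "h ` F \<subseteq> {y \<in> topspace Y. \<psi> y = x'}"
        using h W(1) openin_subset by fastforce
    qed (use F in simp)
    also have "\<dots> = (\<Sum>y\<in>F. f y)" using fh by (simp add: sum.reindex[OF inj])
    also have "\<dots> = pushforward Y \<psi> f x" by (simp add: pushforward_def F_def)
    finally show ?thesis .
  qed
  ultimately show ?thesis by blast
qed

lemma pushforward_compactly_supported:
  assumes \<psi>: "local_homeomorphism Y X \<psi>" and Y: "Hausdorff_space Y" and X: "Hausdorff_space X"
    and f: "f \<in> compactly_supported Y"
  shows "pushforward Y \<psi> f \<in> compactly_supported X"
proof (rule compactly_supportedI)
  let ?K = "\<psi> ` {y \<in> topspace Y. f y \<noteq> 0}"
  show "compactin X ?K"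
    by (rule image_compactin[OF compactly_supportedD(2)[OF f] local_homeomorphism_imp_continuous_map[OF \<psi>]])
  show "x \<in> ?K" if "pushforward Y \<psi> f x \<noteq> 0" for x
  proof -
    have "{y \<in> topspace Y. \<psi> y = x \<and> f y \<noteq> 0} \<noteq> {}"
      using that unfolding pushforward_def by (metis (no_types, lifting) sum.empty)
    then show ?thesis by auto
  qed
  fix c
  show "openin X {x \<in> topspace X. pushforward Y \<psi> f x = c}"
  proof (subst openin_subopen, intro ballI)
    fix x assume "x \<in> {x \<in> topspace X. pushforward Y \<psi> f x = c}"
    then have x: "x \<in> topspace X" "pushforward Y \<psi> f x = c" by auto
    obtain N where N: "openin X N" "x \<in> N" "\<forall>x'\<in>N. pushforward Y \<psi> f x' = pushforward Y \<psi> f x"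
      using pushforward_locally_constant[OF \<psi> Y X f x(1)] by auto
    then have "N \<subseteq> {x \<in> topspace X. pushforward Y \<psi> f x = c}"
      using x(2) openin_subset[OF N(1)] by auto
    with N show "\<exists>T. openin X T \<and> x \<in> T \<and> T \<subseteq> {x \<in> topspace X. pushforward Y \<psi> f x = c}" by blast
  qed
qed


section \<open>Composable tuples as diagrams\<close>

context groupoid
begin

lemma unitsD:
  assumes "u \<in> units G"
  shows "u \<in> arrows G" "rng G u = u" "src G u = u"
  using assms by (auto simp: units_def)

lemma units_rng_src [simp]:
  assumes "g \<in> arrows G"
  shows "rng G g \<in> arrows G" "src G g \<in> arrows G"
    "rng G (rng G g) = rng G g" "src G (rng G g) = rng G g"
    "rng G (src G g) = src G g" "src G (src G g) = src G g"
  using unitsD[OF rng_unit[OF assms]] unitsD[OF src_unit[OF assms]] by simp_all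

declare gmul_closed [simp] rng_gmul [simp] src_gmul [simp] gmul_assoc [simp]
  rng_gmul_left [simp] src_gmul_right [simp] ginv_closed [simp] rng_ginv [simp] src_ginv [simp]
  gmul_ginv_right [simp] gmul_ginv_left [simp]

lemma gmul_unit_left [simp]: "\<lbrakk>u \<in> units G; g \<in> arrows G; rng G g = u\<rbrakk> \<Longrightarrow> gmul G u g = g"
  by auto

lemma gmul_unit_right [simp]: "\<lbrakk>u \<in> units G; g \<in> arrows G; src G g = u\<rbrakk> \<Longrightarrow> gmul G g u = g"
  by auto

text \<open>Since \<open>gmul_assoc\<close> as a simplification rule associates to the right, an
  arrow followed by its inverse is usually separated by brackets inside a longer product. This rule
  and \<open>gmul_cancel_left\<close> restore the cancellation there, so that identities between
  words in a groupoid are proved by simplification.\<close>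

lemma gmul_ginv_cancel_left [simp]:
  "\<lbrakk>g \<in> arrows G; h \<in> arrows G; rng G g = rng G h\<rbrakk> \<Longrightarrow> gmul G g (gmul G (ginv G g) h) = h"
  using gmul_assoc[of g "ginv G g" h] by simp

lemma gmul_cancel_left [simp]:
  "\<lbrakk>g \<in> arrows G; h \<in> arrows G; src G g = rng G h\<rbrakk> \<Longrightarrow> gmul G (ginv G g) (gmul G g h) = h"
  using gmul_assoc[of "ginv G g" g h] by simp

lemma ginv_unique:
  assumes "g \<in> arrows G" "h \<in> arrows G" "src G g = rng G h" "gmul G g h = rng G g"
  shows "h = ginv G g"
proof -
  have "h = gmul G (ginv G g) (gmul G g h)" using assms by (intro gmul_cancel_left[symmetric])
  also have "\<dots> = gmul G (ginv G g) (src G (ginv G g))" using assms(1,4) by simp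
  also have "\<dots> = ginv G g" using assms(1) by (intro src_gmul_right) simp
  finally show ?thesis .
qed

lemma ginv_unit [simp]: "u \<in> units G \<Longrightarrow> ginv G u = u"
  using ginv_unique[of u u] unitsD[of u] by simp

end

text \<open>The common setting of the chain complex and of etale equivalences. It passes to
  restrictions, ampliations and stabilisations, and it also covers the middle groupoid of a Morita
  equivalence, which is given as etale and Hausdorff only.\<close>

locale Hausdorff_etale_groupoid = groupoid +
  assumes Hausdorff: "Hausdorff_space (gtop G)"
    and continuous_rng: "continuous_map (gtop G) (gtop G) (rng G)"
    and continuous_src: "continuous_map (gtop G) (gtop G) (src G)"
    and continuous_ginv: "continuous_map (gtop G) (gtop G) (ginv G)"
    and continuous_gmul:
      "continuous_map
         (subtopology (prod_topology (gtop G) (gtop G)) {(g, h). src G g = rng G h})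
         (gtop G) (\<lambda>(g, h). gmul G g h)"
    and open_units: "openin (gtop G) (units G)"
    and local_homeomorphism_rng: "local_homeomorphism (gtop G) (unit_space G) (rng G)"
    and local_homeomorphism_src: "local_homeomorphism (gtop G) (unit_space G) (src G)"

lemma Hausdorff_etale_groupoidI:
  assumes "etale_groupoid G" "Hausdorff_groupoid G"
  shows "Hausdorff_etale_groupoid G"
proof -
  interpret etale_groupoid G by fact
  show ?thesis
    using assms(2) continuous_rng continuous_src continuous_ginv continuous_gmul open_units
      local_homeomorphism_rng local_homeomorphism_src
    by unfold_locales (simp_all add: Hausdorff_groupoid_def)
qed

lemma topspace_unit_space [simp]: "topspace (unit_space G) = units G"
  by (auto simp: unit_space_def units_def)

context Hausdorff_etale_groupoid
begin

lemma continuous_map_gmul: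
  assumes "continuous_map X (gtop G) f" "continuous_map X (gtop G) h"
    and "\<And>x. x \<in> topspace X \<Longrightarrow> src G (f x) = rng G (h x)"
  shows "continuous_map X (gtop G) (\<lambda>x. gmul G (f x) (h x))"
proof -
  have "continuous_map X (subtopology (prod_topology (gtop G) (gtop G)) {(g, h). src G g = rng G h})
     (\<lambda>x. (f x, h x))"
    using assms by (auto simp: continuous_map_in_subtopology intro!: continuous_map_pairedI)
  from continuous_map_compose[OF this continuous_gmul] show ?thesis by (simp add: o_def)
qed

lemma continuous_map_rng:
  "continuous_map X (gtop G) f \<Longrightarrow> continuous_map X (gtop G) (\<lambda>x. rng G (f x))"
  using continuous_map_compose[OF _ continuous_rng] by (simp add: o_def)

lemma continuous_map_ginv:
  "continuous_map X (gtop G) f \<Longrightarrow> continuous_map X (gtop G) (\<lambda>x. ginv G (f x))"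
  using continuous_map_compose[OF _ continuous_ginv] by (simp add: o_def)

lemma Hausdorff_unit_space: "Hausdorff_space (unit_space G)"
  by (simp add: unit_space_def Hausdorff Hausdorff_space_subtopology)

end

text \<open>
  Composable \<open>n\<close>-tuples are the same as functors \<open>c\<close> from the indiscrete groupoid on \<open>{0..n}\<close>, with
  \<open>c i j\<close> an arrow from the object \<open>c j j\<close> to \<open>c i i\<close>.  In these terms every simplicial map is a
  reindexing, which turns identities between face maps into identities between index maps.
\<close>

definition diagram :: "'a groupoid \<Rightarrow> nat \<Rightarrow> (nat \<Rightarrow> nat \<Rightarrow> 'a) \<Rightarrow> bool" where
  "diagram G n c \<longleftrightarrow>
     (\<forall>i\<le>n. c i i \<in> units G) \<and>
     (\<forall>i\<le>n. \<forall>j\<le>n. c i j \<in> arrows G \<and> rng G (c i j) = c i i \<and> src G (c i j) = c j j) \<and>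
     (\<forall>i\<le>n. \<forall>j\<le>n. \<forall>k\<le>n. gmul G (c i j) (c j k) = c i k)"

text \<open>Entry k is the edge from vertex k to vertex k - 1. The cap \<open>min k n\<close> takes
  effect only for n = 0, where the single entry must be the unit \<open>c 0 0\<close>, in agreement
  with the encoding of degree 0 in \<open>nerve\<close>.\<close>

definition tuple_of :: "nat \<Rightarrow> (nat \<Rightarrow> nat \<Rightarrow> 'a) \<Rightarrow> nat \<Rightarrow> 'a" where
  "tuple_of n c = (\<lambda>k\<in>{1..max 1 n}. c (k - 1) (min k n))"

text \<open>The composite of the first j entries, an arrow from vertex j to vertex 0.\<close>

fun initial_arrow :: "'a groupoid \<Rightarrow> (nat \<Rightarrow> 'a) \<Rightarrow> nat \<Rightarrow> 'a" where
  "initial_arrow G g 0 = rng G (g 1)"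
| "initial_arrow G g (Suc j) = gmul G (initial_arrow G g j) (g (Suc j))"

text \<open>Vertices are compared through vertex 0. For i < j the result is the product of the
  entries i + 1 to j, for i > j its inverse, so one formula without case distinction gives all
  arrows of the diagram.\<close>

definition edge :: "'a groupoid \<Rightarrow> (nat \<Rightarrow> 'a) \<Rightarrow> nat \<Rightarrow> nat \<Rightarrow> 'a" where
  "edge G g i j = gmul G (ginv G (initial_arrow G g i)) (initial_arrow G g j)"

lemma diagramD:
  assumes "diagram G n c" "i \<le> n" "j \<le> n"
  shows "c i j \<in> arrows G" "rng G (c i j) = c i i" "src G (c i j) = c j j" "c i i \<in> units G"
    "k \<le> n \<Longrightarrow> gmul G (c i j) (c j k) = c i k"
  using assms by (auto simp: diagram_def)

text \<open>A diagram contains the arrows between any two vertices in both directions, so every map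
  of indices acts on it, monotone or not.\<close>

lemma diagram_reindex:
  "diagram G n c \<Longrightarrow> (\<And>a. a \<le> m \<Longrightarrow> \<alpha> a \<le> n) \<Longrightarrow> diagram G m (\<lambda>a b. c (\<alpha> a) (\<alpha> b))"
  by (simp add: diagram_def)

lemma tuple_of_cong:
  assumes "\<And>a b. a \<le> n \<Longrightarrow> b \<le> n \<Longrightarrow> c a b = c' a b"
  shows "tuple_of n c = tuple_of n c'"
  unfolding tuple_of_def
  by (rule restrict_ext) (use assms in \<open>auto simp: min_def split: if_splits\<close>)

lemma nerve_arrow:
  assumes "g \<in> nerve G n" "k \<in> {1..max 1 n}"
  shows "g k \<in> arrows G"
  using assms by (auto simp: nerve_def units_def split: if_splits)

lemma nerve_space_topspace [simp]: "topspace (nerve_space G n) = nerve G n"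
proof -
  have "nerve G n \<subseteq> {1..max 1 n} \<rightarrow>\<^sub>E arrows G"
    by (auto simp: nerve_def units_def PiE_def extensional_def)
  then show ?thesis by (auto simp: nerve_space_def)
qed

context groupoid
begin

lemma initial_arrow_props:
  assumes "g \<in> nerve G n" "j \<le> n"
  shows "initial_arrow G g j \<in> arrows G \<and> rng G (initial_arrow G g j) = rng G (g 1) \<and>
    src G (initial_arrow G g j) = (if j = 0 then rng G (g 1) else src G (g j))"
  using assms(2)
proof (induction j)
  case 0
  then show ?case using nerve_arrow[OF assms(1), of 1] by simp
next
  case (Suc j)
  then have a: "g (Suc j) \<in> arrows G" using nerve_arrow[OF assms(1), of "Suc j"] by simp
  have "src G (initial_arrow G g j) = rng G (g (Suc j))"
  proof (cases "j = 0")
    case True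
    then show ?thesis using Suc by simp
  next
    case False
    then have "src G (g j) = rng G (g (Suc j))"
      using Suc.prems assms(1) by (auto simp: nerve_def)
    then show ?thesis using Suc False by simp
  qed
  then show ?case using Suc a by simp
qed

lemma vertex_eq:
  assumes "g \<in> nerve G n" "j \<le> n"
  shows "edge G g j j = (if j = 0 then rng G (g 1) else src G (g j))"
  using initial_arrow_props[OF assms] by (simp add: edge_def)

lemma diagram_edge:
  assumes g: "g \<in> nerve G n"
  shows "diagram G n (edge G g)"
  unfolding diagram_def
proof (intro conjI allI impI)
  fix i assume i: "i \<le> n"
  note pi = initial_arrow_props[OF g i]
  show "edge G g i i \<in> units G" using pi src_unit[of "initial_arrow G g i"] by (simp add: edge_def)
  fix j assume j: "j \<le> n"
  note pj = initial_arrow_props[OF g j]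
  show "edge G g i j \<in> arrows G" "rng G (edge G g i j) = edge G g i i"
    "src G (edge G g i j) = edge G g j j"
    using pi pj by (auto simp: edge_def)
  fix k assume k: "k \<le> n"
  note pk = initial_arrow_props[OF g k]
  show "gmul G (edge G g i j) (edge G g j k) = edge G g i k"
    unfolding edge_def using pi pj pk by simp
qed

text \<open>With \<open>edge_tuple_of\<close> this makes tuples and diagrams mutually inverse
  descriptions. A map on tuples can then be defined on diagrams, and an identity between such maps
  can be checked there.\<close>

lemma tuple_of_edge:
  assumes g: "g \<in> nerve G n"
  shows "tuple_of n (edge G g) = g"
proof
  fix k
  show "tuple_of n (edge G g) k = g k"
  proof (cases "k \<in> {1..max 1 n}")
    case False
    have "g \<in> extensional {1..max 1 n}"
      using g by (auto simp: nerve_def PiE_def extensional_def max_def split: if_splits)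
    then show ?thesis using False by (auto simp: tuple_of_def extensional_def)
  next
    case k: True
    show ?thesis
    proof (cases "n = 0")
      case True
      then have "k = 1" "g 1 \<in> units G" using k g by (auto simp: nerve_def)
      then show ?thesis using True unitsD[of "g 1"] vertex_eq[OF g, of 0] by (simp add: tuple_of_def)
    next
      case False
      then obtain j where j: "k = Suc j" "Suc j \<le> n" using k by (cases k) auto
      then have pj: "initial_arrow G g j \<in> arrows G" "src G (initial_arrow G g j) = rng G (g (Suc j))"
        using initial_arrow_props[OF g, of j] g by (auto simp: nerve_def)
      have "edge G g j (Suc j) = g (Suc j)"
        unfolding edge_def using pj nerve_arrow[OF g, of "Suc j"] j by simp
      then show ?thesis using j by (simp add: tuple_of_def min_def)
    qed
  qed
qed

lemma tuple_of_nerve: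
  assumes "diagram G n c"
  shows "tuple_of n c \<in> nerve G n"
proof (cases "n = 0")
  case True
  then show ?thesis using assms by (auto simp: nerve_def tuple_of_def diagram_def)
next
  case False
  have "src G (c (i - 1) (min i n)) = rng G (c i (min (i + 1) n))" if "i \<in> {1..<n}" for i
  proof -
    have "i - 1 \<le> n" "i \<le> n" "i + 1 \<le> n" using that by auto
    then show ?thesis
      using diagramD(3)[OF assms, of "i - 1" i] diagramD(2)[OF assms, of i "i + 1"] by (simp add: min_def)
  qed
  then show ?thesis using False assms
    by (auto simp: nerve_def tuple_of_def max_def intro!: diagramD)
qed

lemma diagram_inverse:
  assumes c: "diagram G n c" and "i \<le> n" "j \<le> n"
  shows "ginv G (c i j) = c j i"
  using ginv_unique[of "c i j" "c j i"] diagramD[OF c] assms(2,3) by simp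

lemma edge_tuple_of:
  assumes c: "diagram G n c" and ij: "i \<le> n" "j \<le> n"
  shows "edge G (tuple_of n c) i j = c i j"
proof -
  \<comment> \<open>The product telescopes: the edges c 0 1, c 1 2 and so on compose to
    \<open>c 0 k\<close>.\<close>
  have initial_arrow: "initial_arrow G (tuple_of n c) k = c 0 k" if "k \<le> n" for k
    using that
  proof (induction k)
    case 0
    then show ?case using diagramD[OF c] by (simp add: tuple_of_def)
  next
    case (Suc k)
    then show ?case using diagramD(5)[OF c, of 0 k "Suc k"] by (simp add: tuple_of_def min_def)
  qed
  show ?thesis
    unfolding edge_def using diagramD(5)[OF c, of i 0 j] diagram_inverse[OF c, of 0 i] ij by (simp add: initial_arrow)
qed

text \<open>Vertex i is moved along an arrow t i that starts there. In a product the inner factors,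
  the inverse of t j followed by t j, cancel. The prism over a similarity arises from the diagram of
  \<rho> in this way.\<close>

lemma diagram_conjugate:
  assumes c: "diagram G n c"
    and t: "\<And>i. i \<le> n \<Longrightarrow> t i \<in> arrows G \<and> src G (t i) = c i i"
  shows "diagram G n (\<lambda>i j. gmul G (gmul G (t i) (c i j)) (ginv G (t j)))"
proof -
  have tc: "gmul G (t i) (c i i) = t i" if "i \<le> n" for i
    using t[OF that] diagramD[OF c that that] by simp
  have d: "gmul G (gmul G (t i) (c i i)) (ginv G (t i)) = rng G (t i)" if "i \<le> n" for i
    using t[OF that] tc[OF that] by simp
  have e: "gmul G (gmul G (t i) (c i j)) (ginv G (t j)) \<in> arrows G"
    "rng G (gmul G (gmul G (t i) (c i j)) (ginv G (t j))) = rng G (t i)"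
    "src G (gmul G (gmul G (t i) (c i j)) (ginv G (t j))) = rng G (t j)"
    if "i \<le> n" "j \<le> n" for i j
    using t[OF that(1)] t[OF that(2)] diagramD[OF c that] by simp_all
  have m: "gmul G (gmul G (gmul G (t i) (c i j)) (ginv G (t j))) (gmul G (gmul G (t j) (c j k)) (ginv G (t k)))
     = gmul G (gmul G (t i) (c i k)) (ginv G (t k))" if "i \<le> n" "j \<le> n" "k \<le> n" for i j k
  proof -
    have "gmul G (c i j) (gmul G (c j k) (ginv G (t k))) = gmul G (c i k) (ginv G (t k))"
      using gmul_assoc[of "c i j" "c j k" "ginv G (t k)"] t[OF that(3)] diagramD[OF c] that by simp
    then show ?thesis
      using t[OF that(1)] t[OF that(2)] t[OF that(3)] diagramD[OF c] that by simp
  qed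
  show ?thesis
    unfolding diagram_def
    using d e m t rng_unit by simp
qed

end

lemma diagram_hom:
  assumes "diagram G n c" "groupoid_hom G H \<phi>"
  shows "diagram H n (\<lambda>i j. \<phi> (c i j))"
proof -
  have "\<phi> (c i i) \<in> units H" if "i \<le> n" for i
    using diagramD[OF assms(1) that that] assms(2) by (auto simp: groupoid_hom_def units_def)
  moreover have "gmul H (\<phi> (c i j)) (\<phi> (c j k)) = \<phi> (c i k)" if "i \<le> n" "j \<le> n" "k \<le> n" for i j k
  proof -
    have "\<phi> (gmul G (c i j) (c j k)) = gmul H (\<phi> (c i j)) (\<phi> (c j k))"
      using assms(2) diagramD(1-3)[OF assms(1) that(1,2)] diagramD(1-3)[OF assms(1) that(2,3)]
      by (simp add: groupoid_hom_def)
    then show ?thesis using diagramD(5)[OF assms(1) that] by simp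
  qed
  moreover have "\<phi> (c i j) \<in> arrows H \<and> rng H (\<phi> (c i j)) = \<phi> (c i i) \<and> src H (\<phi> (c i j)) = \<phi> (c j j)"
    if "i \<le> n" "j \<le> n" for i j
    using diagramD[OF assms(1)] assms(2) that by (simp add: groupoid_hom_def)
  ultimately show ?thesis
    unfolding diagram_def by simp
qed

context Hausdorff_etale_groupoid
begin

lemma Hausdorff_nerve_space: "Hausdorff_space (nerve_space G n)"
  unfolding nerve_space_def
  by (intro Hausdorff_space_subtopology) (simp add: Hausdorff_space_product_topology Hausdorff)

lemma continuous_map_coordinate:
  assumes "k \<in> {1..max 1 n}"
  shows "continuous_map (nerve_space G n) (gtop G) (\<lambda>g. g k)"
  unfolding nerve_space_def
  by (intro continuous_map_from_subtopology continuous_map_product_projection) (use assms in auto)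

lemma continuous_map_initial_arrow:
  "j \<le> n \<Longrightarrow> continuous_map (nerve_space G n) (gtop G) (\<lambda>g. initial_arrow G g j)"
proof (induction j)
  case 0
  then show ?case by (simp add: continuous_map_rng continuous_map_coordinate)
next
  case (Suc j)
  have "src G (initial_arrow G g j) = rng G (g (Suc j))" if g: "g \<in> nerve G n" for g
    using initial_arrow_props[OF g, of j] Suc.prems g by (auto simp: nerve_def)
  then show ?case
    using Suc by (auto intro!: continuous_map_gmul continuous_map_coordinate)
qed

lemma continuous_map_edge:
  assumes "i \<le> n" "j \<le> n"
  shows "continuous_map (nerve_space G n) (gtop G) (\<lambda>g. edge G g i j)"
  unfolding edge_def
  using assms initial_arrow_props by (intro continuous_map_gmul continuous_map_ginv continuous_map_initial_arrow) auto

lemma continuous_map_tuple_of: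
  assumes "\<And>a b. a \<le> n \<Longrightarrow> b \<le> n \<Longrightarrow> continuous_map X (gtop G) (\<lambda>x. c x a b)"
    and "\<And>x. x \<in> topspace X \<Longrightarrow> diagram G n (c x)"
  shows "continuous_map X (nerve_space G n) (\<lambda>x. tuple_of n (c x))"
  unfolding nerve_space_def continuous_map_in_subtopology continuous_map_componentwise
proof (intro conjI ballI)
  show "(\<lambda>x. tuple_of n (c x)) \<in> topspace X \<rightarrow> nerve G n"
    using tuple_of_nerve assms(2) by auto
  show "(\<lambda>x. tuple_of n (c x)) ` topspace X \<subseteq> extensional {1..max 1 n}"
    by (auto simp: tuple_of_def)
  fix k assume "k \<in> {1..max 1 n}"
  then show "continuous_map X (gtop G) (\<lambda>x. tuple_of n (c x) k)"
    using assms(1)[of "k - 1" "min k n"] by (auto simp: tuple_of_def max_def split: if_splits)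
qed

end


section \<open>Face maps and the boundary\<close>

lemma edge_restrict:
  assumes "i \<le> n" "j \<le> n" "1 \<le> n"
  shows "edge G (restrict g {1..n}) i j = edge G g i j"
proof -
  have "initial_arrow G (restrict g {1..n}) k = initial_arrow G g k" if "k \<le> n" for k
    using that assms(3) by (induction k) auto
  then show ?thesis using assms by (simp add: edge_def)
qed

context Hausdorff_etale_groupoid
begin

lemma homeomorphic_map_coordinate:
  assumes "n \<le> 1"
  shows "homeomorphic_map (nerve_space G n) (subtopology (gtop G) (if n = 0 then units G else arrows G)) (\<lambda>g. g 1)"
    (is "homeomorphic_map _ (subtopology _ ?S) _")
proof (rule homeomorphic_maps_imp_map)
  have S: "?S \<subseteq> arrows G" by (auto simp: units_def)
  have nerve: "nerve G n = {1..1} \<rightarrow>\<^sub>E ?S"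
  proof (cases "n = 0")
    case False
    then have "n = 1" using assms by simp
    then show ?thesis by (simp add: nerve_def)
  qed (simp add: nerve_def)
  have max: "max 1 n = 1" using assms by simp
  show "homeomorphic_maps (nerve_space G n) (subtopology (gtop G) ?S) (\<lambda>g. g 1) (\<lambda>a. \<lambda>k\<in>{1..1}. a)"
    unfolding homeomorphic_maps_def
  proof (intro conjI ballI)
    show "continuous_map (nerve_space G n) (subtopology (gtop G) ?S) (\<lambda>g. g 1)"
      using continuous_map_coordinate[of 1 n] by (auto simp: continuous_map_in_subtopology nerve)
    show "continuous_map (subtopology (gtop G) ?S) (nerve_space G n) (\<lambda>a. \<lambda>k\<in>{1..1}. a)"
      unfolding nerve_space_def continuous_map_in_subtopology continuous_map_componentwise max
      using S by (auto simp: nerve)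
    show "(\<lambda>k\<in>{1..1}. g 1) = g" if "g \<in> topspace (nerve_space G n)" for g
      using that by (auto simp: nerve fun_eq_iff PiE_iff extensional_def) 
  qed auto
qed

text \<open>An (n+1)-tuple is an n-tuple together with an arrow whose range is its last vertex, so
  the nerve in degree n + 1 is the pullback P of the last vertex map and the range map. Both are
  local homeomorphisms, hence so are both projections of P. The new vertex is the source of the
  second projection; the old vertices factor through the first.\<close>

lemma local_homeomorphism_vertex:
  "j \<le> n \<Longrightarrow> local_homeomorphism (nerve_space G n) (unit_space G) (\<lambda>g. edge G g j j)"
proof (induction n arbitrary: j)
  case 0
  have h: "local_homeomorphism (nerve_space G 0) (unit_space G) (\<lambda>g. g 1)"
    using homeomorphic_imp_local_homeomorphism[OF homeomorphic_map_coordinate[of 0]]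
    by (simp add: unit_space_def)
  have "edge G g 0 0 = g 1" if "g \<in> nerve G 0" for g
    using vertex_eq[OF that, of 0] unitsD[of "g 1"] that by (auto simp: nerve_def)
  then show ?case
    using 0 by (intro local_homeomorphism_eq[OF h]) simp
next
  case (Suc n)
  show ?case
  \<comment> \<open>Degrees 0 and 1 share the index set {1..1}, so passing from 0 to 1 adds no
    coordinate and the description by P starts only after it.\<close>
  proof (cases "n = 0")
    case True
    have h: "local_homeomorphism (nerve_space G (Suc n)) (gtop G) (\<lambda>g. g 1)"
      using homeomorphic_imp_local_homeomorphism[OF homeomorphic_map_coordinate[of 1]] True by simp
    have "local_homeomorphism (nerve_space G (Suc n)) (unit_space G)
      (\<lambda>g. if j = 0 then rng G (g 1) else src G (g 1))"
      using local_homeomorphism_compose'[OF h local_homeomorphism_rng]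
        local_homeomorphism_compose'[OF h local_homeomorphism_src] by (cases "j = 0") auto
    then show ?thesis
      by (rule local_homeomorphism_eq) (use Suc.prems True in \<open>auto simp: vertex_eq le_Suc_eq\<close>)
  next
    case False
    define P where "P = subtopology (prod_topology (nerve_space G n) (gtop G)) {(x, a). edge G x n n = rng G a}"
    have max: "max 1 n = n" "max (Suc 0) n = n" "max 1 (Suc n) = Suc n" using False by auto
    have nerve: "nerve G m = {g \<in> {1..m} \<rightarrow>\<^sub>E arrows G. \<forall>i\<in>{1..<m}. src G (g i) = rng G (g (i + 1))}"
      if "m > 0" for m using that by (simp add: nerve_def)
    have restr: "restrict g {1..n} \<in> nerve G n" "edge G (restrict g {1..n}) n n = rng G (g (Suc n))"
      if g: "g \<in> nerve G (Suc n)" for g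
    proof -
      show "restrict g {1..n} \<in> nerve G n"
        using g False by (auto simp: nerve)
      show "edge G (restrict g {1..n}) n n = rng G (g (Suc n))"
        using g False vertex_eq[OF g, of n] edge_restrict[of n n n G g] by (simp add: nerve)
    qed
    have "homeomorphic_map (nerve_space G (Suc n)) P (\<lambda>g. (restrict g {1..n}, g (Suc n)))"
    proof (rule homeomorphic_maps_imp_map)
      show "homeomorphic_maps (nerve_space G (Suc n)) P (\<lambda>g. (restrict g {1..n}, g (Suc n)))
        (\<lambda>(x, a). \<lambda>k\<in>{1..Suc n}. if k \<le> n then x k else a)"
        unfolding homeomorphic_maps_def
      proof (intro conjI ballI)
        have "continuous_map (nerve_space G (Suc n)) (product_topology (\<lambda>_. gtop G) {1..n}) (\<lambda>g. restrict g {1..n})"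
          unfolding continuous_map_componentwise
          by (auto intro!: continuous_map_coordinate)
        then have "continuous_map (nerve_space G (Suc n)) (nerve_space G n) (\<lambda>g. restrict g {1..n})"
          using restr(1) by (simp add: nerve_space_def[of G n] continuous_map_in_subtopology max)
        then show "continuous_map (nerve_space G (Suc n)) P (\<lambda>g. (restrict g {1..n}, g (Suc n)))"
          using restr(2) unfolding P_def continuous_map_in_subtopology
          by (auto intro!: continuous_map_pairedI continuous_map_coordinate)
        have inP: "(\<lambda>k\<in>{1..Suc n}. if k \<le> n then x k else a) \<in> nerve G (Suc n)" if "(x, a) \<in> topspace P" for x a
        proof -
          have x: "x \<in> nerve G n" "a \<in> arrows G" "edge G x n n = rng G a" using that by (auto simp: P_def)
          then have "src G (x n) = rng G a" using vertex_eq[OF x(1), of n] False by simp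
          then show ?thesis using x(1,2) False
            by (auto simp: nerve less_Suc_eq) (metis Suc_leI le_neq_implies_less)
        qed
        have "continuous_map P (gtop G) (\<lambda>p. (\<lambda>k\<in>{1..Suc n}. if k \<le> n then fst p k else snd p) k)"
          if "k \<in> {1..Suc n}" for k
        proof (cases "k \<le> n")
          case True
          have "continuous_map P (gtop G) (\<lambda>p. fst p k)"
            unfolding P_def
            by (intro continuous_map_from_subtopology continuous_map_compose[OF continuous_map_fst continuous_map_coordinate, unfolded o_def])
              (use True that in auto)
          then show ?thesis using True that by simp
        next
          case False
          then show ?thesis using that
            by (simp add: P_def continuous_map_from_subtopology continuous_map_snd)
        qed
        then show "continuous_map P (nerve_space G (Suc n)) (\<lambda>(x, a). \<lambda>k\<in>{1..Suc n}. if k \<le> n then x k else a)"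
          unfolding nerve_space_def[of G "Suc n"] continuous_map_in_subtopology continuous_map_componentwise max
          using inP by (auto simp: case_prod_unfold)
      next
        fix g assume "g \<in> topspace (nerve_space G (Suc n))"
        then have "g \<in> extensional {1..Suc n}" by (auto simp: nerve PiE_def)
        then show "(case (restrict g {1..n}, g (Suc n)) of (x, a) \<Rightarrow> \<lambda>k\<in>{1..Suc n}. if k \<le> n then x k else a) = g"
          by (auto simp: fun_eq_iff extensional_def le_Suc_eq)
      next
        fix p assume p: "p \<in> topspace P"
        obtain x a where xa: "p = (x, a)" by fastforce
        then have "x \<in> extensional {1..n}" using p False by (auto simp: P_def nerve PiE_def)
        then show "(restrict (case p of (x, a) \<Rightarrow> \<lambda>k\<in>{1..Suc n}. if k \<le> n then x k else a) {1..n},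
            (case p of (x, a) \<Rightarrow> \<lambda>k\<in>{1..Suc n}. if k \<le> n then x k else a) (Suc n)) = p"
          by (auto simp: xa fun_eq_iff extensional_def)
      qed
    qed
    then have h: "local_homeomorphism (nerve_space G (Suc n)) P (\<lambda>g. (restrict g {1..n}, g (Suc n)))"
      by (rule homeomorphic_imp_local_homeomorphism)
    show ?thesis
    proof (cases "j = Suc n")
      case True
      have "local_homeomorphism P (gtop G) snd"
        unfolding P_def by (rule local_homeomorphism_pullback[OF Suc.IH[OF order_refl] local_homeomorphism_imp_continuous_map[OF local_homeomorphism_rng]])
      from local_homeomorphism_compose'[OF local_homeomorphism_compose'[OF h this] local_homeomorphism_src]
      show ?thesis
        by (rule local_homeomorphism_eq) (use True in \<open>simp add: vertex_eq\<close>)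
    next
      case False
      then have j: "j \<le> n" using Suc.prems by simp
      have "local_homeomorphism P (nerve_space G n) fst"
        unfolding P_def by (rule local_homeomorphism_pullback_fst[OF local_homeomorphism_rng local_homeomorphism_imp_continuous_map[OF Suc.IH[OF order_refl]]])
      from local_homeomorphism_compose'[OF local_homeomorphism_compose'[OF h this] Suc.IH[OF j]]
      show ?thesis
        by (rule local_homeomorphism_eq) (use edge_restrict[OF j j, of G] \<open>n \<noteq> 0\<close> in \<open>simp only: fst_conv One_nat_def Suc_le_eq neq0_conv\<close>)
    qed
  qed
qed

text \<open>Vertex j of the resulting tuple is \<open>c x j j\<close>, so cancelling one vertex map
  of the target suffices. Which vertex is a free choice: reindexings and induced maps use vertex 0,
  prisms the last one, which lies on the \<rho>-side.\<close>

lemma local_homeomorphism_tuple_of: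
  assumes "\<And>a b. a \<le> n \<Longrightarrow> b \<le> n \<Longrightarrow> continuous_map X (gtop G) (\<lambda>x. c x a b)"
    and "\<And>x. x \<in> topspace X \<Longrightarrow> diagram G n (c x)"
    and "j \<le> n" "local_homeomorphism X (unit_space G) (\<lambda>x. c x j j)"
  shows "local_homeomorphism X (nerve_space G n) (\<lambda>x. tuple_of n (c x))"
proof (rule local_homeomorphism_cancel[OF _ local_homeomorphism_vertex[OF assms(3)] continuous_map_tuple_of[OF assms(1,2)]])
  show "local_homeomorphism X (unit_space G) (\<lambda>x. edge G (tuple_of n (c x)) j j)"
    by (rule local_homeomorphism_eq[OF assms(4)]) (use assms(2,3) edge_tuple_of in metis)
qed auto

lemma local_homeomorphism_reindex:
  assumes "\<And>a. a \<le> m \<Longrightarrow> \<alpha> a \<le> n"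
  shows "local_homeomorphism (nerve_space G n) (nerve_space G m) (\<lambda>g. tuple_of m (\<lambda>a b. edge G g (\<alpha> a) (\<alpha> b)))"
proof (rule local_homeomorphism_tuple_of)
  show "continuous_map (nerve_space G n) (gtop G) (\<lambda>g. edge G g (\<alpha> a) (\<alpha> b))" if "a \<le> m" "b \<le> m" for a b
    using that assms by (intro continuous_map_edge) auto
  show "diagram G m (\<lambda>a b. edge G g (\<alpha> a) (\<alpha> b))" if "g \<in> topspace (nerve_space G n)" for g
    by (rule diagram_reindex[OF diagram_edge assms]) (use that in simp_all)
  show "local_homeomorphism (nerve_space G n) (unit_space G) (\<lambda>g. edge G g (\<alpha> 0) (\<alpha> 0))"
    using assms by (intro local_homeomorphism_vertex) auto
qed simp

end

section \<open>Faces as reindexings, and the boundary operator\<close>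

text \<open>Faces of degree 1 land in units, where the source takes the role of d_0 and the range
  that of d_1. With these conventions the signs of the general alternating sum reproduce the
  boundary in degree 1, and no degree has to be treated separately later.\<close>

definition face_map :: "'a groupoid \<Rightarrow> nat \<Rightarrow> nat \<Rightarrow> (nat \<Rightarrow> 'a) \<Rightarrow> (nat \<Rightarrow> 'a)" where
  "face_map G n i = (if n = 1 then nerve_map 0 (if i = 0 then src G else rng G) else face G n i)"

text \<open>The i-th coface map of the simplex category: the increasing injection whose image omits
  i.\<close>

definition skip :: "nat \<Rightarrow> nat \<Rightarrow> nat" where
  "skip i a = (if a < i then a else Suc a)"

lemma boundary_eq_sum:
  assumes "0 < n"
  shows "boundary G n f x = (\<Sum>i\<le>n. (-1) ^ i * pushforward (nerve_space G n) (face_map G n i) f x)"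
proof (cases "n = 1")
  case True
  then show ?thesis by (simp add: boundary_def face_map_def)
next
  case False
  then show ?thesis using assms by (simp add: boundary_def face_map_def atMost_atLeast0)
qed

context Hausdorff_etale_groupoid
begin

text \<open>Omitting an inner vertex i merges the two edges at i by the composition law of the
  diagram; omitting the first or last vertex drops an end edge. This is the bridge from the explicit
  face formulas to reindexing.\<close>

lemma face_map_eq:
  assumes g: "g \<in> nerve G n" and "0 < n" "i \<le> n"
  shows "face_map G n i g = tuple_of (n - 1) (\<lambda>a b. edge G g (skip i a) (skip i b))"
proof (cases "n = 1")
  case True
  have "i = 0 \<or> i = 1" using True assms by auto
  then show ?thesis
    using True vertex_eq[OF g]
    by (auto simp: face_map_def nerve_map_def tuple_of_def skip_def fun_eq_iff le_Suc_eq)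
next
  case False
  have e: "edge G g k (Suc k) = g (Suc k)" if "Suc k \<le> n" for k
  proof -
    have "tuple_of n (edge G g) (Suc k) = g (Suc k)" by (simp add: tuple_of_edge[OF g])
    then show ?thesis using that by (simp add: tuple_of_def)
  qed
  have d: "diagram G n (edge G g)" by (rule diagram_edge[OF g])
  have "face G n i g k = edge G g (skip i (k - 1)) (skip i (min k (n - 1)))" if k: "k \<in> {1..n - 1}" for k
  proof -
    obtain l where l: "k = Suc l" "Suc (Suc l) \<le> n" using k by (cases k) auto
    consider "k < i" | "k = i" | "i < k" by linarith
    then show ?thesis
    proof cases
      case 1
      then show ?thesis using k l e[of l] by (auto simp: face_def skip_def min_def)
    next
      case 2
      have "gmul G (edge G g l (Suc l)) (edge G g (Suc l) (Suc (Suc l))) = edge G g l (Suc (Suc l))"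
        using diagramD(5)[OF d] l by simp
      then show ?thesis using 2 k l e[of l] e[of "Suc l"] by (auto simp: face_def skip_def min_def)
    next
      case 3
      then show ?thesis using k l e[of "Suc l"] by (auto simp: face_def skip_def min_def)
    qed
  qed
  then show ?thesis
    using False assms by (auto simp: face_map_def tuple_of_def fun_eq_iff face_def)
qed

lemma local_homeomorphism_face_map:
  assumes "0 < n" "i \<le> n"
  shows "local_homeomorphism (nerve_space G n) (nerve_space G (n - 1)) (face_map G n i)"
proof -
  have "skip i a \<le> n" if "a \<le> n - 1" for a using that assms by (auto simp: skip_def)
  note lh = local_homeomorphism_reindex[of "n - 1" "skip i" n, OF this]
  show ?thesis
    by (rule local_homeomorphism_eq[OF lh]) (use face_map_eq[OF _ assms] in auto)
qed

lemma edge_face_map: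
  assumes "g \<in> nerve G n" "0 < n" "i \<le> n" "a \<le> n - 1" "b \<le> n - 1"
  shows "edge G (face_map G n i g) a b = edge G g (skip i a) (skip i b)"
proof -
  have "diagram G (n - 1) (\<lambda>a b. edge G g (skip i a) (skip i b))"
    by (rule diagram_reindex[OF diagram_edge[OF assms(1)]]) (use assms in \<open>auto simp: skip_def\<close>)
  from edge_tuple_of[OF this] show ?thesis using assms by (simp add: face_map_eq)
qed

lemma face_map_nerve:
  "g \<in> nerve G n \<Longrightarrow> 0 < n \<Longrightarrow> i \<le> n \<Longrightarrow> face_map G n i g \<in> nerve G (n - 1)"
  using local_homeomorphism_apply[OF local_homeomorphism_face_map, of n i g] by simp

text \<open>The simplicial identity. Both sides are reindexings of the same diagram, so it reduces
  to the corresponding identity for \<open>skip\<close>, which is arithmetic.\<close>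

lemma face_map_face_map:
  assumes g: "g \<in> nerve G (Suc (Suc n))" and ij: "i < j" "j \<le> Suc (Suc n)"
  shows "face_map G (Suc n) i (face_map G (Suc (Suc n)) j g) =
    face_map G (Suc n) (j - 1) (face_map G (Suc (Suc n)) i g)"
proof -
  have "face_map G (Suc n) k (face_map G (Suc (Suc n)) l g) =
      tuple_of n (\<lambda>a b. edge G g (skip l (skip k a)) (skip l (skip k b)))"
    if kl: "k \<le> Suc n" "l \<le> Suc (Suc n)" for k l
  proof -
    have *: "skip k a \<le> Suc n" if "a \<le> n" for a using that kl by (auto simp: skip_def)
    have "face_map G (Suc n) k (face_map G (Suc (Suc n)) l g) =
      tuple_of n (\<lambda>a b. edge G (face_map G (Suc (Suc n)) l g) (skip k a) (skip k b))"
      using face_map_eq[of "face_map G (Suc (Suc n)) l g" "Suc n" k] face_map_nerve[OF g, of l] kl by simp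
    also have "\<dots> = tuple_of n (\<lambda>a b. edge G g (skip l (skip k a)) (skip l (skip k b)))"
      by (rule tuple_of_cong, rule edge_face_map[OF g]) (use kl * in auto)
    finally show ?thesis .
  qed
  moreover have "skip j (skip i a) = skip i (skip (j - 1) a)" for a
    using ij by (auto simp: skip_def)
  ultimately show ?thesis using ij by simp
qed

lemma chain_carrier [simp]: "carrier (chain_group G n) = compactly_supported (nerve_space G n)"
  by (simp add: chain_group_def)

lemma pushforward_face_map_closed:
  assumes "f \<in> compactly_supported (nerve_space G n)" "0 < n" "i \<le> n"
  shows "pushforward (nerve_space G n) (face_map G n i) f \<in> compactly_supported (nerve_space G (n - 1))"
  by (rule pushforward_compactly_supported[OF local_homeomorphism_face_map])
    (use assms Hausdorff_nerve_space in auto)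

lemma boundary_eq_sum_fun:
  "0 < n \<Longrightarrow> boundary G n f =
    (\<lambda>x. \<Sum>i\<in>{..n}. (-1) ^ i * pushforward (nerve_space G n) (face_map G n i) f x)"
  by (rule ext) (rule boundary_eq_sum)

lemma boundary_closed:
  assumes "f \<in> compactly_supported (nerve_space G n)" "0 < n"
  shows "boundary G n f \<in> compactly_supported (nerve_space G (n - 1))"
  unfolding boundary_eq_sum_fun[OF assms(2)]
  by (rule sum_compactly_supported) (use pushforward_face_map_closed assms in auto)

lemma boundary_linear:
  assumes "f \<in> compactly_supported (nerve_space G n)" "g \<in> compactly_supported (nerve_space G n)"
  shows "boundary G n (\<lambda>x. a * f x + b * g x) y = a * boundary G n f y + b * boundary G n g y"
proof (cases "n = 0")
  case False
  then have n: "0 < n" by simp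
  have "boundary G n (\<lambda>x. a * f x + b * g x) y =
      (\<Sum>i\<le>n. a * ((-1) ^ i * pushforward (nerve_space G n) (face_map G n i) f y) +
        b * ((-1) ^ i * pushforward (nerve_space G n) (face_map G n i) g y))"
    unfolding boundary_eq_sum[OF n]
  proof (rule sum.cong[OF refl])
    fix i assume "i \<in> {..n}"
    then have "local_homeomorphism (nerve_space G n) (nerve_space G (n - 1)) (face_map G n i)"
      using n by (intro local_homeomorphism_face_map) auto
    from pushforward_linear[OF this assms]
    show "(-1) ^ i * pushforward (nerve_space G n) (face_map G n i) (\<lambda>x. a * f x + b * g x) y =
      a * ((-1) ^ i * pushforward (nerve_space G n) (face_map G n i) f y) +
        b * ((-1) ^ i * pushforward (nerve_space G n) (face_map G n i) g y)"
      by (simp add: algebra_simps)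
  qed
  with n show ?thesis
    by (simp add: boundary_eq_sum sum.distrib sum_distrib_left)
qed (simp add: boundary_def)

end

section \<open>Cancellation in alternating sums of faces and prisms\<close>

lemma neg_one_power_pred: "0 < j \<Longrightarrow> (-1) ^ (j - Suc 0) = - ((-1 :: int) ^ j)"
  by (cases j) auto

text \<open>The pairs with i < j correspond to the pairs with j \<le> i by sending (i, j) to (j - 1,
  i). This preserves the value of D and shifts the exponent of the sign by one, so the two halves
  cancel.\<close>

lemma alternating_sum_faces:
  fixes D :: "nat \<Rightarrow> nat \<Rightarrow> int"
  assumes "\<And>i j. i < j \<Longrightarrow> j \<le> Suc n \<Longrightarrow> D i j = D (j - 1) i"
  shows "(\<Sum>i\<le>n. \<Sum>j\<le>Suc n. (-1) ^ (i + j) * D i j) = 0"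
proof -
  let ?T = "\<lambda>(i, j). (-1) ^ (i + j) * D i j"
  let ?I = "{..n} \<times> {..Suc n}"
  have "(\<Sum>i\<le>n. \<Sum>j\<le>Suc n. (-1) ^ (i + j) * D i j) = sum ?T ?I"
    by (rule sum.cartesian_product)
  also have "?I = {(i, j) \<in> ?I. i < j} \<union> {(i, j) \<in> ?I. j \<le> i}"
    by auto
  also have "sum ?T \<dots> = sum ?T {(i, j) \<in> ?I. i < j} + sum ?T {(i, j) \<in> ?I. j \<le> i}"
    by (rule sum.union_disjoint) (auto intro: finite_subset[of _ ?I])
  also have "sum ?T {(i, j) \<in> ?I. i < j} = sum (\<lambda>x. - ?T x) {(i, j) \<in> ?I. j \<le> i}"
    by (rule sum.reindex_bij_witness[where i = "\<lambda>(i, j). (j, Suc i)" and j = "\<lambda>(i, j). (j - 1, i)"])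
      (auto simp: assms power_add neg_one_power_pred) 
  finally show ?thesis by (simp add: sum_negf)
qed

text \<open>Think of A i j as face i of prism j, and of B i j as prism j over face i. Away from the
  lines i = j and i = j + 1, the terms of A cancel those of B. On these two lines the signs are +
  and -, and \<open>diag\<close> makes them telescope, since neighbouring simplices share a wall;
  the bottom and the top of the prism remain.\<close>

lemma alternating_sum_prism:
  fixes A B :: "nat \<Rightarrow> nat \<Rightarrow> int"
  assumes low: "\<And>i j. i < j \<Longrightarrow> j \<le> n \<Longrightarrow> A i j = B i (j - 1)"
    and high: "\<And>i j. Suc j < i \<Longrightarrow> i \<le> Suc n \<Longrightarrow> A i j = B (i - 1) j"
    and diag: "\<And>i. i < n \<Longrightarrow> A (Suc i) (Suc i) = A (Suc i) i"
  shows "(\<Sum>i\<le>Suc n. \<Sum>j\<le>n. (-1) ^ (i + j) * A i j) + (\<Sum>i\<le>n. \<Sum>j<n. (-1) ^ (i + j) * B i j)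
    = A 0 0 - A (Suc n) n"
proof -
  let ?T = "\<lambda>(i, j). (-1) ^ (i + j) * A i j"
  let ?S = "\<lambda>(i, j). (-1) ^ (i + j) * B i j"
  let ?I = "{..Suc n} \<times> {..n}" and ?J = "{..n} \<times> {..<n}"
  have fin: "finite {(i, j) \<in> ?I. Q i j}" "finite {(i, j) \<in> ?J. Q i j}" for Q
    by (auto intro: finite_subset[of _ ?I] finite_subset[of _ ?J])
  have "?I = ({(i, j) \<in> ?I. i < j} \<union> {(i, j) \<in> ?I. Suc j < i}) \<union> ({(i, j) \<in> ?I. i = j} \<union> {(i, j) \<in> ?I. i = Suc j})"
    by auto
  then have "sum ?T ?I = sum ?T (({(i, j) \<in> ?I. i < j} \<union> {(i, j) \<in> ?I. Suc j < i}) \<union> ({(i, j) \<in> ?I. i = j} \<union> {(i, j) \<in> ?I. i = Suc j}))"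
    by (rule arg_cong)
  also have "\<dots> = (sum ?T {(i, j) \<in> ?I. i < j} + sum ?T {(i, j) \<in> ?I. Suc j < i})
      + (sum ?T {(i, j) \<in> ?I. i = j} + sum ?T {(i, j) \<in> ?I. i = Suc j})"
    using fin by (subst sum.union_disjoint; (simp; fail)?; (auto; fail)?)+ 
  also have "sum ?T {(i, j) \<in> ?I. i < j} = sum (\<lambda>x. - ?S x) {(i, j) \<in> ?J. i \<le> j}"
    by (rule sum.reindex_bij_witness[where i = "\<lambda>(i, j). (i, Suc j)" and j = "\<lambda>(i, j). (i, j - 1)"])
      (auto simp: low power_add neg_one_power_pred)
  also have "sum ?T {(i, j) \<in> ?I. Suc j < i} = sum (\<lambda>x. - ?S x) {(i, j) \<in> ?J. j < i}"
    by (rule sum.reindex_bij_witness[symmetric, where j = "\<lambda>(i, j). (Suc i, j)" and i = "\<lambda>(i, j). (i - 1, j)"])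
      (auto simp: high power_add)
  also have "sum ?T {(i, j) \<in> ?I. i = j} = (\<Sum>j\<le>n. A j j)"
    by (rule sum.reindex_bij_witness[where i = "\<lambda>j. (j, j)" and j = fst]) (auto simp: power_add simp flip: power_mult_distrib)
  also have "sum ?T {(i, j) \<in> ?I. i = Suc j} = (\<Sum>j\<le>n. - A (Suc j) j)"
    by (rule sum.reindex_bij_witness[where i = "\<lambda>j. (Suc j, j)" and j = snd]) (auto simp: power_add simp flip: power_mult_distrib)
  also have "sum (\<lambda>x. - ?S x) {(i, j) \<in> ?J. i \<le> j} + sum (\<lambda>x. - ?S x) {(i, j) \<in> ?J. j < i} = - sum ?S ?J"
  proof -
    have "?J = {(i, j) \<in> ?J. i \<le> j} \<union> {(i, j) \<in> ?J. j < i}" by auto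
    then have "sum ?S ?J = sum ?S ({(i, j) \<in> ?J. i \<le> j} \<union> {(i, j) \<in> ?J. j < i})" by (rule arg_cong)
    also have "\<dots> = sum ?S {(i, j) \<in> ?J. i \<le> j} + sum ?S {(i, j) \<in> ?J. j < i}"
      using fin by (intro sum.union_disjoint) auto
    finally show ?thesis by (simp add: sum_negf)
  qed
  also have "(\<Sum>j\<le>n. A j j) = A 0 0 + (\<Sum>j<n. A (Suc j) (Suc j))"
    by (rule sum.atMost_shift)
  also have "(\<Sum>j<n. A (Suc j) (Suc j)) = (\<Sum>j<n. A (Suc j) j)"
    using diag by simp
  also have "(\<Sum>j\<le>n. - A (Suc j) j) = - (\<Sum>j<n. A (Suc j) j) - A (Suc n) n"
    by (simp add: sum_negf flip: lessThan_Suc_atMost)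
  finally show ?thesis
    by (simp add: sum.cartesian_product)
qed

context Hausdorff_etale_groupoid
begin

text \<open>Iterated pushforwards become pushforwards along composed faces, and functions along
  equal composites coincide, so the simplicial identity feeds the cancellation of signed pairs. In
  degree 0 the boundary vanishes by definition.\<close>

lemma boundary_boundary:
  assumes f: "f \<in> compactly_supported (nerve_space G (Suc n))"
  shows "boundary G n (boundary G (Suc n) f) = (\<lambda>x. 0)"
proof (cases n)
  case 0
  then show ?thesis by (simp add: boundary_def)
next
  case (Suc m)
  have lh: "local_homeomorphism (nerve_space G (Suc n)) (nerve_space G m) (\<lambda>g. face_map G n i (face_map G (Suc n) j g))"
    if "i \<le> n" "j \<le> Suc n" for i j
  proof (rule local_homeomorphism_compose'[where f = "face_map G (Suc n) j" and g = "face_map G n i"])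
    show "local_homeomorphism (nerve_space G (Suc n)) (nerve_space G n) (face_map G (Suc n) j)"
      using local_homeomorphism_face_map[of "Suc n" j] that by simp
    show "local_homeomorphism (nerve_space G n) (nerve_space G m) (face_map G n i)"
      using local_homeomorphism_face_map[of n i] that Suc by simp
  qed
  define D where "D x i j = pushforward (nerve_space G (Suc n)) (\<lambda>g. face_map G n i (face_map G (Suc n) j g)) f x" for x i j
  show ?thesis
  proof
    fix x
    have "boundary G n (boundary G (Suc n) f) x = (\<Sum>i\<le>n. (-1) ^ i * pushforward (nerve_space G n) (face_map G n i) (boundary G (Suc n) f) x)"
      using Suc by (simp add: boundary_eq_sum)
    also have "\<dots> = (\<Sum>i\<le>n. \<Sum>j\<le>Suc n. (-1) ^ (i + j) * D x i j)"
    proof (rule sum.cong[OF refl])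
      fix i assume i: "i \<in> {..n}"
      have "pushforward (nerve_space G n) (face_map G n i) (boundary G (Suc n) f) x =
        (\<Sum>j\<in>{..Suc n}. (-1) ^ j * pushforward (nerve_space G n) (face_map G n i) (pushforward (nerve_space G (Suc n)) (face_map G (Suc n) j) f) x)"
        unfolding boundary_eq_sum_fun[OF zero_less_Suc]
        by (rule pushforward_sum[OF local_homeomorphism_face_map])
          (use i Suc pushforward_face_map_closed[OF f] in auto)
      also have "\<dots> = (\<Sum>j\<in>{..Suc n}. (-1) ^ j * D x i j)"
      proof (rule sum.cong[OF refl])
        fix j assume j: "j \<in> {..Suc n}"
        have "pushforward (nerve_space G n) (face_map G n i) (pushforward (nerve_space G (Suc n)) (face_map G (Suc n) j) f) =
          pushforward (nerve_space G (Suc n)) (\<lambda>g. face_map G n i (face_map G (Suc n) j g)) f"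
          by (rule pushforward_compose[where \<phi> = "face_map G n i" and \<psi> = "face_map G (Suc n) j" and Z = "nerve_space G m"])
            (use i j lh f face_map_nerve[of _ "Suc n" j] in auto)
        then show "(-1) ^ j * pushforward (nerve_space G n) (face_map G n i) (pushforward (nerve_space G (Suc n)) (face_map G (Suc n) j) f) x
          = (-1) ^ j * D x i j" by (simp add: D_def)
      qed
      finally show "(-1) ^ i * pushforward (nerve_space G n) (face_map G n i) (boundary G (Suc n) f) x = (\<Sum>j\<le>Suc n. (-1) ^ (i + j) * D x i j)"
        by (simp add: sum_distrib_left power_add mult.assoc del: sum.atMost_Suc)
    qed
    also have "\<dots> = 0"
    proof (rule alternating_sum_faces)
      fix i j :: nat assume ij: "i < j" "j \<le> Suc n"
      have "pushforward (nerve_space G (Suc n)) (\<lambda>g. face_map G n i (face_map G (Suc n) j g)) f =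
        pushforward (nerve_space G (Suc n)) (\<lambda>g. face_map G n (j - 1) (face_map G (Suc n) i g)) f"
        by (rule pushforward_cong) (use face_map_face_map[of _ m i j] ij Suc in simp)
      then show "D x i j = D x (j - 1) i" by (simp add: D_def)
    qed
    finally show "boundary G n (boundary G (Suc n) f) x = 0" .
  qed
qed

end


section \<open>Induced maps on homology\<close>

text \<open>The union over a class has the form of \<open>homology_map\<close>. All members of a
  coset of M are sent by \<phi> into one coset of N, so the union is a single coset. The last two
  hypotheses are injectivity and surjectivity up to N, which is the form in which a homotopy inverse
  provides them.\<close>

lemma FactGroup_iso_inducedI:
  assumes A: "comm_group A" and B: "comm_group B" and M: "subgroup M A" and N: "subgroup N B"
    and \<phi>: "\<phi> \<in> hom A B" "\<And>x. x \<in> M \<Longrightarrow> \<phi> x \<in> N"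
    and inj: "\<And>x. x \<in> carrier A \<Longrightarrow> \<phi> x \<in> N \<Longrightarrow> x \<in> M"
    and surj: "\<And>y. y \<in> carrier B \<Longrightarrow> \<exists>x\<in>carrier A. y \<in> N #>\<^bsub>B\<^esub> \<phi> x"
  shows "(\<lambda>c. \<Union>x\<in>c. N #>\<^bsub>B\<^esub> \<phi> x) \<in> iso (A Mod M) (B Mod N)"
proof -
  interpret A: comm_group A by fact
  interpret B: comm_group B by fact
  interpret M: normal M A by (rule A.subgroup_imp_normal[OF M])
  interpret N: normal N B by (rule B.subgroup_imp_normal[OF N])
  interpret \<phi>: group_hom A B \<phi>
    by (simp add: group_hom_def group_hom_axioms_def A.group_axioms B.group_axioms \<phi>(1))
  let ?F = "\<lambda>c. \<Union>x\<in>c. N #>\<^bsub>B\<^esub> \<phi> x"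
  have F: "?F (M #>\<^bsub>A\<^esub> x) = N #>\<^bsub>B\<^esub> \<phi> x" if x: "x \<in> carrier A" for x
  proof -
    have "N #>\<^bsub>B\<^esub> \<phi> y = N #>\<^bsub>B\<^esub> \<phi> x" if y: "y \<in> M #>\<^bsub>A\<^esub> x" for y
    proof -
      obtain m where m: "m \<in> M" "y = m \<otimes>\<^bsub>A\<^esub> x" using y by (auto simp: r_coset_def)
      have "\<phi> y = \<phi> m \<otimes>\<^bsub>B\<^esub> \<phi> x" using m x by simp
      then have "\<phi> y \<in> N #>\<^bsub>B\<^esub> \<phi> x" using \<phi>(2)[OF m(1)] by (auto simp: r_coset_def)
      then show ?thesis using B.repr_independence[OF _ _ N] x by simp
    qed
    moreover have "x \<in> M #>\<^bsub>A\<^esub> x" by (rule A.rcos_self[OF x M])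
    ultimately show ?thesis by blast
  qed
  have cA: "carrier (A Mod M) = (\<lambda>x. M #>\<^bsub>A\<^esub> x) ` carrier A"
    by (auto simp: FactGroup_def RCOSETS_def)
  have cB: "carrier (B Mod N) = (\<lambda>x. N #>\<^bsub>B\<^esub> x) ` carrier B"
    by (auto simp: FactGroup_def RCOSETS_def)
  have mem: "y \<in> N" if "N #>\<^bsub>B\<^esub> y = N" "y \<in> carrier B" for y
    by (rule B.coset_join1[OF that N])
  show ?thesis
    unfolding iso_iff
  proof (intro conjI)
    show "?F \<in> hom (A Mod M) (B Mod N)"
    proof (rule homI)
      show "?F c \<in> carrier (B Mod N)" if "c \<in> carrier (A Mod M)" for c
        using that F unfolding cA cB by auto
      fix c d assume "c \<in> carrier (A Mod M)" "d \<in> carrier (A Mod M)"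
      then obtain x y where xy: "x \<in> carrier A" "y \<in> carrier A" "c = M #>\<^bsub>A\<^esub> x" "d = M #>\<^bsub>A\<^esub> y"
        unfolding cA by auto
      then show "?F (c \<otimes>\<^bsub>A Mod M\<^esub> d) = ?F c \<otimes>\<^bsub>B Mod N\<^esub> ?F d"
        by (simp only: mult_FactGroup M.rcos_sum N.rcos_sum F A.m_closed \<phi>.hom_mult \<phi>.hom_closed)
    qed
    show "?F ` carrier (A Mod M) = carrier (B Mod N)"
    proof
      show "?F ` carrier (A Mod M) \<subseteq> carrier (B Mod N)"
        using F unfolding cA cB by auto
      show "carrier (B Mod N) \<subseteq> ?F ` carrier (A Mod M)"
      proof
        fix d assume "d \<in> carrier (B Mod N)"
        then obtain y where y: "y \<in> carrier B" "d = N #>\<^bsub>B\<^esub> y" unfolding cB by auto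
        obtain x where x: "x \<in> carrier A" "y \<in> N #>\<^bsub>B\<^esub> \<phi> x" using surj[OF y(1)] by auto
        have "d = N #>\<^bsub>B\<^esub> \<phi> x"
          unfolding y(2) by (rule B.repr_independence[OF x(2) _ N, symmetric]) (use x(1) in simp)
        then have "d = ?F (M #>\<^bsub>A\<^esub> x)" using F[OF x(1)] by simp
        then show "d \<in> ?F ` carrier (A Mod M)" unfolding cA using x(1) by blast
      qed
    qed
    show "inj_on ?F (carrier (A Mod M))"
    proof (rule inj_onI)
      fix c d assume "c \<in> carrier (A Mod M)" "d \<in> carrier (A Mod M)" and eq: "?F c = ?F d"
      then obtain x y where xy: "x \<in> carrier A" "y \<in> carrier A" "c = M #>\<^bsub>A\<^esub> x" "d = M #>\<^bsub>A\<^esub> y"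
        unfolding cA by auto
      have "N #>\<^bsub>B\<^esub> \<phi> x = N #>\<^bsub>B\<^esub> \<phi> y" using eq F xy by simp
      then have "\<phi> y \<in> N #>\<^bsub>B\<^esub> \<phi> x"
        using B.rcos_self[OF _ N, of "\<phi> y"] xy(2) by simp
      then obtain n where n: "n \<in> N" "\<phi> y = n \<otimes>\<^bsub>B\<^esub> \<phi> x" by (auto simp: r_coset_def)
      have "\<phi> (y \<otimes>\<^bsub>A\<^esub> inv\<^bsub>A\<^esub> x) = n"
        using n xy(1,2) N.subset by (simp add: B.m_assoc subset_iff)
      then have "y \<otimes>\<^bsub>A\<^esub> inv\<^bsub>A\<^esub> x \<in> M" using inj[of "y \<otimes>\<^bsub>A\<^esub> inv\<^bsub>A\<^esub> x"] n(1) xy by simp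
      then have "(y \<otimes>\<^bsub>A\<^esub> inv\<^bsub>A\<^esub> x) \<otimes>\<^bsub>A\<^esub> x \<in> M #>\<^bsub>A\<^esub> x" by (auto simp: r_coset_def)
      then have "y \<in> M #>\<^bsub>A\<^esub> x" using xy by (simp add: A.m_assoc)
      from A.repr_independence[OF this xy(1) M] show "c = d" using xy by simp
    qed
  qed
qed

section \<open>Cycles, boundaries and homology as abelian groups\<close>

lemma cycle_group_simps [simp]:
  "carrier (cycle_group G n) = {f \<in> compactly_supported (nerve_space G n). boundary G n f = (\<lambda>x. 0)}"
  "f \<otimes>\<^bsub>cycle_group G n\<^esub> f' = (\<lambda>x. f x + f' x)"
  "\<one>\<^bsub>cycle_group G n\<^esub> = (\<lambda>x. 0)"
  by (simp_all add: cycle_group_def chain_group_def)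

context Hausdorff_etale_groupoid
begin

lemma boundary_add:
  assumes "f \<in> compactly_supported (nerve_space G n)" "g \<in> compactly_supported (nerve_space G n)"
  shows "boundary G n (\<lambda>x. f x + g x) = (\<lambda>x. boundary G n f x + boundary G n g x)"
  using boundary_linear[OF assms, of 1 1] by auto

lemma boundary_uminus:
  assumes "f \<in> compactly_supported (nerve_space G n)"
  shows "boundary G n (\<lambda>x. - f x) = (\<lambda>x. - boundary G n f x)"
  using boundary_linear[OF assms assms, of "-1" 0] by auto

lemma boundary_zero: "boundary G n (\<lambda>x. 0) = (\<lambda>x. 0)"
  using boundary_linear[OF zero_compactly_supported zero_compactly_supported, of n 0 0] by auto

lemma comm_group_cycle_group: "comm_group (cycle_group G n)"
proof (rule comm_groupI)
  fix f assume f: "f \<in> carrier (cycle_group G n)"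
  then show "\<exists>g\<in>carrier (cycle_group G n). g \<otimes>\<^bsub>cycle_group G n\<^esub> f = \<one>\<^bsub>cycle_group G n\<^esub>"
    by (intro bexI[of _ "\<lambda>x. - f x"]) (auto simp: boundary_uminus uminus_compactly_supported)
qed (auto simp: boundary_add add_compactly_supported zero_compactly_supported boundary_zero add.assoc add.commute)

lemma inv_cycle_group:
  assumes "f \<in> carrier (cycle_group G n)"
  shows "inv\<^bsub>cycle_group G n\<^esub> f = (\<lambda>x. - f x)"
proof -
  interpret comm_group "cycle_group G n" by (rule comm_group_cycle_group)
  show ?thesis
    by (rule inv_equality) (use assms in \<open>auto simp: boundary_uminus uminus_compactly_supported\<close>)
qed

lemma subgroup_boundaries: "subgroup (boundaries G n) (cycle_group G n)"
proof -
  interpret comm_group "cycle_group G n" by (rule comm_group_cycle_group)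
  show ?thesis
  proof (rule subgroupI)
    show sub: "boundaries G n \<subseteq> carrier (cycle_group G n)"
      using boundary_boundary boundary_closed[of _ "Suc n"] by (auto simp: boundaries_def)
    show "boundaries G n \<noteq> {}"
      using zero_compactly_supported by (auto simp: boundaries_def)
    fix f assume f: "f \<in> boundaries G n"
    then obtain k where k: "k \<in> compactly_supported (nerve_space G (Suc n))" "f = boundary G (Suc n) k"
      by (auto simp: boundaries_def)
    have "inv\<^bsub>cycle_group G n\<^esub> f = boundary G (Suc n) (\<lambda>x. - k x)"
      using inv_cycle_group[of f n] sub f k boundary_uminus by auto
    then show "inv\<^bsub>cycle_group G n\<^esub> f \<in> boundaries G n"
      using uminus_compactly_supported[OF k(1)] by (auto simp: boundaries_def)
    fix g assume "g \<in> boundaries G n"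
    then obtain l where l: "l \<in> compactly_supported (nerve_space G (Suc n))" "g = boundary G (Suc n) l"
      by (auto simp: boundaries_def)
    have "f \<otimes>\<^bsub>cycle_group G n\<^esub> g = boundary G (Suc n) (\<lambda>x. k x + l x)"
      using k l boundary_add by simp
    then show "f \<otimes>\<^bsub>cycle_group G n\<^esub> g \<in> boundaries G n"
      using add_compactly_supported[OF k(1) l(1)] by (auto simp: boundaries_def)
  qed
qed

lemma group_homology_group: "group (homology_group G n)"
  unfolding homology_group_def
  by (intro normal.factorgroup_is_group comm_group.subgroup_imp_normal comm_group_cycle_group subgroup_boundaries)

end

section \<open>The chain map of an etale homomorphism\<close>

lemma groupoid_hom_unit:
  "groupoid_hom G H \<phi> \<Longrightarrow> u \<in> units G \<Longrightarrow> \<phi> u \<in> units H"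
  by (auto simp: groupoid_hom_def units_def)

lemma local_homeomorphism_units:
  assumes "etale_hom G H \<phi>" "Hausdorff_etale_groupoid G"
  shows "local_homeomorphism (unit_space G) (unit_space H) \<phi>"
proof -
  interpret Hausdorff_etale_groupoid G by fact
  have "local_homeomorphism (unit_space G) (gtop H) \<phi>"
    using assms(1) local_homeomorphism_from_open_subtopology[OF _ open_units]
    by (auto simp: etale_hom_def unit_space_def)
  then show ?thesis
    unfolding unit_space_def[of H]
    by (rule local_homeomorphism_into_subtopology)
      (use assms(1) groupoid_hom_unit in \<open>auto simp: etale_hom_def\<close>)
qed

lemma nerve_map_tuple_of: "nerve_map n \<phi> (tuple_of n c) = tuple_of n (\<lambda>a b. \<phi> (c a b))"
  by (auto simp: nerve_map_def tuple_of_def)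

locale groupoid_pair = G: Hausdorff_etale_groupoid G + H: Hausdorff_etale_groupoid H
  for G :: "'a groupoid" and H :: "'b groupoid"
begin

lemma nerve_map_eq:
  "g \<in> nerve G n \<Longrightarrow> nerve_map n \<phi> g = tuple_of n (\<lambda>a b. \<phi> (edge G g a b))"
  by (metis G.tuple_of_edge nerve_map_tuple_of)

lemma diagram_hom_edge:
  "groupoid_hom G H \<phi> \<Longrightarrow> g \<in> nerve G n \<Longrightarrow> diagram H n (\<lambda>a b. \<phi> (edge G g a b))"
  by (rule diagram_hom[OF G.diagram_edge])

lemma local_homeomorphism_nerve_map:
  assumes "etale_hom G H \<phi>"
  shows "local_homeomorphism (nerve_space G n) (nerve_space H n) (nerve_map n \<phi>)"
proof -
  have h: "groupoid_hom G H \<phi>" "continuous_map (gtop G) (gtop H) \<phi>"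
    using assms by (auto simp: etale_hom_def local_homeomorphism_iff)
  have "local_homeomorphism (nerve_space G n) (nerve_space H n) (\<lambda>g. tuple_of n (\<lambda>a b. \<phi> (edge G g a b)))"
  proof (rule H.local_homeomorphism_tuple_of)
    show "continuous_map (nerve_space G n) (gtop H) (\<lambda>g. \<phi> (edge G g a b))" if "a \<le> n" "b \<le> n" for a b
      using continuous_map_compose[OF G.continuous_map_edge[OF that] h(2)] by (simp add: o_def)
    show "diagram H n (\<lambda>a b. \<phi> (edge G g a b))" if "g \<in> topspace (nerve_space G n)" for g
      using that diagram_hom_edge[OF h(1)] by simp
    show "local_homeomorphism (nerve_space G n) (unit_space H) (\<lambda>g. \<phi> (edge G g 0 0))"
      by (rule local_homeomorphism_compose'[OF G.local_homeomorphism_vertex local_homeomorphism_units[OF assms G.Hausdorff_etale_groupoid_axioms]])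
        simp
  qed simp
  then show ?thesis
    by (rule local_homeomorphism_eq) (simp add: nerve_map_eq)
qed

lemma nerve_map_nerve:
  assumes "etale_hom G H \<phi>" "g \<in> nerve G n"
  shows "nerve_map n \<phi> g \<in> nerve H n"
  using local_homeomorphism_apply[OF local_homeomorphism_nerve_map[OF assms(1)], of g n] assms(2) by simp

lemma nerve_map_face_map:
  assumes \<phi>: "etale_hom G H \<phi>" and g: "g \<in> nerve G n" and n: "0 < n" "i \<le> n"
  shows "nerve_map (n - 1) \<phi> (face_map G n i g) = face_map H n i (nerve_map n \<phi> g)"
proof -
  have h: "groupoid_hom G H \<phi>" using \<phi> by (simp add: etale_hom_def)
  have s: "skip i a \<le> n" if "a \<le> n - 1" for a using that n by (auto simp: skip_def)
  have "face_map H n i (nerve_map n \<phi> g) = tuple_of (n - 1) (\<lambda>a b. edge H (nerve_map n \<phi> g) (skip i a) (skip i b))"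
    by (rule H.face_map_eq[OF nerve_map_nerve[OF \<phi> g] n])
  also have "\<dots> = tuple_of (n - 1) (\<lambda>a b. \<phi> (edge G g (skip i a) (skip i b)))"
    by (rule tuple_of_cong) (use s H.edge_tuple_of[OF diagram_hom_edge[OF h g]] in \<open>simp add: nerve_map_eq[OF g]\<close>)
  also have "\<dots> = nerve_map (n - 1) \<phi> (face_map G n i g)"
    by (simp add: G.face_map_eq[OF g n] nerve_map_tuple_of)
  finally show ?thesis by simp
qed

lemma pushforward_nerve_map_closed:
  assumes "etale_hom G H \<phi>" "f \<in> compactly_supported (nerve_space G n)"
  shows "pushforward (nerve_space G n) (nerve_map n \<phi>) f \<in> compactly_supported (nerve_space H n)"
  by (rule pushforward_compactly_supported[OF local_homeomorphism_nerve_map[OF assms(1)] G.Hausdorff_nerve_space H.Hausdorff_nerve_space assms(2)])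

lemma boundary_pushforward:
  assumes \<phi>: "etale_hom G H \<phi>" and f: "f \<in> compactly_supported (nerve_space G n)" and n: "0 < n"
  shows "boundary H n (pushforward (nerve_space G n) (nerve_map n \<phi>) f) =
    pushforward (nerve_space G (n - 1)) (nerve_map (n - 1) \<phi>) (boundary G n f)"
proof
  fix x
  let ?P = "\<lambda>m. pushforward (nerve_space G m) (nerve_map m \<phi>)"
  have "?P (n - 1) (boundary G n f) x =
    (\<Sum>i\<in>{..n}. (-1) ^ i * ?P (n - 1) (pushforward (nerve_space G n) (face_map G n i) f) x)"
    unfolding G.boundary_eq_sum_fun[OF n]
    by (rule pushforward_sum[OF local_homeomorphism_nerve_map[OF \<phi>]])
      (use f n G.pushforward_face_map_closed in auto)
  also have "\<dots> = (\<Sum>i\<in>{..n}. (-1) ^ i * pushforward (nerve_space H n) (face_map H n i) (?P n f) x)"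
  proof (rule sum.cong[OF refl])
    fix i assume "i \<in> {..n}"
    then have i: "i \<le> n" by simp
    have "?P (n - 1) (pushforward (nerve_space G n) (face_map G n i) f) =
      pushforward (nerve_space G n) (\<lambda>g. nerve_map (n - 1) \<phi> (face_map G n i g)) f"
      by (rule pushforward_compose[where \<phi> = "nerve_map (n - 1) \<phi>" and \<psi> = "face_map G n i" and Z = "nerve_space H (n - 1)"])
        (use G.face_map_nerve[OF _ n i] f local_homeomorphism_compose'[OF G.local_homeomorphism_face_map[OF n i] local_homeomorphism_nerve_map[OF \<phi>]] in auto)
    also have "\<dots> = pushforward (nerve_space G n) (\<lambda>g. face_map H n i (nerve_map n \<phi> g)) f"
      by (rule pushforward_cong) (use nerve_map_face_map[OF \<phi> _ n i] in auto)
    also have "\<dots> = pushforward (nerve_space H n) (face_map H n i) (?P n f)"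
      by (rule pushforward_compose[symmetric, where \<psi> = "nerve_map n \<phi>" and \<phi> = "face_map H n i" and Z = "nerve_space H (n - 1)"])
        (use nerve_map_nerve[OF \<phi>] f local_homeomorphism_compose'[OF local_homeomorphism_nerve_map[OF \<phi>] H.local_homeomorphism_face_map[OF n i]] in auto)
    finally show "(-1) ^ i * ?P (n - 1) (pushforward (nerve_space G n) (face_map G n i) f) x =
      (-1) ^ i * pushforward (nerve_space H n) (face_map H n i) (?P n f) x" by simp
  qed
  also have "\<dots> = boundary H n (?P n f) x"
    by (simp add: boundary_eq_sum[OF n])
  finally show "boundary H n (?P n f) x = ?P (n - 1) (boundary G n f) x" by simp
qed

lemma pushforward_cycle:
  assumes "etale_hom G H \<phi>" "f \<in> carrier (cycle_group G n)"
  shows "pushforward (nerve_space G n) (nerve_map n \<phi>) f \<in> carrier (cycle_group H n)"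
proof (cases "n = 0")
  case True
  then show ?thesis using pushforward_nerve_map_closed[OF assms(1), of f n] assms(2) by (simp add: boundary_def)
next
  case False
  then show ?thesis using pushforward_nerve_map_closed[OF assms(1), of f n] boundary_pushforward[OF assms(1), of f n] assms(2)
    by (simp add: pushforward_zero)
qed

lemma pushforward_boundaries:
  assumes "etale_hom G H \<phi>" "f \<in> boundaries G n"
  shows "pushforward (nerve_space G n) (nerve_map n \<phi>) f \<in> boundaries H n"
proof -
  obtain k where k: "k \<in> compactly_supported (nerve_space G (Suc n))" "f = boundary G (Suc n) k"
    using assms(2) by (auto simp: boundaries_def)
  have "pushforward (nerve_space G n) (nerve_map n \<phi>) f =
      boundary H (Suc n) (pushforward (nerve_space G (Suc n)) (nerve_map (Suc n) \<phi>) k)"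
    using boundary_pushforward[OF assms(1) k(1)] k(2) by simp
  then show ?thesis
    using pushforward_nerve_map_closed[OF assms(1) k(1)] by (auto simp: boundaries_def)
qed

end


section \<open>Homotopy invariance\<close>

text \<open>
  The index map of the \<open>j\<close>-th simplex \<open>{0..n+1} \<rightarrow> {0..n} \<times> {0,1}\<close> in the standard triangulation of
  the prism; the flag is set on the part of the simplex that lies on the \<open>\<sigma>\<close>-side.
\<close>

definition prism_index :: "nat \<Rightarrow> nat \<Rightarrow> nat \<times> bool" where
  "prism_index j a = (if a \<le> j then (a, True) else (a - 1, False))"

text \<open>For a unit u, \<theta> u is an arrow from \<rho> u to \<sigma> u, and
  \<open>intertwine\<close> is naturality. The two conditions on sources and ranges say that both
  products in it are defined.\<close>

locale similar_pair = groupoid_pair G H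
  for G :: "'a groupoid" and H :: "'b groupoid" +
  fixes \<rho> \<sigma> \<theta> :: "'a \<Rightarrow> 'b"
  assumes etale_\<rho>: "etale_hom G H \<rho>" and etale_\<sigma>: "etale_hom G H \<sigma>"
    and continuous_\<theta>: "continuous_map (unit_space G) (gtop H) \<theta>"
    and src_\<theta>: "g \<in> arrows G \<Longrightarrow> src H (\<theta> (rng G g)) = rng H (\<rho> g)"
    and rng_\<theta>: "g \<in> arrows G \<Longrightarrow> src H (\<sigma> g) = rng H (\<theta> (src G g))"
    and intertwine: "g \<in> arrows G \<Longrightarrow> gmul H (\<theta> (rng G g)) (\<rho> g) = gmul H (\<sigma> g) (\<theta> (src G g))"
begin

lemma hom_\<rho>: "groupoid_hom G H \<rho>" and hom_\<sigma>: "groupoid_hom G H \<sigma>"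
  using etale_\<rho> etale_\<sigma> by (auto simp: etale_hom_def)

lemma \<theta>_unit:
  assumes "u \<in> units G"
  shows "\<theta> u \<in> arrows H" "src H (\<theta> u) = \<rho> u"
proof -
  show "\<theta> u \<in> arrows H"
    using continuous_map_image_subset_topspace[OF continuous_\<theta>] assms by auto
  show "src H (\<theta> u) = \<rho> u"
    using src_\<theta>[of u] G.unitsD[OF assms] H.unitsD[OF groupoid_hom_unit[OF hom_\<rho> assms]] by simp
qed

text \<open>The arrow that carries a vertex of the \<rho>-diagram to the prism vertex x: a component
  of \<theta> on the \<sigma>-side, and a unit on the \<rho>-side.\<close>

definition prism_object :: "(nat \<Rightarrow> 'a) \<Rightarrow> nat \<times> bool \<Rightarrow> 'b" where
  "prism_object g x = (if snd x then \<theta> (edge G g (fst x) (fst x)) else \<rho> (edge G g (fst x) (fst x)))"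

text \<open>As x and y vary this is a functor from the indiscrete groupoid on {0..n} x {0,1}, namely
  the \<rho>-diagram conjugated by the arrows \<open>prism_object\<close>. All simplices of the
  prism are reindexings of it.\<close>

definition prism :: "(nat \<Rightarrow> 'a) \<Rightarrow> nat \<times> bool \<Rightarrow> nat \<times> bool \<Rightarrow> 'b" where
  "prism g x y = gmul H (gmul H (prism_object g x) (\<rho> (edge G g (fst x) (fst y)))) (ginv H (prism_object g y))"

definition prism_map :: "nat \<Rightarrow> nat \<Rightarrow> (nat \<Rightarrow> 'a) \<Rightarrow> (nat \<Rightarrow> 'b)" where
  "prism_map n j g = tuple_of (Suc n) (\<lambda>a b. prism g (prism_index j a) (prism_index j b))"

lemma prism_object_props:
  assumes "g \<in> nerve G n" "fst x \<le> n"
  shows "prism_object g x \<in> arrows H" "src H (prism_object g x) = \<rho> (edge G g (fst x) (fst x))"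
proof -
  have u: "edge G g (fst x) (fst x) \<in> units G"
    using diagramD[OF G.diagram_edge[OF assms(1)]] assms(2) by blast
  note ru = groupoid_hom_unit[OF hom_\<rho> u]
  show "prism_object g x \<in> arrows H" "src H (prism_object g x) = \<rho> (edge G g (fst x) (fst x))"
    using \<theta>_unit[OF u] H.unitsD[OF ru] by (auto simp: prism_object_def)
qed

lemma diagram_prism:
  assumes g: "g \<in> nerve G n" and \<alpha>: "\<And>a. a \<le> m \<Longrightarrow> fst (\<alpha> a) \<le> n"
  shows "diagram H m (\<lambda>a b. prism g (\<alpha> a) (\<alpha> b))"
  unfolding prism_def
proof (rule H.diagram_conjugate)
  show "diagram H m (\<lambda>a b. \<rho> (edge G g (fst (\<alpha> a)) (fst (\<alpha> b))))"
    by (rule diagram_reindex[OF diagram_hom_edge[OF hom_\<rho> g]]) (rule \<alpha>)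
  show "prism_object g (\<alpha> i) \<in> arrows H \<and>
      src H (prism_object g (\<alpha> i)) = \<rho> (edge G g (fst (\<alpha> i)) (fst (\<alpha> i)))" if "i \<le> m" for i
    using prism_object_props[OF g \<alpha>[OF that]] by simp
qed

lemma prism_\<rho>:
  assumes g: "g \<in> nerve G n" and ab: "a \<le> n" "b \<le> n"
  shows "prism g (a, False) (b, False) = \<rho> (edge G g a b)"
proof -
  have d: "diagram H n (\<lambda>a b. \<rho> (edge G g a b))" by (rule diagram_hom_edge[OF hom_\<rho> g])
  show ?thesis
    using diagramD[OF d ab] diagramD[OF d ab(2) ab(2)] diagramD[OF d ab(1) ab(1)]
    by (simp add: prism_def prism_object_def)
qed

text \<open>By naturality, \<theta> followed into \<rho>(e) equals \<sigma>(e) times the component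
  of \<theta> at the source, and that component is then cancelled by the trailing inverse.\<close>

lemma prism_\<sigma>:
  assumes g: "g \<in> nerve G n" and ab: "a \<le> n" "b \<le> n"
  shows "prism g (a, True) (b, True) = \<sigma> (edge G g a b)"
proof -
  have d: "diagram G n (edge G g)" by (rule G.diagram_edge[OF g])
  note e = diagramD[OF d ab] 
  have u: "edge G g b b \<in> units G" using diagramD[OF d ab(2) ab(2)] by simp
  have \<sigma>: "\<sigma> (edge G g a b) \<in> arrows H" "src H (\<sigma> (edge G g a b)) = rng H (\<theta> (edge G g b b))"
    using hom_\<sigma> e rng_\<theta>[of "edge G g a b"] by (auto simp: groupoid_hom_def)
  have "gmul H (\<theta> (edge G g a a)) (\<rho> (edge G g a b)) = gmul H (\<sigma> (edge G g a b)) (\<theta> (edge G g b b))"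
    using intertwine[of "edge G g a b"] e by simp
  then show ?thesis
    using \<sigma> \<theta>_unit[OF u] H.src_gmul_right[OF \<sigma>(1)] by (simp add: prism_def prism_object_def)
qed

lemma continuous_map_prism:
  assumes "fst x \<le> n" "fst y \<le> n"
  shows "continuous_map (nerve_space G n) (gtop H) (\<lambda>g. prism g x y)"
proof -
  have \<rho>: "continuous_map (gtop G) (gtop H) \<rho>"
    using etale_\<rho> by (auto simp: etale_hom_def local_homeomorphism_iff)
  have e: "continuous_map (nerve_space G n) (gtop H) (\<lambda>g. \<rho> (edge G g a b))" if "a \<le> n" "b \<le> n" for a b
    using continuous_map_compose[OF G.continuous_map_edge[OF that] \<rho>] by (simp add: o_def)
  have o: "continuous_map (nerve_space G n) (gtop H) (\<lambda>g. prism_object g z)" if z: "fst z \<le> n" for z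
  proof -
    have "continuous_map (nerve_space G n) (gtop H) (\<lambda>g. \<theta> (edge G g (fst z) (fst z)))"
      using continuous_map_compose[OF local_homeomorphism_imp_continuous_map[OF G.local_homeomorphism_vertex[OF z]] continuous_\<theta>]
      by (simp add: o_def)
    then show ?thesis using e[OF z z] by (cases "snd z") (simp_all add: prism_object_def)
  qed
  have d: "diagram H n (\<lambda>a b. \<rho> (edge G g a b))" if "g \<in> nerve G n" for g
    by (rule diagram_hom_edge[OF hom_\<rho> that])
  show ?thesis
    unfolding prism_def
  proof (intro H.continuous_map_gmul H.continuous_map_ginv o e assms)
    fix g assume "g \<in> topspace (nerve_space G n)"
    then have g: "g \<in> nerve G n" by simp
    show "src H (prism_object g x) = rng H (\<rho> (edge G g (fst x) (fst y)))"
      using prism_object_props[OF g assms(1)] diagramD[OF d[OF g] assms] by simp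
    then show "src H (gmul H (prism_object g x) (\<rho> (edge G g (fst x) (fst y)))) = rng H (ginv H (prism_object g y))"
      using prism_object_props[OF g assms(1)] prism_object_props[OF g assms(2)] diagramD[OF d[OF g] assms] by simp
  qed
qed

lemma fst_prism_index: "j \<le> n \<Longrightarrow> a \<le> Suc n \<Longrightarrow> fst (prism_index j a) \<le> n"
  by (auto simp: prism_index_def)

lemma diagram_prism_index:
  "g \<in> nerve G n \<Longrightarrow> j \<le> n \<Longrightarrow> diagram H (Suc n) (\<lambda>a b. prism g (prism_index j a) (prism_index j b))"
  by (rule diagram_prism) (auto intro: fst_prism_index)

lemma local_homeomorphism_prism_map:
  assumes "j \<le> n"
  shows "local_homeomorphism (nerve_space G n) (nerve_space H (Suc n)) (prism_map n j)"
  unfolding prism_map_def[abs_def]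
proof (rule H.local_homeomorphism_tuple_of)
  show "continuous_map (nerve_space G n) (gtop H) (\<lambda>g. prism g (prism_index j a) (prism_index j b))"
    if "a \<le> Suc n" "b \<le> Suc n" for a b
    using that assms by (intro continuous_map_prism fst_prism_index)
  show "diagram H (Suc n) (\<lambda>a b. prism g (prism_index j a) (prism_index j b))"
    if "g \<in> topspace (nerve_space G n)" for g
    using that assms diagram_prism_index by simp
  have "local_homeomorphism (nerve_space G n) (unit_space H) (\<lambda>g. \<rho> (edge G g n n))"
    by (rule local_homeomorphism_compose'[OF G.local_homeomorphism_vertex local_homeomorphism_units[OF etale_\<rho> G.Hausdorff_etale_groupoid_axioms]])
      simp
  then show "local_homeomorphism (nerve_space G n) (unit_space H)
      (\<lambda>g. prism g (prism_index j (Suc n)) (prism_index j (Suc n)))"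
    by (rule local_homeomorphism_eq) (use assms prism_\<rho> in \<open>simp add: prism_index_def\<close>)
qed simp

text \<open>With \<open>prism_map_face_map\<close> this writes faces of prisms and prisms over faces
  as reindexings of the same functor, so that they can be compared by their index maps.\<close>

lemma face_map_prism_map:
  assumes g: "g \<in> nerve G n" and "j \<le> n" "i \<le> Suc n"
  shows "face_map H (Suc n) i (prism_map n j g) =
    tuple_of n (\<lambda>a b. prism g (prism_index j (skip i a)) (prism_index j (skip i b)))"
proof -
  have s: "skip i a \<le> Suc n" if "a \<le> n" for a using that by (auto simp: skip_def)
  have d: "diagram H (Suc n) (\<lambda>a b. prism g (prism_index j a) (prism_index j b))"
    by (rule diagram_prism_index[OF g assms(2)])
  have "face_map H (Suc n) i (prism_map n j g) = tuple_of n (\<lambda>a b. edge H (prism_map n j g) (skip i a) (skip i b))"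
    using H.face_map_eq[OF H.tuple_of_nerve[OF d], of i] assms by (simp add: prism_map_def)
  also have "\<dots> = tuple_of n (\<lambda>a b. prism g (prism_index j (skip i a)) (prism_index j (skip i b)))"
    unfolding prism_map_def by (rule tuple_of_cong) (rule H.edge_tuple_of[OF d s s])
  finally show ?thesis .
qed

lemma prism_map_face_map:
  assumes g: "g \<in> nerve G n" and n: "0 < n" "j < n" "i \<le> n"
  shows "prism_map (n - 1) j (face_map G n i g) =
    tuple_of n (\<lambda>a b. prism g (map_prod (skip i) id (prism_index j a)) (map_prod (skip i) id (prism_index j b)))"
proof -
  have p: "prism (face_map G n i g) x y = prism g (map_prod (skip i) id x) (map_prod (skip i) id y)"
    if "fst x \<le> n - 1" "fst y \<le> n - 1" for x y
    using that n by (simp add: prism_def prism_object_def G.edge_face_map[OF g])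
  show ?thesis
    unfolding prism_map_def using n
    by (auto intro!: tuple_of_cong p fst_prism_index)
qed

text \<open>The alternating sum k of the pushforwards along the prisms is the value at f of a chain
  homotopy. For a cycle, the term of the homotopy formula that involves the boundary of f vanishes,
  and the boundary of k is the difference of the two pushforwards.\<close>

lemma prism_homotopy:
  assumes f: "f \<in> carrier (cycle_group G n)"
  shows "(\<lambda>x. pushforward (nerve_space G n) (nerve_map n \<rho>) f x - pushforward (nerve_space G n) (nerve_map n \<sigma>) f x)
    \<in> boundaries H n"
proof -
  have fC: "f \<in> compactly_supported (nerve_space G n)" and f0: "boundary G n f = (\<lambda>x. 0)"
    using f by auto
  define k where "k = (\<lambda>x. \<Sum>j\<in>{..n}. (-1) ^ j * pushforward (nerve_space G n) (prism_map n j) f x)"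
  have hC: "pushforward (nerve_space G n) (prism_map n j) f \<in> compactly_supported (nerve_space H (Suc n))"
    if "j \<le> n" for j
    by (rule pushforward_compactly_supported[OF local_homeomorphism_prism_map[OF that] G.Hausdorff_nerve_space H.Hausdorff_nerve_space fC])
  have kC: "k \<in> compactly_supported (nerve_space H (Suc n))"
    unfolding k_def by (rule sum_compactly_supported) (use hC in auto)
  define A where "A x i j = pushforward (nerve_space G n) (\<lambda>g. face_map H (Suc n) i (prism_map n j g)) f x" for x i j
  define B where "B x i j = pushforward (nerve_space G n) (\<lambda>g. prism_map (n - 1) j (face_map G n i g)) f x" for x i j
  have "boundary H (Suc n) k x = pushforward (nerve_space G n) (nerve_map n \<rho>) f x - pushforward (nerve_space G n) (nerve_map n \<sigma>) f x"
    for x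
  proof -
    have "boundary H (Suc n) k x = (\<Sum>i\<le>Suc n. (-1) ^ i * pushforward (nerve_space H (Suc n)) (face_map H (Suc n) i) k x)"
      by (simp only: boundary_eq_sum[OF zero_less_Suc])
    also have "\<dots> = (\<Sum>i\<le>Suc n. \<Sum>j\<le>n. (-1) ^ (i + j) * A x i j)"
    proof (rule sum.cong[OF refl])
      fix i assume "i \<in> {..Suc n}"
      then have i: "i \<le> Suc n" by simp
      have lh: "local_homeomorphism (nerve_space H (Suc n)) (nerve_space H n) (face_map H (Suc n) i)"
        using H.local_homeomorphism_face_map[OF _ i] by simp
      have "pushforward (nerve_space H (Suc n)) (face_map H (Suc n) i) k x =
        (\<Sum>j\<in>{..n}. (-1) ^ j * pushforward (nerve_space H (Suc n)) (face_map H (Suc n) i)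
           (pushforward (nerve_space G n) (prism_map n j) f) x)"
        unfolding k_def by (rule pushforward_sum[OF lh]) (use hC in auto)
      also have "\<dots> = (\<Sum>j\<in>{..n}. (-1) ^ j * A x i j)"
      proof (rule sum.cong[OF refl])
        fix j assume "j \<in> {..n}"
        then have j: "j \<le> n" by simp
        have "pushforward (nerve_space H (Suc n)) (face_map H (Suc n) i) (pushforward (nerve_space G n) (prism_map n j) f) =
          pushforward (nerve_space G n) (\<lambda>g. face_map H (Suc n) i (prism_map n j g)) f"
          by (rule pushforward_compose[where \<phi> = "face_map H (Suc n) i" and \<psi> = "prism_map n j",
                OF local_homeomorphism_apply[OF local_homeomorphism_prism_map[OF j]]
                   local_homeomorphism_compose'[OF local_homeomorphism_prism_map[OF j] lh] fC])
        then show "(-1) ^ j * pushforward (nerve_space H (Suc n)) (face_map H (Suc n) i)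
           (pushforward (nerve_space G n) (prism_map n j) f) x = (-1) ^ j * A x i j"
          by (simp add: A_def)
      qed
      finally show "(-1) ^ i * pushforward (nerve_space H (Suc n)) (face_map H (Suc n) i) k x =
        (\<Sum>j\<le>n. (-1) ^ (i + j) * A x i j)"
        by (simp add: sum_distrib_left power_add mult.assoc)
    qed
    \<comment> \<open>The added sum is, up to signs, the prism operator applied to the boundary of
      f, which is zero. Its terms are needed to absorb the faces of prisms that lie over proper
      faces of the base.\<close>
    also have "\<dots> = \<dots> + (\<Sum>i\<le>n. \<Sum>j<n. (-1) ^ (i + j) * B x i j)"
    proof -
      have "(\<Sum>i\<le>n. \<Sum>j<n. (-1) ^ (i + j) * B x i j) = (\<Sum>j<n. \<Sum>i\<le>n. (-1) ^ (i + j) * B x i j)"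
        by (rule sum.swap)
      also have "\<dots> = 0"
      proof (rule sum.neutral, rule ballI)
        fix j assume "j \<in> {..<n}"
        then have j: "j < n" "j \<le> n - 1" and n: "0 < n" by auto
        have lh: "local_homeomorphism (nerve_space G (n - 1)) (nerve_space H n) (prism_map (n - 1) j)"
          using local_homeomorphism_prism_map[OF j(2)] n by simp
        have "(\<Sum>i\<le>n. (-1) ^ i * B x i j) =
          (\<Sum>i\<in>{..n}. (-1) ^ i * pushforward (nerve_space G (n - 1)) (prism_map (n - 1) j) (pushforward (nerve_space G n) (face_map G n i) f) x)"
        proof (rule sum.cong[OF refl])
          fix i assume "i \<in> {..n}"
          then have i: "i \<le> n" by simp
          have "pushforward (nerve_space G (n - 1)) (prism_map (n - 1) j) (pushforward (nerve_space G n) (face_map G n i) f) =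
            pushforward (nerve_space G n) (\<lambda>g. prism_map (n - 1) j (face_map G n i g)) f"
            by (rule pushforward_compose[where \<psi> = "face_map G n i" and \<phi> = "prism_map (n - 1) j",
                OF local_homeomorphism_apply[OF G.local_homeomorphism_face_map[OF n i]]
                   local_homeomorphism_compose'[OF G.local_homeomorphism_face_map[OF n i] lh] fC])
          then show "(-1) ^ i * B x i j = (-1) ^ i * pushforward (nerve_space G (n - 1)) (prism_map (n - 1) j) (pushforward (nerve_space G n) (face_map G n i) f) x"
            by (simp add: B_def)
        qed
        also have "\<dots> = pushforward (nerve_space G (n - 1)) (prism_map (n - 1) j) (boundary G n f) x"
          unfolding G.boundary_eq_sum_fun[OF n]
          by (rule pushforward_sum[OF lh, symmetric]) (use G.pushforward_face_map_closed[OF fC n] in auto)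
        also have "\<dots> = 0" by (simp add: f0 pushforward_zero)
        finally have "(-1) ^ j * (\<Sum>i\<le>n. (-1) ^ i * B x i j) = 0" by simp
        then show "(\<Sum>i\<le>n. (-1) ^ (i + j) * B x i j) = 0"
          by (simp add: sum_distrib_left power_add mult_ac)
      qed
      finally show ?thesis by simp
    qed
    also have "\<dots> = A x 0 0 - A x (Suc n) n"
    proof (rule alternating_sum_prism)
      fix i j :: nat assume ij: "i < j" "j \<le> n"
      \<comment> \<open>The omitted vertex (i, True) lies on the \<sigma>-side before the jump
        between the sides, so over face i the jump occurs one index earlier.\<close>
      have ix: "prism_index j (skip i a) = map_prod (skip i) id (prism_index (j - 1) a)" for a
        using ij by (auto simp: prism_index_def skip_def)
      show "A x i j = B x i (j - 1)"
        unfolding A_def B_def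
        by (intro fun_cong[OF pushforward_cong])
          (use ij prism_map_face_map[of _ n "j - 1" i] in \<open>simp add: face_map_prism_map ix\<close>)
    next
      fix i j :: nat assume ij: "Suc j < i" "i \<le> Suc n"
      \<comment> \<open>The omitted vertex is (i - 1, False), after the jump; the jump stays at j
        and the base loses vertex i - 1.\<close>
      have ix: "prism_index j (skip i a) = map_prod (skip (i - 1)) id (prism_index j a)" for a
        using ij by (auto simp: prism_index_def skip_def)
      show "A x i j = B x (i - 1) j"
        unfolding A_def B_def
        by (intro fun_cong[OF pushforward_cong])
          (use ij prism_map_face_map[of _ n j "i - 1"] in \<open>simp add: face_map_prism_map ix\<close>)
    next
      fix i assume i: "i < n"
      \<comment> \<open>Simplex i + 1 loses (i + 1, True) and simplex i loses (i, False). What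
        remains is the wall common to both, which jumps from (i, True) to (i + 1, False).\<close>
      have ix: "prism_index (Suc i) (skip (Suc i) a) = prism_index i (skip (Suc i) a)" for a
        by (auto simp: prism_index_def skip_def)
      show "A x (Suc i) (Suc i) = A x (Suc i) i"
        unfolding A_def
        by (intro fun_cong[OF pushforward_cong]) (use i in \<open>simp add: face_map_prism_map ix\<close>)
    qed
    \<comment> \<open>Simplex 0 has only its vertex 0 on the \<sigma>-side; omitting it leaves the
      whole \<rho>-side.\<close>
    also have "A x 0 0 = pushforward (nerve_space G n) (nerve_map n \<rho>) f x"
      unfolding A_def
    proof (intro fun_cong[OF pushforward_cong])
      fix g assume "g \<in> topspace (nerve_space G n)"
      then have g: "g \<in> nerve G n" by simp
      show "face_map H (Suc n) 0 (prism_map n 0 g) = nerve_map n \<rho> g"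
        unfolding face_map_prism_map[OF g le0 le0] nerve_map_eq[OF g]
        by (rule tuple_of_cong) (simp add: prism_index_def skip_def prism_\<rho>[OF g])
    qed
    \<comment> \<open>Simplex n has only its last vertex on the \<rho>-side; omitting it leaves the
      whole \<sigma>-side.\<close>
    also have "A x (Suc n) n = pushforward (nerve_space G n) (nerve_map n \<sigma>) f x"
      unfolding A_def
    proof (intro fun_cong[OF pushforward_cong])
      fix g assume "g \<in> topspace (nerve_space G n)"
      then have g: "g \<in> nerve G n" by simp
      show "face_map H (Suc n) (Suc n) (prism_map n n g) = nerve_map n \<sigma> g"
        unfolding face_map_prism_map[OF g order_refl order_refl] nerve_map_eq[OF g]
        by (rule tuple_of_cong) (simp add: prism_index_def skip_def prism_\<sigma>[OF g])
    qed
    finally show ?thesis .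
  qed
  then have "boundary H (Suc n) k = (\<lambda>x. pushforward (nerve_space G n) (nerve_map n \<rho>) f x - pushforward (nerve_space G n) (nerve_map n \<sigma>) f x)"
    by (rule ext)
  then show ?thesis
    using kC unfolding boundaries_def by (metis H.chain_carrier Suc_eq_plus1 imageI)
qed

end

section \<open>Similarities act as isomorphisms on homology\<close>

lemma etale_hom_compose:
  assumes "etale_hom G H \<rho>" "etale_hom H K \<sigma>"
  shows "etale_hom G K (\<sigma> \<circ> \<rho>)"
  using assms local_homeomorphism_compose unfolding etale_hom_def groupoid_hom_def by auto

lemma etale_hom_id: "etale_hom G G id"
  by (simp add: etale_hom_def groupoid_hom_def homeomorphic_imp_local_homeomorphism)

lemma similar_to_id_homologous:
  assumes G: "Hausdorff_etale_groupoid G" and H: "Hausdorff_etale_groupoid H"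
    and \<rho>: "etale_hom G H \<rho>" and \<sigma>: "etale_hom H G \<sigma>" and sim: "similar_homs G G (\<sigma> \<circ> \<rho>) id"
    and f: "f \<in> carrier (cycle_group G n)"
  shows "(\<lambda>x. pushforward (nerve_space H n) (nerve_map n \<sigma>) (pushforward (nerve_space G n) (nerve_map n \<rho>) f) x - f x)
    \<in> boundaries G n"
proof -
  interpret GH: groupoid_pair G H using G H by (simp add: groupoid_pair_def)
  interpret HG: groupoid_pair H G using G H by (simp add: groupoid_pair_def)
  have e: "etale_hom G G (\<sigma> \<circ> \<rho>)" by (rule etale_hom_compose[OF \<rho> \<sigma>])
  obtain \<theta> where \<theta>: "continuous_map (unit_space G) (gtop G) \<theta>"
    "\<And>g. g \<in> arrows G \<Longrightarrow> src G (\<theta> (rng G g)) = rng G ((\<sigma> \<circ> \<rho>) g)"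
    "\<And>g. g \<in> arrows G \<Longrightarrow> src G (id g) = rng G (\<theta> (src G g))"
    "\<And>g. g \<in> arrows G \<Longrightarrow> gmul G (\<theta> (rng G g)) ((\<sigma> \<circ> \<rho>) g) = gmul G (id g) (\<theta> (src G g))"
    using sim unfolding similar_homs_def by blast
  interpret similar_pair G G "\<sigma> \<circ> \<rho>" id \<theta>
    using G e etale_hom_id \<theta> by (simp add: similar_pair_def similar_pair_axioms_def groupoid_pair_def)
  have fC: "f \<in> compactly_supported (nerve_space G n)" using f by simp
  have "pushforward (nerve_space H n) (nerve_map n \<sigma>) (pushforward (nerve_space G n) (nerve_map n \<rho>) f) =
     pushforward (nerve_space G n) (\<lambda>g. nerve_map n \<sigma> (nerve_map n \<rho> g)) f"
    by (rule pushforward_compose[where \<psi> = "nerve_map n \<rho>" and \<phi> = "nerve_map n \<sigma>",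
          OF local_homeomorphism_apply[OF GH.local_homeomorphism_nerve_map[OF \<rho>]]
            local_homeomorphism_compose'[OF GH.local_homeomorphism_nerve_map[OF \<rho>] HG.local_homeomorphism_nerve_map[OF \<sigma>]] fC])
  also have "\<dots> = pushforward (nerve_space G n) (nerve_map n (\<sigma> \<circ> \<rho>)) f"
    by (rule pushforward_cong) (simp add: nerve_map_def fun_eq_iff)
  finally have 1: "pushforward (nerve_space H n) (nerve_map n \<sigma>) (pushforward (nerve_space G n) (nerve_map n \<rho>) f) =
    pushforward (nerve_space G n) (nerve_map n (\<sigma> \<circ> \<rho>)) f" .
  have 2: "pushforward (nerve_space G n) (nerve_map n id) f = f"
    by (rule pushforward_ident[OF fC]) (use nerve_map_eq[of _ n id] GH.G.tuple_of_edge in simp)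
  show ?thesis
    using prism_homotopy[OF f] unfolding 1 2 .
qed

text \<open>Pushing forward along \<sigma> is an inverse up to boundaries. The similarity of
  \<sigma> after \<rho> with the identity gives injectivity, that of \<rho> after \<sigma> gives
  surjectivity.\<close>

theorem similarity_homology_iso:
  assumes G: "Hausdorff_etale_groupoid G" and H: "Hausdorff_etale_groupoid H" and sim: "similarity G H \<rho>"
  shows "homology_map G H \<rho> n \<in> iso (homology_group G n) (homology_group H n)"
proof -
  interpret GH: groupoid_pair G H using G H by (simp add: groupoid_pair_def)
  interpret HG: groupoid_pair H G using G H by (simp add: groupoid_pair_def)
  obtain \<sigma> where \<rho>: "etale_hom G H \<rho>" and \<sigma>: "etale_hom H G \<sigma>"
    and 1: "similar_homs G G (\<sigma> \<circ> \<rho>) id" and 2: "similar_homs H H (\<rho> \<circ> \<sigma>) id"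
    using sim unfolding similarity_def by blast
  let ?P = "pushforward (nerve_space G n) (nerve_map n \<rho>)"
  let ?Q = "pushforward (nerve_space H n) (nerve_map n \<sigma>)"
  have bG: "subgroup (boundaries G n) (cycle_group G n)" and bH: "subgroup (boundaries H n) (cycle_group H n)"
    by (rule GH.G.subgroup_boundaries GH.H.subgroup_boundaries)+
  have minus: "(\<lambda>x. - b x) \<in> boundaries K n"
    if "b \<in> boundaries K n" "Hausdorff_etale_groupoid K" for b :: "(nat \<Rightarrow> 'c) \<Rightarrow> int" and K
  proof -
    interpret K: Hausdorff_etale_groupoid K by fact
    have "b \<in> carrier (cycle_group K n)" using that(1) subgroup.subset[OF K.subgroup_boundaries] by blast
    then show ?thesis
      using K.inv_cycle_group subgroup.m_inv_closed[OF K.subgroup_boundaries that(1)] by simp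
  qed
  have "(\<lambda>c. \<Union>f\<in>c. boundaries H n #>\<^bsub>cycle_group H n\<^esub> ?P f)
    \<in> iso (cycle_group G n Mod boundaries G n) (cycle_group H n Mod boundaries H n)"
  proof (rule FactGroup_iso_inducedI[OF GH.G.comm_group_cycle_group GH.H.comm_group_cycle_group bG bH])
    show "?P \<in> hom (cycle_group G n) (cycle_group H n)"
    proof (rule homI)
      show "?P f \<in> carrier (cycle_group H n)" if "f \<in> carrier (cycle_group G n)" for f
        by (rule GH.pushforward_cycle[OF \<rho> that])
      show "?P (f \<otimes>\<^bsub>cycle_group G n\<^esub> f') = ?P f \<otimes>\<^bsub>cycle_group H n\<^esub> ?P f'"
        if "f \<in> carrier (cycle_group G n)" "f' \<in> carrier (cycle_group G n)" for f f'
        using pushforward_add[OF GH.local_homeomorphism_nerve_map[OF \<rho>], of f n f'] that by simp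
    qed
    show "?P f \<in> boundaries H n" if "f \<in> boundaries G n" for f
      by (rule GH.pushforward_boundaries[OF \<rho> that])
    show "f \<in> boundaries G n" if f: "f \<in> carrier (cycle_group G n)" "?P f \<in> boundaries H n" for f
    proof -
      have a: "?Q (?P f) \<in> boundaries G n" by (rule HG.pushforward_boundaries[OF \<sigma> f(2)])
      \<comment> \<open>Added to the boundary in \<open>a\<close>, this leaves f.\<close>
      have b: "(\<lambda>x. - (?Q (?P f) x - f x)) \<in> boundaries G n"
        by (rule minus[OF similar_to_id_homologous[OF G H \<rho> \<sigma> 1 f(1)] G])
      show ?thesis using subgroup.m_closed[OF bG a b] by simp
    qed
    show "\<exists>f\<in>carrier (cycle_group G n). h \<in> boundaries H n #>\<^bsub>cycle_group H n\<^esub> ?P f"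
      if h: "h \<in> carrier (cycle_group H n)" for h
    proof (rule bexI)
      show "?Q h \<in> carrier (cycle_group G n)" by (rule HG.pushforward_cycle[OF \<sigma> h])
      have "(\<lambda>x. - (?P (?Q h) x - h x)) \<in> boundaries H n"
        by (rule minus[OF similar_to_id_homologous[OF H G \<sigma> \<rho> 2 h] H])
      then show "h \<in> boundaries H n #>\<^bsub>cycle_group H n\<^esub> ?P (?Q h)"
        unfolding r_coset_def by (auto intro!: exI bexI[rotated])
    qed
  qed
  moreover have "homology_map G H \<rho> n = (\<lambda>c. \<Union>f\<in>c. boundaries H n #>\<^bsub>cycle_group H n\<^esub> ?P f)"
    by (simp add: homology_map_def fun_eq_iff)
  ultimately show ?thesis by (simp add: homology_group_def)
qed


section \<open>Etale equivalences\<close>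

text \<open>
  The topological part of the definition of a weak equivalence is automatic for an etale homomorphism
  that is fully faithful and essentially surjective, so it is not required here.
\<close>

definition etale_equivalence :: "'k groupoid \<Rightarrow> 'a groupoid \<Rightarrow> ('k \<Rightarrow> 'a) \<Rightarrow> bool" where
  "etale_equivalence K G \<phi> \<longleftrightarrow>
     etale_hom K G \<phi> \<and>
     (\<forall>u\<in>units K. \<forall>v\<in>units K. \<forall>g\<in>arrows G. rng G g = \<phi> u \<longrightarrow> src G g = \<phi> v \<longrightarrow>
        (\<exists>!k. k \<in> arrows K \<and> rng K k = u \<and> src K k = v \<and> \<phi> k = g)) \<and>
     (\<forall>v\<in>units G. \<exists>u\<in>units K. \<exists>g\<in>arrows G. rng G g = \<phi> u \<and> src G g = v)"

lemma etale_equivalence_hom: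
  assumes "etale_equivalence K G \<phi>"
  shows "etale_hom K G \<phi>" "groupoid_hom K G \<phi>" "local_homeomorphism (gtop K) (gtop G) \<phi>"
  using assms by (auto simp: etale_equivalence_def etale_hom_def)

lemma groupoid_homD:
  assumes "groupoid_hom G H \<phi>" "g \<in> arrows G"
  shows "\<phi> g \<in> arrows H" "rng H (\<phi> g) = \<phi> (rng G g)" "src H (\<phi> g) = \<phi> (src G g)"
    "h \<in> arrows G \<Longrightarrow> src G g = rng G h \<Longrightarrow> \<phi> (gmul G g h) = gmul H (\<phi> g) (\<phi> h)"
  using assms by (auto simp: groupoid_hom_def)

lemma etale_equivalence_lift:
  assumes "etale_equivalence K G \<phi>" "u \<in> units K" "v \<in> units K"
    "g \<in> arrows G" "rng G g = \<phi> u" "src G g = \<phi> v"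
  obtains k where "k \<in> arrows K" "rng K k = u" "src K k = v" "\<phi> k = g"
  using assms unfolding etale_equivalence_def by metis

locale etale_equivalence_pair = K: Hausdorff_etale_groupoid K + G: Hausdorff_etale_groupoid G
  for K :: "'k groupoid" and G :: "'a groupoid" +
  fixes \<phi> :: "'k \<Rightarrow> 'a"
  assumes equiv: "etale_equivalence K G \<phi>"
begin

lemmas hom = etale_equivalence_hom(2)[OF equiv]

lemma faithful:
  assumes "k \<in> arrows K" "k' \<in> arrows K" "rng K k = rng K k'" "src K k = src K k'" "\<phi> k = \<phi> k'"
  shows "k = k'"
proof -
  have "\<exists>!x. x \<in> arrows K \<and> rng K x = rng K k \<and> src K x = src K k \<and> \<phi> x = \<phi> k"
    using equiv K.rng_unit[OF assms(1)] K.src_unit[OF assms(1)] groupoid_homD[OF hom assms(1)]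
    unfolding etale_equivalence_def by blast
  then show ?thesis using assms by metis
qed

text \<open>A continuous family m of arrows of G with continuously chosen endpoints in K lifts
  pointwise by full faithfulness. The lift is continuous because near each parameter it must agree
  with a preimage taken in a small open set.\<close>

lemma continuous_lift:
  assumes a: "continuous_map Y (unit_space K) a" and b: "continuous_map Y (unit_space K) b"
    and m: "continuous_map Y (gtop G) m"
    and rm: "\<And>y. y \<in> topspace Y \<Longrightarrow> rng G (m y) = \<phi> (a y)"
    and sm: "\<And>y. y \<in> topspace Y \<Longrightarrow> src G (m y) = \<phi> (b y)"
  obtains l where "continuous_map Y (gtop K) l"
    "\<And>y. y \<in> topspace Y \<Longrightarrow> l y \<in> arrows K \<and> rng K (l y) = a y \<and> src K (l y) = b y \<and> \<phi> (l y) = m y"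
proof -
  have au: "a y \<in> units K" and bu: "b y \<in> units K" and ma: "m y \<in> arrows G" if "y \<in> topspace Y" for y
    using that a b m continuous_map_image_subset_topspace by fastforce+
  have "\<exists>k. k \<in> arrows K \<and> rng K k = a y \<and> src K k = b y \<and> \<phi> k = m y" if y: "y \<in> topspace Y" for y
    using etale_equivalence_lift[OF equiv au[OF y] bu[OF y] ma[OF y] rm[OF y] sm[OF y]] by metis
  then obtain l where l: "\<And>y. y \<in> topspace Y \<Longrightarrow> l y \<in> arrows K \<and> rng K (l y) = a y \<and> src K (l y) = b y \<and> \<phi> (l y) = m y"
    by metis
  have lh: "local_homeomorphism (gtop K) (gtop G) \<phi>" by (rule etale_equivalence_hom(3)[OF equiv])
  have lhu: "local_homeomorphism (unit_space K) (unit_space G) \<phi>"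
    by (rule local_homeomorphism_units[OF etale_equivalence_hom(1)[OF equiv] K.Hausdorff_etale_groupoid_axioms])
  have "openin Y {y \<in> topspace Y. l y \<in> O1}" if O1: "openin (gtop K) O1" for O1
  proof (subst openin_subopen, intro ballI)
    fix y assume "y \<in> {y \<in> topspace Y. l y \<in> O1}"
    then have y: "y \<in> topspace Y" "l y \<in> O1" by auto
    note ly = l[OF y(1)]
    obtain A where A: "openin (unit_space K) A" "a y \<in> A" "inj_on \<phi> A"
      by (rule local_homeomorphism_locally_inj[OF lhu, of "a y"]) (use au[OF y(1)] in auto)
    obtain B where B: "openin (unit_space K) B" "b y \<in> B" "inj_on \<phi> B"
      by (rule local_homeomorphism_locally_inj[OF lhu, of "b y"]) (use bu[OF y(1)] in auto)
    \<comment> \<open>On A and B the map \<phi> is injective, so an arrow k of U over m z must have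
      the endpoints a z and b z, and \<open>faithful\<close> identifies it with l z.\<close>
    define U where "U = O1 \<inter> {k \<in> arrows K. rng K k \<in> A} \<inter> {k \<in> arrows K. src K k \<in> B}"
    have "openin (gtop K) U"
      unfolding U_def
      by (intro openin_Int O1 openin_continuous_map_preimage[OF _ A(1)] openin_continuous_map_preimage[OF _ B(1)]
          local_homeomorphism_imp_continuous_map K.local_homeomorphism_rng K.local_homeomorphism_src)
    then have "openin (gtop G) (\<phi> ` U)"
      using local_homeomorphism_imp_open_map[OF lh] by (simp add: open_map_def)
    define N where "N = {y \<in> topspace Y. m y \<in> \<phi> ` U} \<inter> {y \<in> topspace Y. a y \<in> A} \<inter> {y \<in> topspace Y. b y \<in> B}"
    have "openin Y N"
      unfolding N_def
      by (intro openin_Int openin_continuous_map_preimage[OF m \<open>openin (gtop G) (\<phi> ` U)\<close>]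
          openin_continuous_map_preimage[OF a A(1)] openin_continuous_map_preimage[OF b B(1)])
    moreover have "y \<in> N"
    proof -
      have "l y \<in> U" using y(2) ly A(2) B(2) by (simp add: U_def)
      then have "m y \<in> \<phi> ` U" using ly by (metis imageI)
      then show ?thesis using y(1) A(2) B(2) by (simp add: N_def)
    qed
    moreover have "N \<subseteq> {y \<in> topspace Y. l y \<in> O1}"
    proof
      fix z assume "z \<in> N"
      then have z: "z \<in> topspace Y" "m z \<in> \<phi> ` U" "a z \<in> A" "b z \<in> B" by (auto simp: N_def)
      then obtain k where k: "k \<in> U" "\<phi> k = m z" by auto
      have kK: "k \<in> arrows K" "rng K k \<in> A" "src K k \<in> B" "k \<in> O1" using k(1) by (auto simp: U_def)
      have "\<phi> (rng K k) = \<phi> (a z)" "\<phi> (src K k) = \<phi> (b z)"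
        using groupoid_homD[OF hom kK(1)] k(2) rm[OF z(1)] sm[OF z(1)] by simp_all
      then have "rng K k = a z" "src K k = b z"
        using inj_onD[OF A(3) _ kK(2) z(3)] inj_onD[OF B(3) _ kK(3) z(4)] by blast+
      then have "l z = k"
        using l[OF z(1)] kK(1) k(2) by - (rule faithful, simp_all)
      then show "z \<in> {y \<in> topspace Y. l y \<in> O1}" using z(1) kK(4) by simp
    qed
    ultimately show "\<exists>T. openin Y T \<and> y \<in> T \<and> T \<subseteq> {y \<in> topspace Y. l y \<in> O1}" by blast
  qed
  moreover have "l ` topspace Y \<subseteq> arrows K" using l by blast
  ultimately have "continuous_map Y (gtop K) l" by (simp add: continuous_map)
  with l show ?thesis using that by blast
qed

text \<open>A continuous section over the units of G chooses an object u(v) of K and an arrow h(v)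
  from v to \<phi>(u(v)). An arrow g of G is conjugated by h so that its endpoints lie in the image
  of \<phi>, and then lifted; this is the inverse \<sigma>. The arrows h, inverted and for K lifted
  as well, are the required natural transformations.\<close>

theorem similarity:
  assumes "zero_dimensional_space (unit_space G)" "sigma_compact_space (unit_space G)"
  shows "similarity K G \<phi>"
proof -
  have lhu: "local_homeomorphism (unit_space K) (unit_space G) \<phi>"
    by (rule local_homeomorphism_units[OF etale_equivalence_hom(1)[OF equiv] K.Hausdorff_etale_groupoid_axioms])
  define P where "P = subtopology (prod_topology (unit_space K) (gtop G)) {(u, g). \<phi> u = rng G g}"
  have lh_snd: "local_homeomorphism P (gtop G) snd"
    unfolding P_def
    by (rule local_homeomorphism_pullback[OF lhu local_homeomorphism_imp_continuous_map[OF G.local_homeomorphism_rng]])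
  have lh_fst: "local_homeomorphism P (unit_space K) fst"
    unfolding P_def
    by (rule local_homeomorphism_pullback_fst[OF G.local_homeomorphism_rng local_homeomorphism_imp_continuous_map[OF lhu]])
  have lh_q: "local_homeomorphism P (unit_space G) (\<lambda>p. src G (snd p))"
    by (rule local_homeomorphism_compose'[OF lh_snd G.local_homeomorphism_src])
  have surj: "(\<lambda>p. src G (snd p)) ` topspace P = topspace (unit_space G)"
  proof
    show "(\<lambda>p. src G (snd p)) ` topspace P \<subseteq> topspace (unit_space G)"
      using local_homeomorphism_apply[OF lh_q] by blast
    show "topspace (unit_space G) \<subseteq> (\<lambda>p. src G (snd p)) ` topspace P"
    proof
      fix v assume "v \<in> topspace (unit_space G)"
      then obtain u g where ug: "u \<in> units K" "g \<in> arrows G" "rng G g = \<phi> u" "src G g = v"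
        using equiv unfolding etale_equivalence_def by auto
      then have "(u, g) \<in> topspace P" by (simp add: P_def)
      then show "v \<in> (\<lambda>p. src G (snd p)) ` topspace P" using ug(4) by (intro image_eqI[of _ _ "(u, g)"]) auto
    qed
  qed
  obtain t where t: "continuous_map (unit_space G) P t" "\<And>v. v \<in> topspace (unit_space G) \<Longrightarrow> src G (snd (t v)) = v"
    using local_homeomorphism_section[OF lh_q surj G.Hausdorff_unit_space assms] by metis
  \<comment> \<open>This composite is the identity, so cancelling the projection shows that the
    section is itself a local homeomorphism. Hence so is u.\<close>
  have "local_homeomorphism (unit_space G) (unit_space G) (\<lambda>v. src G (snd (t v)))"
    by (rule local_homeomorphism_eq[OF homeomorphic_imp_local_homeomorphism[of _ _ id]]) (use t(2) in auto)
  from local_homeomorphism_cancel[OF this lh_q t(1)]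
  have lh_t: "local_homeomorphism (unit_space G) P t" .
  define u where "u v = fst (t v)" for v
  define h where "h v = snd (t v)" for v
  have lh_u: "local_homeomorphism (unit_space G) (unit_space K) u"
    unfolding u_def by (rule local_homeomorphism_compose'[OF lh_t lh_fst])
  have cont_h: "continuous_map (unit_space G) (gtop G) h"
    unfolding h_def by (rule local_homeomorphism_imp_continuous_map[OF local_homeomorphism_compose'[OF lh_t lh_snd]])
  have uh: "u v \<in> units K" "h v \<in> arrows G" "rng G (h v) = \<phi> (u v)" "src G (h v) = v" if "v \<in> units G" for v
    using local_homeomorphism_apply[OF lh_t, of v] t(2)[of v] that by (auto simp: u_def h_def P_def)
  have cr: "continuous_map (gtop G) (unit_space G) (rng G)" and cs: "continuous_map (gtop G) (unit_space G) (src G)"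
    using G.local_homeomorphism_rng G.local_homeomorphism_src local_homeomorphism_imp_continuous_map by blast+
  \<comment> \<open>The conjugate runs from \<phi>(u(s g)) to \<phi>(u(r g)), the endpoints that
    full faithfulness requires.\<close>
  define m where "m g = gmul G (gmul G (h (rng G g)) g) (ginv G (h (src G g)))" for g
  have hr: "h (rng G g) \<in> arrows G" "rng G (h (rng G g)) = \<phi> (u (rng G g))" "src G (h (rng G g)) = rng G g"
    and hs: "h (src G g) \<in> arrows G" "rng G (h (src G g)) = \<phi> (u (src G g))" "src G (h (src G g)) = src G g"
    if "g \<in> arrows G" for g
    using uh[OF G.rng_unit[OF that]] uh[OF G.src_unit[OF that]] by auto
  obtain \<sigma> where \<sigma>: "continuous_map (gtop G) (gtop K) \<sigma>"
    "\<And>g. g \<in> arrows G \<Longrightarrow> \<sigma> g \<in> arrows K \<and> rng K (\<sigma> g) = u (rng G g) \<and> src K (\<sigma> g) = u (src G g) \<and> \<phi> (\<sigma> g) = m g"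
  proof (rule continuous_lift)
    show "continuous_map (gtop G) (unit_space K) (\<lambda>g. u (rng G g))"
      using continuous_map_compose[OF cr local_homeomorphism_imp_continuous_map[OF lh_u]] by (simp add: o_def)
    show "continuous_map (gtop G) (unit_space K) (\<lambda>g. u (src G g))"
      using continuous_map_compose[OF cs local_homeomorphism_imp_continuous_map[OF lh_u]] by (simp add: o_def)
    have 1: "continuous_map (gtop G) (gtop G) (\<lambda>g. h (rng G g))" "continuous_map (gtop G) (gtop G) (\<lambda>g. h (src G g))"
      using continuous_map_compose[OF cr cont_h] continuous_map_compose[OF cs cont_h] by (simp_all add: o_def)
    have 2: "continuous_map (gtop G) (gtop G) (\<lambda>g. g)" using continuous_map_id by (simp add: id_def)
    show "continuous_map (gtop G) (gtop G) m"
      unfolding m_def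
      by (intro G.continuous_map_gmul G.continuous_map_ginv 1 2) (use hr hs in auto)
    show "rng G (m g) = \<phi> (u (rng G g))" "src G (m g) = \<phi> (u (src G g))" if "g \<in> topspace (gtop G)" for g
      using hr[OF that] hs[OF that] that by (simp_all add: m_def)
  qed auto
  have \<sigma>_unit: "\<sigma> v = u v" if v: "v \<in> units G" for v
  proof (rule faithful)
    note vD = G.unitsD[OF v]
    show "\<sigma> v \<in> arrows K" "rng K (\<sigma> v) = rng K (u v)" "src K (\<sigma> v) = src K (u v)"
      using \<sigma>(2)[OF vD(1)] vD K.unitsD[OF uh(1)[OF v]] by auto
    show "u v \<in> arrows K" using K.unitsD[OF uh(1)[OF v]] by simp
    have "m v = rng G (h v)"
      using uh[OF v] vD by (simp add: m_def v)
    then show "\<phi> (\<sigma> v) = \<phi> (u v)" using \<sigma>(2)[OF vD(1)] uh[OF v] by simp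
  qed
  have mm: "m (gmul G g g') = gmul G (m g) (m g')" if g: "g \<in> arrows G" "g' \<in> arrows G" "src G g = rng G g'" for g g'
    using hr[OF g(1)] hs[OF g(1)] hr[OF g(2)] hs[OF g(2)] g
    by (simp add: m_def)
  have hom_\<sigma>: "groupoid_hom G K \<sigma>"
    unfolding groupoid_hom_def
  proof (intro conjI ballI impI)
    fix g assume g: "g \<in> arrows G"
    show "\<sigma> g \<in> arrows K" "rng K (\<sigma> g) = \<sigma> (rng G g)" "src K (\<sigma> g) = \<sigma> (src G g)"
      using \<sigma>(2)[OF g] \<sigma>_unit G.rng_unit[OF g] G.src_unit[OF g] by auto
    fix g' assume g': "g' \<in> arrows G" "src G g = rng G g'"
    show "\<sigma> (gmul G g g') = gmul K (\<sigma> g) (\<sigma> g')"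
    proof (rule faithful)
      have gg: "gmul G g g' \<in> arrows G" using g g' by simp
      show "\<sigma> (gmul G g g') \<in> arrows K" "gmul K (\<sigma> g) (\<sigma> g') \<in> arrows K"
        "rng K (\<sigma> (gmul G g g')) = rng K (gmul K (\<sigma> g) (\<sigma> g'))"
        "src K (\<sigma> (gmul G g g')) = src K (gmul K (\<sigma> g) (\<sigma> g'))"
        using \<sigma>(2)[OF g] \<sigma>(2)[OF g'(1)] \<sigma>(2)[OF gg] g g' by auto
      have "\<phi> (gmul K (\<sigma> g) (\<sigma> g')) = gmul G (m g) (m g')"
        using groupoid_homD(4)[OF hom, of "\<sigma> g" "\<sigma> g'"] \<sigma>(2)[OF g] \<sigma>(2)[OF g'(1)] g'(2) by auto
      then show "\<phi> (\<sigma> (gmul G g g')) = \<phi> (gmul K (\<sigma> g) (\<sigma> g'))"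
        using mm[OF g g'] \<sigma>(2)[OF gg] by simp
    qed
  qed
  \<comment> \<open>The range of \<sigma> g is u(r g), so \<sigma> becomes a local homeomorphism on
    cancelling the range map of K. This is where u must be more than continuous.\<close>
  have "local_homeomorphism (gtop G) (unit_space K) (\<lambda>g. u (rng G g))"
    by (rule local_homeomorphism_compose'[OF G.local_homeomorphism_rng lh_u])
  then have "local_homeomorphism (gtop G) (unit_space K) (\<lambda>g. rng K (\<sigma> g))"
    by (rule local_homeomorphism_eq) (use \<sigma>(2) in auto)
  from local_homeomorphism_cancel[OF this K.local_homeomorphism_rng \<sigma>(1)] hom_\<sigma>
  have etale_\<sigma>: "etale_hom G K \<sigma>" by (simp add: etale_hom_def)
  have etale_\<phi>: "etale_hom K G \<phi>" by (rule etale_equivalence_hom(1)[OF equiv])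
  have cont: "continuous_hom A A (\<beta> \<circ> \<alpha>)" "continuous_hom A A id"
    if "etale_hom A B \<alpha>" "etale_hom B A \<beta>" for A :: "'c groupoid" and B :: "'d groupoid" and \<alpha> \<beta>
    using etale_hom_compose[OF that] etale_hom_id[of A] local_homeomorphism_imp_continuous_map
    by (auto simp: etale_hom_def continuous_hom_def)
  \<comment> \<open>The inverse of h(v) goes from \<phi>(u(v)), which is \<phi> after \<sigma> at v,
    back to v; naturality is the definition of m.\<close>
  have "similar_homs G G (\<phi> \<circ> \<sigma>) id"
    unfolding similar_homs_def
  proof (intro conjI cont[OF etale_\<sigma> etale_\<phi>] exI[of _ "\<lambda>v. ginv G (h v)"] ballI)
    show "continuous_map (unit_space G) (gtop G) (\<lambda>v. ginv G (h v))"
      by (rule G.continuous_map_ginv[OF cont_h])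
    fix g assume g: "g \<in> arrows G"
    show "src G (ginv G (h (rng G g))) = rng G ((\<phi> \<circ> \<sigma>) g)" "src G (id g) = rng G (ginv G (h (src G g)))"
      "gmul G (ginv G (h (rng G g))) ((\<phi> \<circ> \<sigma>) g) = gmul G (id g) (ginv G (h (src G g)))"
      using \<sigma>(2)[OF g] hr[OF g] hs[OF g] g by (simp_all add: m_def)
  qed
  moreover have "similar_homs K K (\<sigma> \<circ> \<phi>) id"
  proof -
    have c1: "continuous_map (unit_space K) (unit_space K) (\<lambda>w. w)"
      using continuous_map_id by (simp add: id_def)
    have c2: "continuous_map (unit_space K) (unit_space K) (\<lambda>w. u (\<phi> w))"
      using local_homeomorphism_imp_continuous_map[OF local_homeomorphism_compose'[OF lhu lh_u]] .
    have c3: "continuous_map (unit_space K) (gtop G) (\<lambda>w. ginv G (h (\<phi> w)))"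
      using continuous_map_compose[OF local_homeomorphism_imp_continuous_map[OF lhu] cont_h]
      by (intro G.continuous_map_ginv) (simp add: o_def)
    have \<phi>u: "\<phi> w \<in> units G" if "w \<in> units K" for w by (rule groupoid_hom_unit[OF hom that])
    \<comment> \<open>The inverse of h(\<phi> w) joins \<phi>(u(\<phi> w)) to \<phi>(w), so it lifts
      to an arrow of K from u(\<phi> w) to w. Naturality is checked after applying \<phi>, which is
      enough by \<open>faithful\<close>.\<close>
    obtain \<theta> where \<theta>: "continuous_map (unit_space K) (gtop K) \<theta>"
      "\<And>w. w \<in> topspace (unit_space K) \<Longrightarrow> \<theta> w \<in> arrows K \<and> rng K (\<theta> w) = w \<and> src K (\<theta> w) = u (\<phi> w) \<and> \<phi> (\<theta> w) = ginv G (h (\<phi> w))"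
      by (rule continuous_lift[OF c1 c2 c3]) (use uh[OF \<phi>u] in auto)
    show ?thesis
      unfolding similar_homs_def
    proof (intro conjI cont[OF etale_\<phi> etale_\<sigma>] exI[of _ \<theta>] ballI)
      fix k assume k: "k \<in> arrows K"
      note \<phi>k = groupoid_homD[OF hom k]
      have \<theta>r: "\<theta> (rng K k) \<in> arrows K" "rng K (\<theta> (rng K k)) = rng K k" "src K (\<theta> (rng K k)) = u (\<phi> (rng K k))"
          "\<phi> (\<theta> (rng K k)) = ginv G (h (\<phi> (rng K k)))"
        using \<theta>(2)[of "rng K k"] K.rng_unit[OF k] by auto
      have \<theta>s: "\<theta> (src K k) \<in> arrows K" "rng K (\<theta> (src K k)) = src K k" "src K (\<theta> (src K k)) = u (\<phi> (src K k))"
          "\<phi> (\<theta> (src K k)) = ginv G (h (\<phi> (src K k)))"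
        using \<theta>(2)[of "src K k"] K.src_unit[OF k] by auto
      have \<sigma>k: "\<sigma> (\<phi> k) \<in> arrows K" "rng K (\<sigma> (\<phi> k)) = u (\<phi> (rng K k))" "src K (\<sigma> (\<phi> k)) = u (\<phi> (src K k))"
        "\<phi> (\<sigma> (\<phi> k)) = m (\<phi> k)"
        using \<sigma>(2)[OF \<phi>k(1)] \<phi>k by auto
      show 1: "src K (\<theta> (rng K k)) = rng K ((\<sigma> \<circ> \<phi>) k)" "src K (id k) = rng K (\<theta> (src K k))"
        using \<theta>r \<theta>s \<sigma>k by auto
      show "gmul K (\<theta> (rng K k)) ((\<sigma> \<circ> \<phi>) k) = gmul K (id k) (\<theta> (src K k))"
      proof (rule faithful)
        show "gmul K (\<theta> (rng K k)) ((\<sigma> \<circ> \<phi>) k) \<in> arrows K" "gmul K (id k) (\<theta> (src K k)) \<in> arrows K"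
          "rng K (gmul K (\<theta> (rng K k)) ((\<sigma> \<circ> \<phi>) k)) = rng K (gmul K (id k) (\<theta> (src K k)))"
          "src K (gmul K (\<theta> (rng K k)) ((\<sigma> \<circ> \<phi>) k)) = src K (gmul K (id k) (\<theta> (src K k)))"
          using \<theta>r \<theta>s \<sigma>k k 1 by auto
        have "\<phi> (gmul K (\<theta> (rng K k)) (\<sigma> (\<phi> k))) = gmul G (ginv G (h (rng G (\<phi> k)))) (m (\<phi> k))"
          using groupoid_homD(4)[OF hom \<theta>r(1) \<sigma>k(1)] \<theta>r \<sigma>k \<phi>k by simp
        also have "\<dots> = gmul G (\<phi> k) (ginv G (h (src G (\<phi> k))))"
          using hr[OF \<phi>k(1)] hs[OF \<phi>k(1)] \<phi>k(1) by (simp add: m_def)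
        also have "\<dots> = \<phi> (gmul K k (\<theta> (src K k)))"
          using groupoid_homD(4)[OF hom k \<theta>s(1)] \<theta>s \<phi>k by simp
        finally show "\<phi> (gmul K (\<theta> (rng K k)) ((\<sigma> \<circ> \<phi>) k)) = \<phi> (gmul K (id k) (\<theta> (src K k)))" by simp
      qed
    qed (use \<theta> in simp)
  qed
  ultimately show ?thesis
    unfolding similarity_def using etale_\<phi> etale_\<sigma> by blast
qed

end

lemma etale_equivalence_similarity:
  assumes "Hausdorff_etale_groupoid K" "Hausdorff_etale_groupoid G" "etale_equivalence K G \<phi>"
    and "zero_dimensional_space (unit_space G)" "sigma_compact_space (unit_space G)"
  shows "similarity K G \<phi>"
  using etale_equivalence_pair.similarity[of K G \<phi>] assms
  by (simp add: etale_equivalence_pair_def etale_equivalence_pair_axioms_def)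

lemma etale_equivalence_homology_iso:
  assumes "Hausdorff_etale_groupoid K" "Hausdorff_etale_groupoid G" "etale_equivalence K G \<phi>"
    and "zero_dimensional_space (unit_space G)" "sigma_compact_space (unit_space G)"
  shows "homology_group K n \<cong> homology_group G n"
  using similarity_homology_iso[OF assms(1,2) etale_equivalence_similarity[OF assms]]
  by (rule is_isoI)


section \<open>Isomorphisms and composites; a criterion for Hausdorff etale groupoids\<close>

lemma etale_equivalence_iso:
  assumes "groupoid K" "groupoid_iso K L \<iota>"
  shows "etale_equivalence K L \<iota>"
proof -
  interpret K: groupoid K by fact
  have hom: "groupoid_hom K L \<iota>" and homeo: "homeomorphic_map (gtop K) (gtop L) \<iota>"
    using assms(2) by (auto simp: groupoid_iso_def)
  have inj: "inj_on \<iota> (arrows K)" and im: "\<iota> ` arrows K = arrows L"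
    using homeomorphic_imp_injective_map[OF homeo] homeomorphic_imp_surjective_map[OF homeo] by auto
  have unit: "u \<in> arrows K" if "u \<in> units K" for u using that by (simp add: units_def)
  show ?thesis
    unfolding etale_equivalence_def etale_hom_def
  proof (intro conjI ballI impI hom homeomorphic_imp_local_homeomorphism[OF homeo])
    fix u v g assume uv: "u \<in> units K" "v \<in> units K" and g: "g \<in> arrows L" "rng L g = \<iota> u" "src L g = \<iota> v"
    have "g \<in> \<iota> ` arrows K" using g(1) im by simp
    then obtain k where k: "k \<in> arrows K" "\<iota> k = g" by blast
    have "\<iota> (rng K k) = \<iota> u" "\<iota> (src K k) = \<iota> v"
      using groupoid_homD[OF hom k(1)] k(2) g by simp_all
    then have "rng K k = u" "src K k = v"
      using inj_onD[OF inj, of "rng K k" u] inj_onD[OF inj, of "src K k" v] unit uv k(1) by simp_all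
    then show "\<exists>!k. k \<in> arrows K \<and> rng K k = u \<and> src K k = v \<and> \<iota> k = g"
      using k inj_onD[OF inj] by (intro ex1I[of _ k]) auto
  next
    fix v assume v: "v \<in> units L"
    then have v': "v \<in> arrows L" "rng L v = v" "src L v = v" by (auto simp: units_def)
    then have "v \<in> \<iota> ` arrows K" using im by simp
    then obtain w where w: "w \<in> arrows K" "\<iota> w = v" by blast
    show "\<exists>u\<in>units K. \<exists>g\<in>arrows L. rng L g = \<iota> u \<and> src L g = v"
      by (rule bexI[OF _ K.rng_unit[OF w(1)]], rule bexI[OF _ v'(1)])
        (use groupoid_homD[OF hom w(1)] w(2) v' in simp)
  qed
qed

lemma etale_equivalence_compose:
  assumes "groupoid G" and \<alpha>: "etale_equivalence K L \<alpha>" and \<beta>: "etale_equivalence L G \<beta>"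
  shows "etale_equivalence K G (\<beta> \<circ> \<alpha>)"
proof -
  interpret G: groupoid G by fact
  note h\<alpha> = etale_equivalence_hom[OF \<alpha>] and h\<beta> = etale_equivalence_hom[OF \<beta>]
  show ?thesis
    unfolding etale_equivalence_def
  proof (intro conjI ballI impI etale_hom_compose[OF h\<alpha>(1) h\<beta>(1)])
    fix u v g assume uv: "u \<in> units K" "v \<in> units K" and g: "g \<in> arrows G"
      "rng G g = (\<beta> \<circ> \<alpha>) u" "src G g = (\<beta> \<circ> \<alpha>) v"
    have \<alpha>uv: "\<alpha> u \<in> units L" "\<alpha> v \<in> units L" using uv groupoid_hom_unit[OF h\<alpha>(2)] by auto
    have "\<exists>!l. l \<in> arrows L \<and> rng L l = \<alpha> u \<and> src L l = \<alpha> v \<and> \<beta> l = g"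
      using \<beta> \<alpha>uv g by (simp add: etale_equivalence_def)
    then obtain l where l: "l \<in> arrows L" "rng L l = \<alpha> u" "src L l = \<alpha> v" "\<beta> l = g"
      and l_unique: "\<And>l'. l' \<in> arrows L \<Longrightarrow> rng L l' = \<alpha> u \<Longrightarrow> src L l' = \<alpha> v \<Longrightarrow> \<beta> l' = g \<Longrightarrow> l' = l"
      by metis
    have "\<exists>!k. k \<in> arrows K \<and> rng K k = u \<and> src K k = v \<and> \<alpha> k = l"
      using \<alpha> uv l by (simp add: etale_equivalence_def)
    then obtain k where k: "k \<in> arrows K" "rng K k = u" "src K k = v" "\<alpha> k = l"
      and k_unique: "\<And>k'. k' \<in> arrows K \<Longrightarrow> rng K k' = u \<Longrightarrow> src K k' = v \<Longrightarrow> \<alpha> k' = l \<Longrightarrow> k' = k"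
      by metis
    show "\<exists>!k. k \<in> arrows K \<and> rng K k = u \<and> src K k = v \<and> (\<beta> \<circ> \<alpha>) k = g"
    proof (rule ex1I[of _ k])
      fix k' assume k': "k' \<in> arrows K \<and> rng K k' = u \<and> src K k' = v \<and> (\<beta> \<circ> \<alpha>) k' = g"
      then have "\<alpha> k' = l" using groupoid_homD[OF h\<alpha>(2), of k'] by (intro l_unique) auto
      then show "k' = k" using k' k_unique by blast
    qed (use k l in simp)
  next
    fix v assume v: "v \<in> units G"
    obtain w g where w: "w \<in> units L" "g \<in> arrows G" "rng G g = \<beta> w" "src G g = v"
      using \<beta> v unfolding etale_equivalence_def by blast
    obtain u l where u: "u \<in> units K" "l \<in> arrows L" "rng L l = \<alpha> u" "src L l = w"
      using \<alpha> w(1) unfolding etale_equivalence_def by blast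
    note \<beta>l = groupoid_homD[OF h\<beta>(2) u(2)]
    have "gmul G (\<beta> l) g \<in> arrows G" "rng G (gmul G (\<beta> l) g) = (\<beta> \<circ> \<alpha>) u" "src G (gmul G (\<beta> l) g) = v"
      using \<beta>l u w by simp_all
    then show "\<exists>u\<in>units K. \<exists>g\<in>arrows G. rng G g = (\<beta> \<circ> \<alpha>) u \<and> src G g = v"
      using u(1) by blast
  qed
qed

text \<open>A single local homeomorphism p on arrows that depends only on the range is enough:
  restricted to the open set of units it is still one, and cancelling it gives the range map. The
  source map is the range map after inversion, a homeomorphism. In the applications p is the range
  in the ambient groupoid, the first coordinate of a triple, or the range in each factor.\<close>

lemma Hausdorff_etale_groupoid_intro:
  assumes "groupoid G" and Haus: "Hausdorff_space (gtop G)"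
    and rng: "continuous_map (gtop G) (gtop G) (rng G)"
    and ginv: "continuous_map (gtop G) (gtop G) (ginv G)"
    and gmul: "continuous_map (subtopology (prod_topology (gtop G) (gtop G)) {(g, h). src G g = rng G h})
         (gtop G) (\<lambda>(g, h). gmul G g h)"
    and units: "openin (gtop G) (units G)"
    and p: "local_homeomorphism (gtop G) X p" and p_rng: "\<And>g. g \<in> arrows G \<Longrightarrow> p (rng G g) = p g"
  shows "Hausdorff_etale_groupoid G"
proof -
  interpret groupoid G by fact
  have invol: "ginv G (ginv G g) = g" if "g \<in> arrows G" for g
    using ginv_unique[of "ginv G g" g] that by simp
  have "homeomorphic_map (gtop G) (gtop G) (ginv G)"
    by (rule homeomorphic_maps_imp_map[where g = "ginv G"]) (use ginv invol in \<open>simp add: homeomorphic_maps_def\<close>)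
  then have lh_ginv: "local_homeomorphism (gtop G) (gtop G) (ginv G)"
    by (rule homeomorphic_imp_local_homeomorphism)
  have "local_homeomorphism (unit_space G) X p"
    unfolding unit_space_def by (rule local_homeomorphism_from_open_subtopology[OF p units])
  moreover have "local_homeomorphism (gtop G) X (\<lambda>g. p (rng G g))"
    by (rule local_homeomorphism_eq[OF p]) (simp add: p_rng)
  moreover have "continuous_map (gtop G) (unit_space G) (rng G)"
    using rng rng_unit by (auto simp: unit_space_def continuous_map_in_subtopology)
  ultimately have lh_rng: "local_homeomorphism (gtop G) (unit_space G) (rng G)"
    by (intro local_homeomorphism_cancel[where p = p])
  have src: "src G g = rng G (ginv G g)" if "g \<in> arrows G" for g using that by simp
  have lh_src: "local_homeomorphism (gtop G) (unit_space G) (src G)"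
    by (rule local_homeomorphism_eq[OF local_homeomorphism_compose'[OF lh_ginv lh_rng]]) simp
  then have "continuous_map (gtop G) (gtop G) (src G)"
    by (auto simp: unit_space_def local_homeomorphism_iff continuous_map_in_subtopology)
  then show ?thesis
    using Haus rng ginv gmul units lh_rng lh_src by unfold_locales
qed

section \<open>Restrictions\<close>

lemma restriction_simps [simp]:
  "gtop (restriction G U) = subtopology (gtop G) {g \<in> arrows G. rng G g \<in> U \<and> src G g \<in> U}"
  "rng (restriction G U) = rng G" "src (restriction G U) = src G"
  "gmul (restriction G U) = gmul G" "ginv (restriction G U) = ginv G"
  by (simp_all add: restriction_def)

lemma units_restriction: "U \<subseteq> units G \<Longrightarrow> units (restriction G U) = U"
  by (auto simp: units_def)

context Hausdorff_etale_groupoid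
begin

lemma Hausdorff_etale_restriction:
  assumes "openin (unit_space G) U"
  shows "Hausdorff_etale_groupoid (restriction G U)"
proof (rule Hausdorff_etale_groupoid_intro)
  have U: "U \<subseteq> units G" using openin_subset[OF assms] by simp
  let ?A = "{g \<in> arrows G. rng G g \<in> U \<and> src G g \<in> U}"
  have "?A = {g \<in> arrows G. rng G g \<in> U} \<inter> {g \<in> arrows G. src G g \<in> U}" by auto
  then have A: "openin (gtop G) ?A"
    using openin_continuous_map_preimage[OF local_homeomorphism_imp_continuous_map[OF local_homeomorphism_rng] assms]
      openin_continuous_map_preimage[OF local_homeomorphism_imp_continuous_map[OF local_homeomorphism_src] assms]
    by (simp add: openin_Int)
  show "groupoid (restriction G U)"
    by unfold_locales (auto simp: units_restriction[OF U])
  show "Hausdorff_space (gtop (restriction G U))"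
    by (simp add: Hausdorff Hausdorff_space_subtopology)
  have id: "continuous_map (subtopology (gtop G) ?A) (gtop G) (\<lambda>g. g)"
    using continuous_map_id_subt[of "gtop G" ?A] by (simp only: id_def)
  show "continuous_map (gtop (restriction G U)) (gtop (restriction G U)) (rng (restriction G U))"
    using continuous_map_rng[OF id] by (auto simp: continuous_map_in_subtopology)
  show "continuous_map (gtop (restriction G U)) (gtop (restriction G U)) (ginv (restriction G U))"
    using continuous_map_ginv[OF id] by (auto simp: continuous_map_in_subtopology)
  let ?Q = "subtopology (prod_topology (subtopology (gtop G) ?A) (subtopology (gtop G) ?A)) {(g, h). src G g = rng G h}"
  have "continuous_map ?Q (gtop G) (\<lambda>p. gmul G (fst p) (snd p))"
    by (rule continuous_map_gmul)
      (auto intro!: continuous_map_from_subtopology continuous_map_into_fulltopology[OF continuous_map_fst]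
        continuous_map_into_fulltopology[OF continuous_map_snd])
  then show "continuous_map (subtopology (prod_topology (gtop (restriction G U)) (gtop (restriction G U)))
      {(g, h). src (restriction G U) g = rng (restriction G U) h}) (gtop (restriction G U))
      (\<lambda>(g, h). gmul (restriction G U) g h)"
    by (auto simp: continuous_map_in_subtopology case_prod_unfold)
  have "openin (gtop G) U" using assms open_units by (simp add: unit_space_def openin_open_subtopology)
  moreover have "U \<subseteq> ?A" using U by (auto simp: units_def)
  ultimately show "openin (gtop (restriction G U)) (units (restriction G U))"
    using A by (simp add: units_restriction[OF U] openin_open_subtopology)
  show "local_homeomorphism (gtop (restriction G U)) (unit_space G) (rng G)"
    using local_homeomorphism_from_open_subtopology[OF local_homeomorphism_rng A] by simp
qed auto

text \<open>Fullness of U is essential surjectivity, and the restriction keeps every arrow between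
  points of U. The inclusion is etale because composing it with the range map of G gives a local
  homeomorphism into the open set U.\<close>

lemma etale_equivalence_restriction:
  assumes "openin (unit_space G) U" "full G U"
  shows "etale_equivalence (restriction G U) G id"
proof -
  interpret R: Hausdorff_etale_groupoid "restriction G U" by (rule Hausdorff_etale_restriction[OF assms(1)])
  have U: "U \<subseteq> units G" using assms(2) by (simp add: full_def)
  have hom: "groupoid_hom (restriction G U) G id" by (simp add: groupoid_hom_def)
  have "local_homeomorphism (gtop (restriction G U)) (unit_space (restriction G U)) (rng G)"
    using R.local_homeomorphism_rng by simp
  moreover have "unit_space (restriction G U) = subtopology (unit_space G) U"
  proof -
    have "{g \<in> arrows G. rng G g \<in> U \<and> src G g \<in> U} \<inter> U = units G \<inter> U"
      using U by (auto simp: units_def)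
    then show ?thesis
      by (simp only: unit_space_def units_restriction[OF U] restriction_simps subtopology_subtopology)
  qed
  ultimately have "local_homeomorphism (gtop (restriction G U)) (unit_space G) (\<lambda>g. rng G (id g))"
    using local_homeomorphism_into_fulltopology[OF _ assms(1)] by simp
  moreover have "continuous_map (gtop (restriction G U)) (gtop G) id" by simp
  ultimately have lh: "local_homeomorphism (gtop (restriction G U)) (gtop G) id"
    by (intro local_homeomorphism_cancel[OF _ local_homeomorphism_rng])
  show ?thesis
    unfolding etale_equivalence_def etale_hom_def
  proof (intro conjI hom lh ballI impI)
    fix u v g assume "u \<in> units (restriction G U)" "v \<in> units (restriction G U)" "g \<in> arrows G" "rng G g = id u" "src G g = id v"
    then show "\<exists>!k. k \<in> arrows (restriction G U) \<and> rng (restriction G U) k = u \<and> src (restriction G U) k = v \<and> id k = g"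
      by (intro ex1I[of _ g]) (auto simp: units_restriction[OF U])
  next
    fix v assume "v \<in> units G"
    then have "orbit G v \<inter> U \<noteq> {}" using assms(2) by (simp add: full_def)
    then obtain g where "g \<in> arrows G" "src G g = v" "rng G g \<in> U" by (auto simp: orbit_def)
    then show "\<exists>u\<in>units (restriction G U). \<exists>g\<in>arrows G. rng G g = id u \<and> src G g = v"
      by (auto simp: units_restriction[OF U])
  qed
qed

end

section \<open>Ampliations\<close>

lemma pullback_groupoid_simps [simp]:
  "gtop (pullback_groupoid X \<psi> G) = subtopology (prod_topology X (prod_topology (gtop G) X))
               {(x, g, y). \<psi> x = rng G g \<and> \<psi> y = src G g}"
  "rng (pullback_groupoid X \<psi> G) (x, g, y) = (x, rng G g, x)"
  "src (pullback_groupoid X \<psi> G) (x, g, y) = (y, src G g, y)"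
  "gmul (pullback_groupoid X \<psi> G) (x, g, y) (y', h, z) = (x, gmul G g h, z)"
  "ginv (pullback_groupoid X \<psi> G) (x, g, y) = (y, ginv G g, x)"
  by (simp_all add: pullback_groupoid_def)

locale ampliation = Hausdorff_etale_groupoid +
  fixes X :: "'x topology" and \<psi> :: "'x \<Rightarrow> 'a"
  assumes Hausdorff_X: "Hausdorff_space X"
    and lh_\<psi>: "local_homeomorphism X (unit_space G) \<psi>"
    and surj_\<psi>: "\<psi> ` topspace X = units G"
begin

abbreviation "A \<equiv> pullback_groupoid X \<psi> G"

lemma \<psi>_unit: "x \<in> topspace X \<Longrightarrow> \<psi> x \<in> units G"
  using surj_\<psi> by blast

lemma arrows_ampliation:
  "(x, g, y) \<in> arrows A \<longleftrightarrow> x \<in> topspace X \<and> g \<in> arrows G \<and> y \<in> topspace X \<and> \<psi> x = rng G g \<and> \<psi> y = src G g"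
  by auto

lemma units_ampliation: "units A = (\<lambda>x. (x, \<psi> x, x)) ` topspace X"
proof (intro equalityI subsetI)
  fix k assume k: "k \<in> units A"
  obtain x g y where xgy: "k = (x, g, y)" by (cases k) auto
  have "k \<in> arrows A" "rng A k = k" using k by (simp_all add: units_def)
  then have "x \<in> topspace X" "\<psi> x = rng G g" "rng G g = g" "y = x" by (auto simp: xgy)
  then have "k = (x, \<psi> x, x)" by (simp add: xgy)
  then show "k \<in> (\<lambda>x. (x, \<psi> x, x)) ` topspace X" using \<open>x \<in> topspace X\<close> by blast
next
  fix k assume "k \<in> (\<lambda>x. (x, \<psi> x, x)) ` topspace X"
  then obtain x where x: "x \<in> topspace X" "k = (x, \<psi> x, x)" by blast
  note u = unitsD[OF \<psi>_unit[OF x(1)]]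
  have "k \<in> arrows A" "rng A k = k" "src A k = k" using x(1) u by (simp_all add: x(2))
  then show "k \<in> units A" by (simp add: units_def[of A] del: pullback_groupoid_simps(1))
qed

lemma units_ampliationI: "x \<in> topspace X \<Longrightarrow> u = \<psi> x \<Longrightarrow> (x, u, x) \<in> units A"
  by (simp add: units_ampliation)

lemma groupoid_ampliation: "groupoid A"
  by unfold_locales
    (auto simp del: pullback_groupoid_simps(1) simp: arrows_ampliation intro!: units_ampliationI)

text \<open>The triples form an iterated pullback, first of y along the source and then of x along
  the range. The rest identifies the nested subspace topology with the one on triples.\<close>

lemma local_homeomorphism_ampliation_fst: "local_homeomorphism (gtop A) X fst"
proof -
  let ?Q = "subtopology (prod_topology (gtop G) X) {(g, y). src G g = \<psi> y}"
  have "local_homeomorphism ?Q (gtop G) fst"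
    by (rule local_homeomorphism_pullback_fst[OF lh_\<psi> local_homeomorphism_imp_continuous_map[OF local_homeomorphism_src]])
  from local_homeomorphism_compose'[OF this local_homeomorphism_rng]
  have "local_homeomorphism ?Q (unit_space G) (\<lambda>q. rng G (fst q))" .
  from local_homeomorphism_pullback_fst[OF this local_homeomorphism_imp_continuous_map[OF lh_\<psi>]]
  have "local_homeomorphism (subtopology (prod_topology X ?Q) {(x, q). \<psi> x = rng G (fst q)}) X fst" .
  moreover have "prod_topology X ?Q = subtopology (prod_topology X (prod_topology (gtop G) X)) (UNIV \<times> {(g, y). src G g = \<psi> y})"
    using subtopology_Times[of X "prod_topology (gtop G) X" UNIV "{(g, y). src G g = \<psi> y}"] by simp
  moreover have "(UNIV \<times> {(g, y). src G g = \<psi> y}) \<inter> {(x, q). \<psi> x = rng G (fst q)} = {(x, g, y). \<psi> x = rng G g \<and> \<psi> y = src G g}"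
    by auto
  ultimately show ?thesis by (simp add: subtopology_subtopology)
qed

lemma continuous_map_ampliation:
  "continuous_map (gtop A) X fst" "continuous_map (gtop A) (gtop G) (\<lambda>k. fst (snd k))"
  "continuous_map (gtop A) X (\<lambda>k. snd (snd k))"
proof -
  have "continuous_map (gtop A) (prod_topology (gtop G) X) snd"
    by (simp add: continuous_map_from_subtopology continuous_map_snd)
  then show "continuous_map (gtop A) (gtop G) (\<lambda>k. fst (snd k))" "continuous_map (gtop A) X (\<lambda>k. snd (snd k))"
    using continuous_map_compose[OF _ continuous_map_fst] continuous_map_compose[OF _ continuous_map_snd]
    by (auto simp: o_def)
  show "continuous_map (gtop A) X fst"
    by (simp add: continuous_map_from_subtopology continuous_map_fst)
qed

lemma continuous_map_into_ampliation:
  assumes "continuous_map Y X a" "continuous_map Y (gtop G) m" "continuous_map Y X b"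
    and "\<And>y. y \<in> topspace Y \<Longrightarrow> \<psi> (a y) = rng G (m y)" "\<And>y. y \<in> topspace Y \<Longrightarrow> \<psi> (b y) = src G (m y)"
  shows "continuous_map Y (gtop A) (\<lambda>y. (a y, m y, b y))"
  using assms by (auto simp: continuous_map_in_subtopology intro!: continuous_map_pairedI)

lemma Hausdorff_etale_ampliation: "Hausdorff_etale_groupoid A"
proof (rule Hausdorff_etale_groupoid_intro[OF groupoid_ampliation])
  show "Hausdorff_space (gtop A)"
    by (simp add: Hausdorff_space_subtopology Hausdorff_space_prod_topology Hausdorff Hausdorff_X)
  have mem: "fst k \<in> topspace X" "fst (snd k) \<in> arrows G" "snd (snd k) \<in> topspace X"
    "\<psi> (fst k) = rng G (fst (snd k))" "\<psi> (snd (snd k)) = src G (fst (snd k))" if "k \<in> arrows A" for k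
    using that by auto
  have "continuous_map (gtop A) (gtop A) (\<lambda>k. (fst k, rng G (fst (snd k)), fst k))"
    by (intro continuous_map_into_ampliation continuous_map_ampliation continuous_map_rng) (use mem in auto)
  then show "continuous_map (gtop A) (gtop A) (rng A)"
    by (simp add: pullback_groupoid_def case_prod_unfold)
  have "continuous_map (gtop A) (gtop A) (\<lambda>k. (snd (snd k), ginv G (fst (snd k)), fst k))"
    by (intro continuous_map_into_ampliation continuous_map_ampliation continuous_map_ginv) (use mem in auto)
  then show "continuous_map (gtop A) (gtop A) (ginv A)"
    by (simp add: pullback_groupoid_def case_prod_unfold)
  let ?Q = "subtopology (prod_topology (gtop A) (gtop A)) {(g, h). src A g = rng A h}"
  have f: "continuous_map ?Q (gtop A) fst" and s: "continuous_map ?Q (gtop A) snd"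
    by (auto intro: continuous_map_from_subtopology continuous_map_fst continuous_map_snd simp del: pullback_groupoid_simps)
  have Q: "fst p \<in> arrows A" "snd p \<in> arrows A" "snd (snd (fst p)) = fst (snd p)"
    "src G (fst (snd (fst p))) = rng G (fst (snd (snd p)))" if "p \<in> topspace ?Q" for p
    using that by (auto simp: pullback_groupoid_def)
  have "continuous_map ?Q (gtop A) (\<lambda>p. (fst (fst p), gmul G (fst (snd (fst p))) (fst (snd (snd p))), snd (snd (snd p))))"
  proof (intro continuous_map_into_ampliation continuous_map_gmul)
    show "continuous_map ?Q X (\<lambda>p. fst (fst p))" "continuous_map ?Q (gtop G) (\<lambda>p. fst (snd (fst p)))"
      using continuous_map_compose[OF f continuous_map_ampliation(1)] continuous_map_compose[OF f continuous_map_ampliation(2)]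
      by (simp_all add: o_def)
    show "continuous_map ?Q X (\<lambda>p. snd (snd (snd p)))" "continuous_map ?Q (gtop G) (\<lambda>p. fst (snd (snd p)))"
      using continuous_map_compose[OF s continuous_map_ampliation(3)] continuous_map_compose[OF s continuous_map_ampliation(2)]
      by (simp_all add: o_def)
  qed (use Q mem in auto)
  then show "continuous_map ?Q (gtop A) (\<lambda>(g, h). gmul A g h)"
    by (simp add: pullback_groupoid_def case_prod_unfold)
  show "local_homeomorphism (gtop A) X fst" by (rule local_homeomorphism_ampliation_fst)
  show "fst (rng A k) = fst k" if "k \<in> arrows A" for k
    by (simp add: pullback_groupoid_def case_prod_unfold)
  show "openin (gtop A) (units A)"
  proof (subst openin_subopen, intro ballI)
    fix k assume "k \<in> units A"
    then obtain x where x: "x \<in> topspace X" "k = (x, \<psi> x, x)" by (auto simp: units_ampliation)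
    obtain U where U: "openin X U" "x \<in> U" "inj_on \<psi> U"
      by (rule local_homeomorphism_locally_inj[OF lh_\<psi> x(1)])
    \<comment> \<open>If the middle entry is a unit g, both ends are sent to g; since both lie in U,
      where \<psi> is injective, they coincide. So triples of this kind are units.\<close>
    define T where "T = {k \<in> arrows A. fst k \<in> U} \<inter> {k \<in> arrows A. fst (snd k) \<in> units G} \<inter> {k \<in> arrows A. snd (snd k) \<in> U}"
    have "openin (gtop A) T"
      unfolding T_def
      by (intro openin_Int openin_continuous_map_preimage[OF continuous_map_ampliation(1) U(1)]
          openin_continuous_map_preimage[OF continuous_map_ampliation(2) open_units]
          openin_continuous_map_preimage[OF continuous_map_ampliation(3) U(1)])
    moreover have "k \<in> T" using x U(2) \<psi>_unit[OF x(1)] unitsD[OF \<psi>_unit[OF x(1)]] by (simp add: T_def)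
    moreover have "T \<subseteq> units A"
    proof
      fix l assume l: "l \<in> T"
      obtain a g b where abg: "l = (a, g, b)" by (cases l) auto
      then have p: "a \<in> U" "b \<in> U" "g \<in> units G" "\<psi> a = rng G g" "\<psi> b = src G g" "a \<in> topspace X"
        using l by (auto simp: T_def)
      then have "\<psi> a = g" "\<psi> b = g" using unitsD[OF p(3)] by auto
      then have "a = b" using inj_onD[OF U(3) _ p(1,2)] by simp
      then show "l \<in> units A" using abg \<open>\<psi> a = g\<close> p(6) by (auto simp: units_ampliation)
    qed
    ultimately show "\<exists>T. openin (gtop A) T \<and> k \<in> T \<and> T \<subseteq> units A" by blast
  qed
qed

lemma etale_equivalence_ampliation: "etale_equivalence A G (\<lambda>(x, g, y). g)"
proof -
  have hom: "groupoid_hom A G (\<lambda>(x, g, y). g)"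
    unfolding groupoid_hom_def by (auto simp: pullback_groupoid_def)
  have cont: "continuous_map (gtop A) (gtop G) (\<lambda>(x, g, y). g)"
    using continuous_map_ampliation(2) by (simp add: case_prod_unfold)
  have "local_homeomorphism (gtop A) (unit_space G) (\<lambda>k. rng G ((\<lambda>(x, g, y). g) k))"
    by (rule local_homeomorphism_eq[OF local_homeomorphism_compose'[OF local_homeomorphism_ampliation_fst lh_\<psi>]])
      auto
  from local_homeomorphism_cancel[OF this local_homeomorphism_rng cont]
  have lh: "local_homeomorphism (gtop A) (gtop G) (\<lambda>(x, g, y). g)" .
  show ?thesis
    unfolding etale_equivalence_def etale_hom_def
  proof (intro conjI hom lh ballI impI)
    fix u v g assume uv: "u \<in> units A" "v \<in> units A" and g: "g \<in> arrows G" 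
      "rng G g = (\<lambda>(x, g, y). g) u" "src G g = (\<lambda>(x, g, y). g) v"
    obtain x y where xy: "x \<in> topspace X" "y \<in> topspace X" "u = (x, \<psi> x, x)" "v = (y, \<psi> y, y)"
      using uv by (auto simp: units_ampliation)
    show "\<exists>!k. k \<in> arrows A \<and> rng A k = u \<and> src A k = v \<and> (\<lambda>(x, g, y). g) k = g"
    proof (rule ex1I[of _ "(x, g, y)"])
      show "k = (x, g, y)" if "k \<in> arrows A \<and> rng A k = u \<and> src A k = v \<and> (\<lambda>(x, g, y). g) k = g" for k
        using that xy by (cases k) auto
    qed (use xy g in auto)
  next
    fix v assume v: "v \<in> units G"
    then obtain x where x: "x \<in> topspace X" "\<psi> x = v" using surj_\<psi> by (metis imageE)
    show "\<exists>u\<in>units A. \<exists>g\<in>arrows G. rng G g = (\<lambda>(x, g, y). g) u \<and> src G g = v"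
    proof (intro bexI conjI)
      show "(x, \<psi> x, x) \<in> units A" by (rule units_ampliationI[OF x(1) refl])
      show "v \<in> arrows G" "src G v = v" by (rule unitsD[OF v])+
      show "rng G v = (\<lambda>(x, g, y). g) (x, \<psi> x, x)" using x(2) unitsD[OF v] by simp
    qed
  qed
qed

end


section \<open>Stabilisations\<close>

lemma product_groupoid_simps [simp]:
  "gtop (product_groupoid G H) = prod_topology (gtop G) (gtop H)"
  "rng (product_groupoid G H) (g, h) = (rng G g, rng H h)"
  "src (product_groupoid G H) (g, h) = (src G g, src H h)"
  "gmul (product_groupoid G H) (g, h) (g', h') = (gmul G g g', gmul H h h')"
  "ginv (product_groupoid G H) (g, h) = (ginv G g, ginv H h)"
  by (simp_all add: product_groupoid_def)

lemma full_equivalence_relation_simps [simp]: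
  "gtop full_equivalence_relation = discrete_topology UNIV"
  "rng full_equivalence_relation (m, n) = (m, m)"
  "src full_equivalence_relation (m, n) = (n, n)"
  "gmul full_equivalence_relation (m, n) (n', p) = (m, p)"
  "ginv full_equivalence_relation (m, n) = (n, m)"
  by (simp_all add: full_equivalence_relation_def)

lemma local_homeomorphism_discrete:
  "local_homeomorphism (discrete_topology UNIV) (discrete_topology UNIV) f"
  by (rule local_homeomorphismI) (auto simp: open_map_into_discrete_topology intro!: exI[of _ "{_}"])

lemma local_homeomorphism_fst_discrete:
  "local_homeomorphism (prod_topology X (discrete_topology UNIV)) X fst"
proof (rule local_homeomorphismI)
  show "continuous_map (prod_topology X (discrete_topology UNIV)) X fst" by (rule continuous_map_fst)
  show "open_map (prod_topology X (discrete_topology UNIV)) X fst" by (rule open_map_fst)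
  fix p assume "p \<in> topspace (prod_topology X (discrete_topology (UNIV :: 'b set)))"
  then show "\<exists>U. openin (prod_topology X (discrete_topology UNIV)) U \<and> p \<in> U \<and> inj_on fst U"
    by (intro exI[of _ "topspace X \<times> {snd p}"]) (auto simp: openin_prod_Times_iff inj_on_def)
qed

context Hausdorff_etale_groupoid
begin

abbreviation "stab \<equiv> product_groupoid G full_equivalence_relation"

lemma units_stabilisation: "(g, m, n) \<in> units stab \<longleftrightarrow> g \<in> units G \<and> m = n"
  by (auto simp: units_def)

lemma groupoid_stabilisation: "groupoid stab"
proof unfold_locales
  show "rng stab g \<in> units stab" "src stab g \<in> units stab" if "g \<in> arrows stab" for g
    using that rng_unit src_unit by (auto simp: units_stabilisation)
qed auto

lemma Hausdorff_etale_stabilisation: "Hausdorff_etale_groupoid stab"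
proof (rule Hausdorff_etale_groupoid_intro[OF groupoid_stabilisation])
  let ?D = "discrete_topology (UNIV :: (nat \<times> nat) set)"
  have stab: "gtop stab = prod_topology (gtop G) ?D" by simp
  show "Hausdorff_space (gtop stab)"
    by (simp add: Hausdorff_space_prod_topology Hausdorff Hausdorff_space_discrete_topology)
  have c: "continuous_map (gtop stab) ?D (\<lambda>p. f (snd p))" for f :: "nat \<times> nat \<Rightarrow> nat \<times> nat"
    using continuous_map_compose[OF continuous_map_snd[of "gtop G" ?D], of ?D f] by (simp add: o_def)
  have "continuous_map (gtop stab) (gtop stab) (\<lambda>p. (rng G (fst p), rng full_equivalence_relation (snd p)))"
    "continuous_map (gtop stab) (gtop stab) (\<lambda>p. (ginv G (fst p), ginv full_equivalence_relation (snd p)))"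
    using continuous_map_pairedI[OF continuous_map_rng c] continuous_map_pairedI[OF continuous_map_ginv c]
      continuous_map_fst[of "gtop G" ?D] unfolding stab by blast+
  then show "continuous_map (gtop stab) (gtop stab) (rng stab)" "continuous_map (gtop stab) (gtop stab) (ginv stab)"
    by (simp_all add: product_groupoid_def case_prod_unfold)
  let ?Q = "subtopology (prod_topology (gtop stab) (gtop stab)) {(g, h). src stab g = rng stab h}"
  have f: "continuous_map ?Q (gtop stab) fst" and s: "continuous_map ?Q (gtop stab) snd"
    by (auto intro: continuous_map_from_subtopology continuous_map_fst continuous_map_snd simp del: product_groupoid_simps)
  have ff: "continuous_map ?Q (gtop G) (\<lambda>p. fst (fst p))" and sf: "continuous_map ?Q ?D (\<lambda>p. snd (fst p))"
    and fs: "continuous_map ?Q (gtop G) (\<lambda>p. fst (snd p))" and ss: "continuous_map ?Q ?D (\<lambda>p. snd (snd p))"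
    using continuous_map_compose[OF f, of "gtop G" fst] continuous_map_compose[OF f, of ?D snd]
      continuous_map_compose[OF s, of "gtop G" fst] continuous_map_compose[OF s, of ?D snd]
    by (simp_all add: o_def continuous_map_fst continuous_map_snd)
  have "prod_topology ?D ?D = discrete_topology UNIV"
    using prod_topology_discrete_topology[of "UNIV :: (nat \<times> nat) set" "UNIV :: (nat \<times> nat) set"] by simp
  then have "continuous_map ?Q (discrete_topology UNIV) (\<lambda>p. (snd (fst p), snd (snd p)))"
    using continuous_map_pairedI[OF sf ss] by simp
  from continuous_map_compose[OF this, of ?D "\<lambda>(a, b). gmul full_equivalence_relation a b"]
  have m: "continuous_map ?Q ?D (\<lambda>p. gmul full_equivalence_relation (snd (fst p)) (snd (snd p)))"
    by (simp add: o_def)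
  have "src G (fst (fst p)) = rng G (fst (snd p))" if "p \<in> topspace ?Q" for p
    using that by (auto simp: product_groupoid_def)
  then have "continuous_map ?Q (gtop G) (\<lambda>p. gmul G (fst (fst p)) (fst (snd p)))"
    by (rule continuous_map_gmul[OF ff fs])
  from continuous_map_pairedI[OF this m]
  show "continuous_map ?Q (gtop stab) (\<lambda>(g, h). gmul stab g h)"
    by (simp add: product_groupoid_def case_prod_unfold)
  have "units stab = units G \<times> {(m, n). m = n}" by (auto simp: units_stabilisation)
  then show "openin (gtop stab) (units stab)" by (simp add: openin_prod_Times_iff open_units)
  \<comment> \<open>This p keeps the range in each factor, with the index m in place of the unit (m,
    m).\<close>
  show "local_homeomorphism (gtop stab) (prod_topology (unit_space G) (discrete_topology UNIV)) (\<lambda>(g, r). (rng G g, fst r))"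
    unfolding stab by (rule local_homeomorphism_prod[OF local_homeomorphism_rng local_homeomorphism_discrete])
qed auto

lemma etale_equivalence_stabilisation: "etale_equivalence stab G fst"
proof -
  have hom: "groupoid_hom stab G fst" by (auto simp: groupoid_hom_def)
  have lh: "local_homeomorphism (gtop stab) (gtop G) fst"
    by (simp add: local_homeomorphism_fst_discrete)
  show ?thesis
    unfolding etale_equivalence_def etale_hom_def
  proof (intro conjI hom lh ballI impI)
    fix u v g assume uv: "u \<in> units stab" "v \<in> units stab" and g: "g \<in> arrows G" "rng G g = fst u" "src G g = fst v"
    obtain x m y n where xy: "u = (x, m, m)" "v = (y, n, n)"
      using uv by (metis prod_cases3 units_stabilisation)
    show "\<exists>!k. k \<in> arrows stab \<and> rng stab k = u \<and> src stab k = v \<and> fst k = g"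
    proof (rule ex1I[of _ "(g, m, n)"])
      show "k = (g, m, n)" if "k \<in> arrows stab \<and> rng stab k = u \<and> src stab k = v \<and> fst k = g" for k
        using that xy by (cases k) auto
    qed (use xy g in auto)
  next
    fix v assume v: "v \<in> units G"
    then have "(v, 0, 0) \<in> units stab" by (simp add: units_stabilisation)
    then show "\<exists>u\<in>units stab. \<exists>g\<in>arrows G. rng G g = fst u \<and> src G g = v"
      using unitsD[OF v] by (intro bexI[of _ "(v, 0, 0)"] bexI[of _ v]) auto
  qed
qed

end

section \<open>Weak equivalences\<close>

text \<open>The map u to (u, \<phi> u) embeds the units of K as an open subset of P, and the given
  local homeomorphism on P restricts there to \<phi>. So \<phi> is a local homeomorphism on units;
  passing through the range maps extends this to arrows. The isomorphism with the pullback groupoid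
  is full faithfulness.\<close>

lemma weak_equivalence_imp_etale_equivalence:
  assumes K: "Hausdorff_etale_groupoid K" and G: "Hausdorff_etale_groupoid G" and w: "weak_equivalence K G \<phi>"
  shows "etale_equivalence K G \<phi>"
proof -
  interpret K: Hausdorff_etale_groupoid K by fact
  interpret G: Hausdorff_etale_groupoid G by fact
  define P where "P = subtopology (prod_topology (unit_space K) (gtop G)) {(u, h). \<phi> u = rng G h}"
  define A where "A = pullback_groupoid (unit_space K) \<phi> G"
  have hom: "groupoid_hom K G \<phi>" and cont: "continuous_map (gtop K) (gtop G) \<phi>"
    and lhq: "local_homeomorphism P (unit_space G) (\<lambda>(u, h). src G h)"
    and surj: "(\<lambda>(u, h). src G h) ` topspace P = units G"
    and homeo: "homeomorphic_map (gtop K) (gtop A) (\<lambda>k. (rng K k, \<phi> k, src K k))"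
    using w by (simp_all add: weak_equivalence_def continuous_hom_def groupoid_iso_def Let_def P_def A_def)
  have \<phi>u: "\<phi> u \<in> units G" if "u \<in> units K" for u by (rule groupoid_hom_unit[OF hom that])
  have "local_homeomorphism (unit_space K) P (\<lambda>u. (u, \<phi> u))"
  proof (rule local_homeomorphismI)
    have "continuous_map (unit_space K) (gtop G) \<phi>"
      using cont by (simp add: unit_space_def continuous_map_from_subtopology)
    then show "continuous_map (unit_space K) P (\<lambda>u. (u, \<phi> u))"
      using G.unitsD[OF \<phi>u] continuous_map_id[of "unit_space K"] unfolding P_def
      by (auto simp: continuous_map_in_subtopology id_def intro!: continuous_map_pairedI)
    show "open_map (unit_space K) P (\<lambda>u. (u, \<phi> u))"
      unfolding open_map_def
    proof (intro allI impI)
      fix U assume U: "openin (unit_space K) U"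
      then have Uu: "U \<subseteq> units K" using openin_subset by fastforce
      \<comment> \<open>A unit h equals its range, so the pairs of P with a unit as second entry are
        the pairs (u, \<phi> u). Openness of the image comes from openness of the units of
        G.\<close>
      have "(\<lambda>u. (u, \<phi> u)) ` U = (U \<times> units G) \<inter> {(u, h). \<phi> u = rng G h}"
        using Uu \<phi>u G.unitsD by force
      then show "openin P ((\<lambda>u. (u, \<phi> u)) ` U)"
        unfolding P_def using U G.open_units
        by (simp add: openin_subtopology_Int openin_prod_Times_iff)
    qed
    show "\<exists>U. openin (unit_space K) U \<and> u \<in> U \<and> inj_on (\<lambda>u. (u, \<phi> u)) U" if "u \<in> topspace (unit_space K)" for u
      using that by (intro exI[of _ "topspace (unit_space K)"] conjI openin_topspace) (auto simp: inj_on_def)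
  qed
  from local_homeomorphism_compose'[OF this lhq]
  have "local_homeomorphism (unit_space K) (unit_space G) (\<lambda>u. src G (\<phi> u))" by simp
  from local_homeomorphism_compose'[OF K.local_homeomorphism_rng this]
  have "local_homeomorphism (gtop K) (unit_space G) (\<lambda>k. src G (\<phi> (rng K k)))" .
  then have "local_homeomorphism (gtop K) (unit_space G) (\<lambda>k. rng G (\<phi> k))"
    by (rule local_homeomorphism_eq)
      (use G.unitsD(3)[OF \<phi>u[OF K.rng_unit]] groupoid_homD(2)[OF hom] in simp)
  from local_homeomorphism_cancel[OF this G.local_homeomorphism_rng cont]
  have lh: "local_homeomorphism (gtop K) (gtop G) \<phi>" .
  have inj: "inj_on (\<lambda>k. (rng K k, \<phi> k, src K k)) (arrows K)"
    and im: "(\<lambda>k. (rng K k, \<phi> k, src K k)) ` arrows K = arrows A"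
    using homeomorphic_imp_injective_map[OF homeo] homeomorphic_imp_surjective_map[OF homeo] by auto
  show ?thesis
    unfolding etale_equivalence_def etale_hom_def
  proof (intro conjI hom lh ballI impI)
    fix u v g assume "u \<in> units K" "v \<in> units K" "g \<in> arrows G" "rng G g = \<phi> u" "src G g = \<phi> v"
    then have "(u, g, v) \<in> arrows A" by (simp add: A_def)
    then have "(u, g, v) \<in> (\<lambda>k. (rng K k, \<phi> k, src K k)) ` arrows K" using im by simp
    then obtain k where k: "k \<in> arrows K" "rng K k = u" "\<phi> k = g" "src K k = v" by auto
    show "\<exists>!k. k \<in> arrows K \<and> rng K k = u \<and> src K k = v \<and> \<phi> k = g"
    proof (rule ex1I[of _ k])
      fix k' assume "k' \<in> arrows K \<and> rng K k' = u \<and> src K k' = v \<and> \<phi> k' = g"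
      then show "k' = k" using inj_onD[OF inj _ _ k(1), of k'] k by simp
    qed (use k in simp)
  next
    fix v assume "v \<in> units G"
    then have "v \<in> (\<lambda>(u, h). src G h) ` topspace P" using surj by simp
    then obtain u h where "(u, h) \<in> topspace P" "src G h = v" by auto
    then have "u \<in> units K" "h \<in> arrows G" "rng G h = \<phi> u" "src G h = v" by (simp_all add: P_def)
    then show "\<exists>u\<in>units K. \<exists>g\<in>arrows G. rng G g = \<phi> u \<and> src G g = v" by blast
  qed
qed

section \<open>Equivalence in the sense of Renault\<close>

lemma topspace_quotient_topology: "topspace (quotient_topology X q) = q ` topspace X"
proof
  show "topspace (quotient_topology X q) \<subseteq> q ` topspace X"
    by (metis openin_quotient_topology openin_topspace)
  have "{x \<in> topspace X. q x \<in> q ` topspace X} = topspace X" by auto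
  then have "openin (quotient_topology X q) (q ` topspace X)" by (simp add: openin_quotient_topology)
  then show "q ` topspace X \<subseteq> topspace (quotient_topology X q)" by (rule openin_subset)
qed

lemma induces_homeomorphismD:
  assumes "induces_homeomorphism Z q Y f"
  shows "f ` topspace Z = topspace Y"
    "\<And>x y. x \<in> topspace Z \<Longrightarrow> y \<in> topspace Z \<Longrightarrow> f x = f y \<Longrightarrow> q x = q y"
proof -
  obtain f' where f': "homeomorphic_map (quotient_topology Z q) Y f'" "\<And>z. z \<in> topspace Z \<Longrightarrow> f' (q z) = f z"
    using assms unfolding induces_homeomorphism_def by blast
  have "f' ` q ` topspace Z = topspace Y" "inj_on f' (q ` topspace Z)"
    using homeomorphic_imp_surjective_map[OF f'(1)] homeomorphic_imp_injective_map[OF f'(1)]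
    by (simp_all add: topspace_quotient_topology)
  then show "f ` topspace Z = topspace Y"
    using f'(2) by (auto simp: image_image)
  show "q x = q y" if "x \<in> topspace Z" "y \<in> topspace Z" "f x = f y" for x y
    using inj_onD[OF \<open>inj_on f' (q ` topspace Z)\<close>, of "q x" "q y"] f'(2) that by simp
qed

text \<open>Proper maps are closed, and an injective, continuous, closed map is an embedding. This
  makes the acting arrow a continuous function of a point and its translate.\<close>

lemma embedding_map_free_proper:
  assumes "proper_map T Y \<Gamma>" "inj_on \<Gamma> (topspace T)" "continuous_map T Y \<Gamma>"
  shows "homeomorphic_map T (subtopology Y (\<Gamma> ` topspace T)) \<Gamma>"
  using injective_closed_imp_embedding_map[of T Y \<Gamma>] assms by (simp add: proper_map_def embedding_map_def)

text \<open>
  The relation of a free and proper action of an etale groupoid is closed in \<open>Z \<times> Z\<close>, and the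
  diagonal is open in it because the units form an open set.
\<close>

lemma local_homeomorphism_quotient:
  assumes \<Gamma>: "homeomorphic_map T (subtopology (prod_topology Z Z) (\<Gamma> ` topspace T)) \<Gamma>"
    and D: "openin T D" "\<Gamma> ` D = (\<lambda>z. (z, z)) ` topspace Z"
    and f: "continuous_map Z Y f" "open_map Z Y f"
    and rel: "\<And>x y. x \<in> topspace Z \<Longrightarrow> y \<in> topspace Z \<Longrightarrow> f x = f y \<Longrightarrow> (x, y) \<in> \<Gamma> ` topspace T"
  shows "local_homeomorphism Z Y f"
proof (rule local_homeomorphismI[OF f])
  fix z assume z: "z \<in> topspace Z"
  have "openin (subtopology (prod_topology Z Z) (\<Gamma> ` topspace T)) (\<Gamma> ` D)"
    using homeomorphic_imp_open_map[OF \<Gamma>] D(1) by (simp add: open_map_def)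
  then obtain W where W: "openin (prod_topology Z Z) W" "\<Gamma> ` D = W \<inter> \<Gamma> ` topspace T"
    by (auto simp: openin_subtopology)
  have "(z, z) \<in> \<Gamma> ` D" using z by (simp add: D(2))
  then have "(z, z) \<in> W" using W(2) by blast
  then obtain U V where UV: "openin Z U" "openin Z V" "z \<in> U" "z \<in> V" "U \<times> V \<subseteq> W"
    using W(1) unfolding openin_prod_topology_alt by meson
  \<comment> \<open>Inside W only the diagonal belongs to the relation, so points of the
    neighbourhood with the same f-value coincide.\<close>
  have "inj_on f (U \<inter> V)"
  proof (rule inj_onI)
    fix x y assume xy: "x \<in> U \<inter> V" "y \<in> U \<inter> V" "f x = f y"
    then have "x \<in> topspace Z" "y \<in> topspace Z" using openin_subset[OF UV(1)] by auto
    then have "(x, y) \<in> \<Gamma> ` topspace T" using rel xy(3) by blast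
    moreover have "(x, y) \<in> W" using UV(5) xy by blast
    ultimately have "(x, y) \<in> \<Gamma> ` D" using W(2) by blast
    then show "x = y" by (auto simp: D(2))
  qed
  then show "\<exists>U. openin Z U \<and> z \<in> U \<and> inj_on f U"
    using UV by (intro exI[of _ "U \<inter> V"]) auto
qed

text \<open>Two points with the same value of s lie in one G-orbit, so they form a pair in the image
  of \<Gamma>. Arrows that are units form the open set D, whose image is the diagonal.\<close>

lemma left_quotient_local_homeomorphism:
  assumes G: "Hausdorff_etale_groupoid G" and fp: "free_proper_left_space G Z r act"
    and s: "continuous_map Z Y s" "open_map Z Y s" and ind: "induces_homeomorphism Z (left_orbit G r act) Y s"
  shows "local_homeomorphism Z Y s"
proof -
  interpret G: Hausdorff_etale_groupoid G by fact
  have L: "left_space G Z r act" using fp by (simp add: free_proper_left_space_def)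
  let ?T = "left_pairs G Z r" and ?\<Gamma> = "\<lambda>(g, z). (act g z, z)"
  have r: "r z \<in> units G" if "z \<in> topspace Z" for z
    using L that continuous_map_image_subset_topspace[of Z "unit_space G" r] by (auto simp: left_space_def)
  have act1: "act (r z) z = z" if "z \<in> topspace Z" for z using L that by (simp add: left_space_def)
  have T: "topspace ?T = {(g, z). g \<in> arrows G \<and> z \<in> topspace Z \<and> src G g = r z}"
    by (auto simp: left_pairs_def)
  have "continuous_map ?T Z (\<lambda>(g, z). act g z)" using L by (simp add: left_space_def)
  moreover have "continuous_map ?T Z snd"
    by (simp add: left_pairs_def continuous_map_from_subtopology continuous_map_snd)
  ultimately have "continuous_map ?T (prod_topology Z Z) ?\<Gamma>"
    by (simp add: case_prod_unfold continuous_map_pairedI)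
  then have \<Gamma>: "homeomorphic_map ?T (subtopology (prod_topology Z Z) (?\<Gamma> ` topspace ?T)) ?\<Gamma>"
    using fp by (intro embedding_map_free_proper) (simp_all add: free_proper_left_space_def)
  let ?D = "(units G \<times> topspace Z) \<inter> {(g, z). src G g = r z}"
  have D: "openin ?T ?D"
    unfolding left_pairs_def by (intro openin_subtopology_Int) (simp add: openin_prod_Times_iff G.open_units)
  show ?thesis
  proof (rule local_homeomorphism_quotient[OF \<Gamma> D _ s])
    show "?\<Gamma> ` ?D = (\<lambda>z. (z, z)) ` topspace Z"
    proof
      show "?\<Gamma> ` ?D \<subseteq> (\<lambda>z. (z, z)) ` topspace Z"
        using act1 G.unitsD(3) by auto
      show "(\<lambda>z. (z, z)) ` topspace Z \<subseteq> ?\<Gamma> ` ?D"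
      proof
        fix p assume "p \<in> (\<lambda>z. (z, z)) ` topspace Z"
        then obtain z where z: "z \<in> topspace Z" "p = (z, z)" by blast
        then have a: "(r z, z) \<in> ?D" and b: "p = ?\<Gamma> (r z, z)"
          using r[OF z(1)] G.unitsD(3)[OF r[OF z(1)]] act1[OF z(1)] by auto
        show "p \<in> ?\<Gamma> ` ?D" by (rule image_eqI[where f = ?\<Gamma> and x = "(r z, z)", OF b a])
      qed
    qed
    fix x y assume xy: "x \<in> topspace Z" "y \<in> topspace Z" "s x = s y"
    then have "left_orbit G r act x = left_orbit G r act y"
      by (rule induces_homeomorphismD(2)[OF ind])
    moreover have "x \<in> left_orbit G r act x"
      unfolding left_orbit_def using act1[OF xy(1)] r[OF xy(1)] G.unitsD[OF r[OF xy(1)]] by force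
    ultimately obtain g where g: "g \<in> arrows G" "src G g = r y" "x = act g y"
      by (auto simp: left_orbit_def)
    then have a: "(g, y) \<in> topspace ?T" and b: "(x, y) = ?\<Gamma> (g, y)" using xy(2) by (simp_all add: T)
    show "(x, y) \<in> ?\<Gamma> ` topspace ?T" by (rule image_eqI[where f = ?\<Gamma> and x = "(g, y)", OF b a])
  qed
qed


lemma right_quotient_local_homeomorphism:
  assumes H: "Hausdorff_etale_groupoid H" and fp: "free_proper_right_space H Z s act"
    and r: "continuous_map Z Y r" "open_map Z Y r" and ind: "induces_homeomorphism Z (right_orbit H s act) Y r"
  shows "local_homeomorphism Z Y r"
proof -
  interpret H: Hausdorff_etale_groupoid H by fact
  have L: "right_space H Z s act" using fp by (simp add: free_proper_right_space_def)
  let ?T = "right_pairs H Z s" and ?\<Gamma> = "\<lambda>(z, h). (z, act z h)"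
  have s: "s z \<in> units H" if "z \<in> topspace Z" for z
    using L that continuous_map_image_subset_topspace[of Z "unit_space H" s] by (auto simp: right_space_def)
  have act1: "act z (s z) = z" if "z \<in> topspace Z" for z using L that by (simp add: right_space_def)
  have T: "topspace ?T = {(z, h). z \<in> topspace Z \<and> h \<in> arrows H \<and> s z = rng H h}"
    by (auto simp: right_pairs_def)
  have "continuous_map ?T Z (\<lambda>(z, h). act z h)" using L by (simp add: right_space_def)
  moreover have "continuous_map ?T Z fst"
    by (simp add: right_pairs_def continuous_map_from_subtopology continuous_map_fst)
  ultimately have "continuous_map ?T (prod_topology Z Z) ?\<Gamma>"
    by (simp add: case_prod_unfold continuous_map_pairedI)
  then have \<Gamma>: "homeomorphic_map ?T (subtopology (prod_topology Z Z) (?\<Gamma> ` topspace ?T)) ?\<Gamma>"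
    using fp by (intro embedding_map_free_proper) (simp_all add: free_proper_right_space_def)
  let ?D = "(topspace Z \<times> units H) \<inter> {(z, h). s z = rng H h}"
  have D: "openin ?T ?D"
    unfolding right_pairs_def by (intro openin_subtopology_Int) (simp add: openin_prod_Times_iff H.open_units)
  show ?thesis
  proof (rule local_homeomorphism_quotient[OF \<Gamma> D _ r])
    show "?\<Gamma> ` ?D = (\<lambda>z. (z, z)) ` topspace Z"
    proof
      show "?\<Gamma> ` ?D \<subseteq> (\<lambda>z. (z, z)) ` topspace Z"
      proof
        fix p assume "p \<in> ?\<Gamma> ` ?D"
        then obtain z h where z: "z \<in> topspace Z" "h \<in> units H" "s z = rng H h" "p = (z, act z h)" by auto
        then have "h = s z" using H.unitsD(2)[OF z(2)] by simp
        then show "p \<in> (\<lambda>z. (z, z)) ` topspace Z" using z act1[OF z(1)] by simp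
      qed
      show "(\<lambda>z. (z, z)) ` topspace Z \<subseteq> ?\<Gamma> ` ?D"
      proof
        fix p assume "p \<in> (\<lambda>z. (z, z)) ` topspace Z"
        then obtain z where z: "z \<in> topspace Z" "p = (z, z)" by blast
        then have a: "(z, s z) \<in> ?D" and b: "p = ?\<Gamma> (z, s z)"
          using s[OF z(1)] H.unitsD(2)[OF s[OF z(1)]] act1[OF z(1)] by auto
        show "p \<in> ?\<Gamma> ` ?D" by (rule image_eqI[where f = ?\<Gamma> and x = "(z, s z)", OF b a])
      qed
    qed
    fix x y assume xy: "x \<in> topspace Z" "y \<in> topspace Z" "r x = r y"
    then have "right_orbit H s act x = right_orbit H s act y"
      by (rule induces_homeomorphismD(2)[OF ind])
    moreover have "y \<in> right_orbit H s act y"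
      unfolding right_orbit_def using act1[OF xy(2)] H.unitsD[OF s[OF xy(2)]] by force
    ultimately obtain h where h: "h \<in> arrows H" "s x = rng H h" "y = act x h"
      by (auto simp: right_orbit_def)
    then have a: "(x, h) \<in> topspace ?T" and b: "(x, y) = ?\<Gamma> (x, h)" using xy(1) by (simp_all add: T)
    show "(x, y) \<in> ?\<Gamma> ` topspace ?T" by (rule image_eqI[where f = ?\<Gamma> and x = "(x, h)", OF b a])
  qed
qed

text \<open>
  For a Renault equivalence \<open>Z\<close> the ampliation of \<open>G\<close> along \<open>r\<close> maps to \<open>H\<close>: an arrow \<open>(x, g, y)\<close> goes
  to the unique \<open>h\<close> with \<open>x \<cdot> h = g \<cdot> y\<close>.
\<close>

lemma renault_common_cover:
  fixes Z :: "'z topology" and G :: "'a groupoid" and H :: "'b groupoid"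
  assumes G: "Hausdorff_etale_groupoid G" and H: "Hausdorff_etale_groupoid H"
    and left: "free_proper_left_space G Z r lact" and right: "free_proper_right_space H Z s ract"
    and comm: "commuting_actions G H Z r s lact ract"
    and ind_r: "induces_homeomorphism Z (right_orbit H s ract) (unit_space G) r"
    and ind_s: "induces_homeomorphism Z (left_orbit G r lact) (unit_space H) s"
  obtains \<Phi> where "ampliation G Z r" "etale_equivalence (pullback_groupoid Z r G) H \<Phi>"
proof -
  interpret G: Hausdorff_etale_groupoid G by fact
  interpret H: Hausdorff_etale_groupoid H by fact
  have L: "left_space G Z r lact" and R: "right_space H Z s ract"
    using left right by (simp_all add: free_proper_left_space_def free_proper_right_space_def)
  have lh_r: "local_homeomorphism Z (unit_space G) r"
    by (rule right_quotient_local_homeomorphism[OF H right _ _ ind_r]) (use L in \<open>simp_all add: left_space_def\<close>)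
  have lh_s: "local_homeomorphism Z (unit_space H) s"
    by (rule left_quotient_local_homeomorphism[OF G left _ _ ind_s]) (use R in \<open>simp_all add: right_space_def\<close>)
  have amp: "ampliation G Z r"
    using G L lh_r induces_homeomorphismD(1)[OF ind_r]
    by (simp add: ampliation_def ampliation_axioms_def left_space_def)
  interpret ampliation G Z r by (rule amp)
  have s: "s z \<in> units H" if "z \<in> topspace Z" for z
    using local_homeomorphism_apply[OF lh_s that] by simp
  have lact1: "lact (r z) z = z" and ract1: "ract z (s z) = z" if "z \<in> topspace Z" for z
    using L R that by (simp_all add: left_space_def right_space_def)
  have rl: "r (lact g z) = rng G g" and sl: "s (lact g z) = s z" and lZ: "lact g z \<in> topspace Z"
    if "g \<in> arrows G" "z \<in> topspace Z" "src G g = r z" for g z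
  proof -
    show "r (lact g z) = rng G g" using L that by (simp add: left_space_def)
    show "s (lact g z) = s z" using comm that by (simp add: commuting_actions_def)
    have "continuous_map (left_pairs G Z r) Z (\<lambda>(g, z). lact g z)" using L by (simp add: left_space_def)
    moreover have "(g, z) \<in> topspace (left_pairs G Z r)" using that by (simp add: left_pairs_def)
    ultimately show "lact g z \<in> topspace Z"
      using continuous_map_image_subset_topspace by fastforce
  qed
  have sr: "s (ract z h) = src H h" and rr: "r (ract z h) = r z" and rZ: "ract z h \<in> topspace Z"
    if "z \<in> topspace Z" "h \<in> arrows H" "s z = rng H h" for z h
  proof -
    show "s (ract z h) = src H h" using R that by (simp add: right_space_def)
    show "r (ract z h) = r z" using comm that by (simp add: commuting_actions_def)
    have "continuous_map (right_pairs H Z s) Z (\<lambda>(z, h). ract z h)" using R by (simp add: right_space_def)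
    moreover have "(z, h) \<in> topspace (right_pairs H Z s)" using that by (simp add: right_pairs_def)
    ultimately show "ract z h \<in> topspace Z"
      using continuous_map_image_subset_topspace by fastforce
  qed
  let ?T = "right_pairs H Z s" and ?\<Gamma> = "\<lambda>(z, h). (z, ract z h)"
  have T: "topspace ?T = {(z, h). z \<in> topspace Z \<and> h \<in> arrows H \<and> s z = rng H h}"
    by (auto simp: right_pairs_def)
  have cT: "continuous_map ?T Z fst" "continuous_map ?T (gtop H) snd"
    by (simp_all add: right_pairs_def continuous_map_from_subtopology continuous_map_fst continuous_map_snd)
  have "continuous_map ?T Z (\<lambda>(z, h). ract z h)" using R by (simp add: right_space_def)
  then have "continuous_map ?T (prod_topology Z Z) ?\<Gamma>"
    using cT(1) by (simp add: case_prod_unfold continuous_map_pairedI)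
  then have homeo: "homeomorphic_map ?T (subtopology (prod_topology Z Z) (?\<Gamma> ` topspace ?T)) ?\<Gamma>"
    using right by (intro embedding_map_free_proper) (simp_all add: free_proper_right_space_def)
  have free_r: "h = h'" if "(z, h) \<in> topspace ?T" "(z, h') \<in> topspace ?T" "ract z h = ract z h'" for z h h'
  proof -
    have "inj_on ?\<Gamma> (topspace ?T)" using right by (simp add: free_proper_right_space_def)
    from inj_onD[OF this _ that(1,2)] show ?thesis using that(3) by simp
  qed
  have free_l: "g = g'" if "(g, z) \<in> topspace (left_pairs G Z r)" "(g', z) \<in> topspace (left_pairs G Z r)" "lact g z = lact g' z" for z g g'
  proof -
    have "inj_on (\<lambda>(g, z). (lact g z, z)) (topspace (left_pairs G Z r))" using left by (simp add: free_proper_left_space_def)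
    from inj_onD[OF this _ that(1,2)] show ?thesis using that(3) by simp
  qed
  \<comment> \<open>The inverse of the embedding recovers h from x and its translate by h; this is
    the source of the continuity of \<Phi>.\<close>
  obtain \<Delta> where \<Delta>: "homeomorphic_maps ?T (subtopology (prod_topology Z Z) (?\<Gamma> ` topspace ?T)) ?\<Gamma> \<Delta>"
    using homeo by (auto simp: homeomorphic_map_maps)
  define \<Phi> where "\<Phi> = (\<lambda>(x, g, y). snd (\<Delta> (x, lact g y)))"
  have ex: "\<exists>h. (x, h) \<in> topspace ?T \<and> ract x h = lact g y" if k: "(x, g, y) \<in> arrows A" for x g y
  proof -
    have k': "x \<in> topspace Z" "g \<in> arrows G" "y \<in> topspace Z" "r x = rng G g" "r y = src G g"
      using k by auto
    have gy: "lact g y \<in> topspace Z" "r (lact g y) = r x" using lZ rl k' by auto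
    have "right_orbit H s ract x = right_orbit H s ract (lact g y)"
      using induces_homeomorphismD(2)[OF ind_r k'(1) gy(1)] gy(2) by simp
    moreover have "lact g y \<in> right_orbit H s ract (lact g y)"
      unfolding right_orbit_def using ract1[OF gy(1)] H.unitsD[OF s[OF gy(1)]] by force
    ultimately have "lact g y \<in> right_orbit H s ract x" by simp
    then obtain h where "h \<in> arrows H" "s x = rng H h" "lact g y = ract x h"
      unfolding right_orbit_def by blast
    then show ?thesis using k'(1) by (intro exI[of _ h]) (simp add: T)
  qed
  have \<Gamma>\<Phi>: "(x, lact g y) \<in> ?\<Gamma> ` topspace ?T" and \<Phi>: "\<Phi> (x, g, y) \<in> arrows H" "rng H (\<Phi> (x, g, y)) = s x"
    "ract x (\<Phi> (x, g, y)) = lact g y" "src H (\<Phi> (x, g, y)) = s y"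
    if k: "(x, g, y) \<in> arrows A" for x g y
  proof -
    obtain h where h: "(x, h) \<in> topspace ?T" "ract x h = lact g y" using ex[OF k] by blast
    have e: "(x, lact g y) = ?\<Gamma> (x, h)" using h(2) by simp
    show "(x, lact g y) \<in> ?\<Gamma> ` topspace ?T" by (rule image_eqI[where f = ?\<Gamma> and x = "(x, h)", OF e h(1)])
    have "\<Delta> (?\<Gamma> (x, h)) = (x, h)" using \<Delta> h(1) unfolding homeomorphic_maps_def by blast
    then have \<Phi>h: "\<Phi> (x, g, y) = h" using h(2) by (simp add: \<Phi>_def)
    show "\<Phi> (x, g, y) \<in> arrows H" "rng H (\<Phi> (x, g, y)) = s x" "ract x (\<Phi> (x, g, y)) = lact g y"
      using h by (auto simp: \<Phi>h T)
    show "src H (\<Phi> (x, g, y)) = s y"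
      using sr[of x h] sl[of g y] h k by (simp add: \<Phi>h T)
  qed
  have \<Phi>_unique: "\<Phi> (x, g, y) = h" if "(x, g, y) \<in> arrows A" "h \<in> arrows H" "rng H h = s x" "ract x h = lact g y" for x g y h
    by (rule free_r[of x]) (use \<Phi>[OF that(1)] that in \<open>auto simp: T\<close>)
  have cont: "continuous_map (gtop A) (gtop H) \<Phi>"
  proof -
    have "continuous_map (gtop A) (left_pairs G Z r) (\<lambda>k. (fst (snd k), snd (snd k)))"
      unfolding left_pairs_def continuous_map_in_subtopology
      using continuous_map_pairedI[OF continuous_map_ampliation(2,3)] by auto
    moreover have "continuous_map (left_pairs G Z r) Z (\<lambda>(g, z). lact g z)" using L by (simp add: left_space_def)
    ultimately have "continuous_map (gtop A) Z ((\<lambda>(g, z). lact g z) \<circ> (\<lambda>k. (fst (snd k), snd (snd k))))"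
      by (rule continuous_map_compose)
    then have "continuous_map (gtop A) Z (\<lambda>k. lact (fst (snd k)) (snd (snd k)))"
      by (simp only: o_def case_prod_conv)
    from continuous_map_pairedI[OF continuous_map_ampliation(1) this]
    have "continuous_map (gtop A) (subtopology (prod_topology Z Z) (?\<Gamma> ` topspace ?T)) (\<lambda>k. (fst k, lact (fst (snd k)) (snd (snd k))))"
      unfolding continuous_map_in_subtopology
    proof
      show "(\<lambda>k. (fst k, lact (fst (snd k)) (snd (snd k)))) \<in> arrows A \<rightarrow> ?\<Gamma> ` topspace ?T"
      proof
        fix k assume "k \<in> arrows A"
        then have "(fst k, fst (snd k), snd (snd k)) \<in> arrows A" by (simp only: prod.collapse)
        then show "(fst k, lact (fst (snd k)) (snd (snd k))) \<in> ?\<Gamma> ` topspace ?T" by (rule \<Gamma>\<Phi>)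
      qed
    qed
    moreover have "continuous_map (subtopology (prod_topology Z Z) (?\<Gamma> ` topspace ?T)) ?T \<Delta>"
      using \<Delta> by (simp add: homeomorphic_maps_def)
    ultimately have "continuous_map (gtop A) ?T (\<Delta> \<circ> (\<lambda>k. (fst k, lact (fst (snd k)) (snd (snd k)))))"
      by (rule continuous_map_compose)
    from continuous_map_compose[OF this cT(2)]
    show ?thesis by (simp only: o_def \<Phi>_def case_prod_unfold)
  qed
  \<comment> \<open>Both r x and s x act on x as the identity, so uniqueness sends a unit to a
    unit.\<close>
  have \<Phi>_unit: "\<Phi> (x, r x, x) = s x" if x: "x \<in> topspace Z" for x
    by (rule \<Phi>_unique)
      (use x s[OF x] H.unitsD[OF s[OF x]] G.unitsD[OF \<psi>_unit[OF x]] lact1 ract1 in auto)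
  have hom: "groupoid_hom A H \<Phi>"
    unfolding groupoid_hom_def
  proof (intro conjI ballI impI)
    fix k assume kA: "k \<in> arrows A"
    obtain x g y where k: "k = (x, g, y)" by (cases k) auto
    then have k': "(x, g, y) \<in> arrows A" using kA by simp
    then have xg: "x \<in> topspace Z" "g \<in> arrows G" "y \<in> topspace Z" "r x = rng G g" "r y = src G g" by auto
    note \<Phi>k = \<Phi>[OF k']
    show "\<Phi> k \<in> arrows H" "rng H (\<Phi> k) = \<Phi> (rng A k)" "src H (\<Phi> k) = \<Phi> (src A k)"
      using \<Phi>k \<Phi>_unit[OF xg(1)] \<Phi>_unit[OF xg(3)] xg(4,5) by (simp_all add: k)
    fix l assume lA: "l \<in> arrows A" and kl: "src A k = rng A l"
    obtain y' g' z where l: "l = (y', g', z)" by (cases l) auto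
    with kl k have y': "y' = y" by simp
    have l': "(y, g', z) \<in> arrows A" using lA l y' by simp
    then have yg: "g' \<in> arrows G" "z \<in> topspace Z" "r y = rng G g'" "r z = src G g'" by auto
    note \<Phi>l = \<Phi>[OF l']
    have gg: "src G g = rng G g'" using xg(5) yg(3) by simp
    have "\<Phi> (x, gmul G g g', z) = gmul H (\<Phi> (x, g, y)) (\<Phi> (y, g', z))"
    proof (rule \<Phi>_unique)
      show "(x, gmul G g g', z) \<in> arrows A" using xg yg gg by (simp only: arrows_ampliation) simp
      show "gmul H (\<Phi> (x, g, y)) (\<Phi> (y, g', z)) \<in> arrows H"
        "rng H (gmul H (\<Phi> (x, g, y)) (\<Phi> (y, g', z))) = s x"
        using \<Phi>k \<Phi>l by simp_all
      have "ract x (gmul H (\<Phi> (x, g, y)) (\<Phi> (y, g', z))) = ract (ract x (\<Phi> (x, g, y))) (\<Phi> (y, g', z))"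
        using R \<Phi>k \<Phi>l xg(1) by (simp add: right_space_def)
      also have "\<dots> = ract (lact g y) (\<Phi> (y, g', z))" using \<Phi>k by simp
      also have "\<dots> = lact g (ract y (\<Phi> (y, g', z)))"
        using comm \<Phi>l xg by (simp add: commuting_actions_def)
      also have "\<dots> = lact g (lact g' z)" using \<Phi>l by simp
      also have "\<dots> = lact (gmul G g g') z"
        using L xg yg gg by (simp add: left_space_def)
      finally show "ract x (gmul H (\<Phi> (x, g, y)) (\<Phi> (y, g', z))) = lact (gmul G g g') z" .
    qed
    then show "\<Phi> (gmul A k l) = gmul H (\<Phi> k) (\<Phi> l)" by (simp add: k l y')
  qed
  have "local_homeomorphism (gtop A) (unit_space H) (\<lambda>k. rng H (\<Phi> k))"
  proof (rule local_homeomorphism_eq[OF local_homeomorphism_compose'[OF local_homeomorphism_ampliation_fst lh_s]])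
    fix k assume "k \<in> arrows A"
    then show "s (fst k) = rng H (\<Phi> k)" using \<Phi>(2)[of "fst k" "fst (snd k)" "snd (snd k)"] by (simp only: prod.collapse)
  qed
  from local_homeomorphism_cancel[OF this H.local_homeomorphism_rng cont]
  have lh: "local_homeomorphism (gtop A) (gtop H) \<Phi>" .
  have "etale_equivalence A H \<Phi>"
    unfolding etale_equivalence_def etale_hom_def
  proof (intro conjI hom lh ballI impI)
    fix u v h assume uv: "u \<in> units A" "v \<in> units A" and h: "h \<in> arrows H" "rng H h = \<Phi> u" "src H h = \<Phi> v"
    obtain x y where xy: "x \<in> topspace Z" "u = (x, r x, x)" "y \<in> topspace Z" "v = (y, r y, y)"
      using uv unfolding units_ampliation by blast
    have hx: "s x = rng H h" "src H h = s y" using h xy \<Phi>_unit by simp_all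
    have xh: "ract x h \<in> topspace Z" "s (ract x h) = s y" "r (ract x h) = r x"
      using rZ[OF xy(1) h(1) hx(1)] sr[OF xy(1) h(1) hx(1)] rr[OF xy(1) h(1) hx(1)] hx(2) by simp_all
    \<comment> \<open>The translate of x by h and the point y have the same value under s, hence lie
      in one G-orbit. The arrow g joining them gives the lift (x, g, y) of h, unique by freeness of
      the left action.\<close>
    have "left_orbit G r lact (ract x h) = left_orbit G r lact y"
      using induces_homeomorphismD(2)[OF ind_s xh(1) xy(3)] xh(2) by simp
    moreover have "ract x h \<in> left_orbit G r lact (ract x h)"
      unfolding left_orbit_def using lact1[OF xh(1)] G.unitsD[OF \<psi>_unit[OF xh(1)]] by force
    ultimately obtain g where g: "g \<in> arrows G" "src G g = r y" "ract x h = lact g y"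
      by (auto simp: left_orbit_def)
    have rg: "rng G g = r x" using rl[OF g(1) xy(3) g(2)] xh(3) g(3) by simp
    have k: "(x, g, y) \<in> arrows A" using xy g rg by simp
    show "\<exists>!k. k \<in> arrows A \<and> rng A k = u \<and> src A k = v \<and> \<Phi> k = h"
    proof (rule ex1I[of _ "(x, g, y)"])
      show "(x, g, y) \<in> arrows A \<and> rng A (x, g, y) = u \<and> src A (x, g, y) = v \<and> \<Phi> (x, g, y) = h"
        using k \<Phi>_unique[OF k h(1)] hx(1) g rg xy by simp
      fix k' assume k': "k' \<in> arrows A \<and> rng A k' = u \<and> src A k' = v \<and> \<Phi> k' = h"
      obtain x' g' y' where e: "k' = (x', g', y')" by (cases k') auto
      then have xy': "x' = x" "y' = y" using k' xy by simp_all
      have kA: "(x, g', y) \<in> arrows A" "\<Phi> (x, g', y) = h" using k' e xy' by simp_all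
      then have "lact g' y = lact g y" using \<Phi>(3)[OF kA(1)] g(3) by simp
      then have "g' = g"
        by (intro free_l[of g' y g]) (use kA(1) g xy(3) in \<open>auto simp: left_pairs_def\<close>)
      then show "k' = (x, g, y)" using e xy' by simp
    qed
  next
    fix v assume v: "v \<in> units H"
    then have "v \<in> s ` topspace Z" using induces_homeomorphismD(1)[OF ind_s] by simp
    then obtain x where x: "x \<in> topspace Z" "v = s x" by blast
    show "\<exists>u\<in>units A. \<exists>h\<in>arrows H. rng H h = \<Phi> u \<and> src H h = v"
    proof (intro bexI conjI)
      show "(x, r x, x) \<in> units A" by (rule units_ampliationI[OF x(1) refl])
      show "v \<in> arrows H" "src H v = v" by (rule H.unitsD[OF v])+
      show "rng H v = \<Phi> (x, r x, x)" using \<Phi>_unit[OF x(1)] H.unitsD[OF v] x(2) by simp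
    qed
  qed
  with amp show ?thesis using that by blast
qed


section \<open>The eight equivalence relations\<close>

lemma homology_iso_common_cover:
  assumes K: "Hausdorff_etale_groupoid K"
    and G: "Hausdorff_etale_groupoid G" "zero_dimensional_space (unit_space G)" "sigma_compact_space (unit_space G)"
    and H: "Hausdorff_etale_groupoid H" "zero_dimensional_space (unit_space H)" "sigma_compact_space (unit_space H)"
    and KG: "etale_equivalence K G \<phi>" and KH: "etale_equivalence K H \<psi>"
  shows "homology_group G n \<cong> homology_group H n"
proof -
  have "homology_group G n \<cong> homology_group K n"
    using group.iso_sym[OF Hausdorff_etale_groupoid.group_homology_group[OF K]]
      etale_equivalence_homology_iso[OF K G(1) KG G(2,3)] by blast
  also have "homology_group K n \<cong> homology_group H n"
    by (rule etale_equivalence_homology_iso[OF K H(1) KH H(2,3)])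
  finally show ?thesis .
qed

section \<open>Linking groupoids\<close>

text \<open>The inverse isomorphism maps the units of G onto X and carries compact pieces to compact
  pieces. Used on both halves of a linking groupoid, it gives \<sigma>-compactness of its units,
  which a section over them requires.\<close>

lemma homeomorphic_units_sigma_compact:
  assumes iso: "groupoid_iso (restriction L X) G \<alpha>" and X: "X \<subseteq> units L"
    and sc: "sigma_compact_space (unit_space G)"
  obtains \<K> where "countable \<K>" "\<And>K. K \<in> \<K> \<Longrightarrow> compactin (unit_space L) K" "\<Union>\<K> = X"
proof -
  have hom: "groupoid_hom (restriction L X) G \<alpha>"
    and homeo: "homeomorphic_map (gtop (restriction L X)) (gtop G) \<alpha>"
    using iso by (simp_all add: groupoid_iso_def)
  obtain \<beta> where \<beta>: "homeomorphic_maps (gtop (restriction L X)) (gtop G) \<alpha> \<beta>"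
    using homeo by (auto simp: homeomorphic_map_maps)
  have c: "continuous_map (gtop G) (gtop (restriction L X)) \<beta>"
    and \<beta>\<alpha>: "\<And>x. x \<in> arrows (restriction L X) \<Longrightarrow> \<beta> (\<alpha> x) = x"
    and \<alpha>\<beta>: "\<And>g. g \<in> arrows G \<Longrightarrow> \<alpha> (\<beta> g) = g"
    using \<beta> by (auto simp: homeomorphic_maps_def)
  have Xa: "x \<in> arrows (restriction L X)" "rng L x = x" if "x \<in> X" for x
    using that X by (auto simp: units_def)
  have im: "\<beta> ` units G = X"
  proof
    show "\<beta> ` units G \<subseteq> X"
    proof
      fix x assume "x \<in> \<beta> ` units G"
      then obtain u where u: "u \<in> units G" "x = \<beta> u" by blast
      then have uD: "u \<in> arrows G" "rng G u = u" by (auto simp: units_def)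
      have x: "x \<in> arrows (restriction L X)"
        using continuous_map_image_subset_topspace[OF c] uD(1) u(2) by blast
      then have r: "rng L x \<in> X" by simp
      \<comment> \<open>The preimage x is recognised as a unit through \<alpha>: it has the same
        image as its range, and \<beta> recovers both.\<close>
      have "\<alpha> (rng L x) = rng G (\<alpha> x)"
        using groupoid_homD(2)[OF hom x] by simp
      also have "\<dots> = \<alpha> x" using uD \<alpha>\<beta>[OF uD(1)] u(2) by simp
      finally have "rng L x = x"
        using \<beta>\<alpha>[OF x] \<beta>\<alpha>[OF Xa(1)[OF r]] by simp
      with r show "x \<in> X" by simp
    qed
    show "X \<subseteq> \<beta> ` units G"
    proof
      fix x assume x: "x \<in> X"
      then have "x \<in> units (restriction L X)" by (simp add: units_restriction[OF X])
      then have "\<alpha> x \<in> units G" by (rule groupoid_hom_unit[OF hom])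
      then show "x \<in> \<beta> ` units G" using \<beta>\<alpha>[OF Xa(1)[OF x]] by (metis imageI)
    qed
  qed
  obtain \<K> where \<K>: "countable \<K>" "\<And>K. K \<in> \<K> \<Longrightarrow> compactin (unit_space G) K" "\<Union>\<K> = units G"
    using sc by (auto simp: sigma_compact_space_def)
  have "compactin (unit_space L) (\<beta> ` K)" if "K \<in> \<K>" for K
  proof -
    have K: "compactin (gtop G) K" "K \<subseteq> units G"
      using \<K>(2)[OF that] by (simp_all add: unit_space_def compactin_subtopology)
    have "compactin (gtop (restriction L X)) (\<beta> ` K)" by (rule image_compactin[OF K(1) c])
    then have "compactin (gtop L) (\<beta> ` K)" by (simp add: compactin_subtopology)
    moreover have "\<beta> ` K \<subseteq> units L" using K(2) im X by blast
    ultimately show ?thesis by (simp add: unit_space_def compactin_subtopology)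
  qed
  moreover have "\<Union>((`) \<beta> ` \<K>) = X" using im \<K>(3) by blast
  ultimately show ?thesis using that[of "(`) \<beta> ` \<K>"] \<K>(1) by auto
qed

text \<open>The groupoids are connected in two steps with L in the middle, so L itself is the target
  of etale equivalences. Its units are zero-dimensional because L is ample, and \<sigma>-compact as
  the union of X and Y.\<close>

lemma linking_homology_iso:
  assumes G: "Hausdorff_etale_groupoid G" "zero_dimensional_space (unit_space G)" "sigma_compact_space (unit_space G)"
    and H: "Hausdorff_etale_groupoid H" "zero_dimensional_space (unit_space H)" "sigma_compact_space (unit_space H)"
    and link: "linking_equivalent TYPE('l) G H"
  shows "homology_group G n \<cong> homology_group H n"
proof -
  obtain L :: "'l groupoid" and X Y where L: "ample_groupoid L" "Hausdorff_groupoid L"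
    and XY: "X \<union> Y = units L" "openin (unit_space L) X" "full L X" "openin (unit_space L) Y" "full L Y"
    and "isomorphic_groupoids (restriction L X) G" "isomorphic_groupoids (restriction L Y) H"
    using link unfolding linking_equivalent_def by blast
  then obtain \<alpha> \<gamma> where \<alpha>: "groupoid_iso (restriction L X) G \<alpha>" and \<gamma>: "groupoid_iso (restriction L Y) H \<gamma>"
    by (auto simp: isomorphic_groupoids_def)
  have etale: "Hausdorff_etale_groupoid L"
    using L by (intro Hausdorff_etale_groupoidI) (auto simp: ample_groupoid_def)
  interpret L: Hausdorff_etale_groupoid L by (rule etale)
  have zd: "zero_dimensional_space (unit_space L)"
    using L(1) by (simp add: ample_groupoid_def ample_groupoid_axioms_def)
  have sub: "X \<subseteq> units L" "Y \<subseteq> units L" using XY(1) by auto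
  obtain \<K> \<L> where \<K>: "countable \<K>" "\<And>K. K \<in> \<K> \<Longrightarrow> compactin (unit_space L) K" "\<Union>\<K> = X"
    and \<L>: "countable \<L>" "\<And>K. K \<in> \<L> \<Longrightarrow> compactin (unit_space L) K" "\<Union>\<L> = Y"
    using homeomorphic_units_sigma_compact[OF \<alpha> sub(1) G(3)] homeomorphic_units_sigma_compact[OF \<gamma> sub(2) H(3)]
    by metis
  have sc: "sigma_compact_space (unit_space L)"
    unfolding sigma_compact_space_def
    using \<K> \<L> XY(1) by (intro exI[of _ "\<K> \<union> \<L>"]) auto
  have RX: "Hausdorff_etale_groupoid (restriction L X)" and RY: "Hausdorff_etale_groupoid (restriction L Y)"
    using XY by (auto intro: L.Hausdorff_etale_restriction)
  have "homology_group G n \<cong> homology_group L n"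
    by (rule homology_iso_common_cover[OF RX G etale zd sc
          etale_equivalence_iso[OF Hausdorff_etale_groupoid.axioms(1)[OF RX] \<alpha>] L.etale_equivalence_restriction[OF XY(2,3)]])
  also have "homology_group L n \<cong> homology_group H n"
    by (rule homology_iso_common_cover[OF RY etale zd sc H
          L.etale_equivalence_restriction[OF XY(4,5)] etale_equivalence_iso[OF Hausdorff_etale_groupoid.axioms(1)[OF RY] \<gamma>]])
  finally show ?thesis .
qed

theorem lemma4p3:
  fixes G :: "'a groupoid" and H :: "'b groupoid"
  assumes "ample_groupoid G" and "Hausdorff_groupoid G"
    and "second_countable (gtop G)" and "sigma_compact_space (unit_space G)"
    and "ample_groupoid H" and "Hausdorff_groupoid H"
    and "second_countable (gtop H)" and "sigma_compact_space (unit_space H)"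
  shows
    "(similar_groupoids G H \<or>
      morita_equivalent TYPE('k) G H \<or>
      linking_equivalent TYPE('l) G H \<or>
      renault_equivalent TYPE('z) G H \<or>
      isomorphic_ampliations TYPE('x) TYPE('y) G H \<or>
      isomorphic_groupoids (product_groupoid G full_equivalence_relation)
        (product_groupoid H full_equivalence_relation) \<or>
      kakutani_equivalent G H \<or>
      weakly_kakutani_equivalent G H
        \<longrightarrow> (\<forall>n. homology_group G n \<cong> homology_group H n)) \<and>
     (\<forall>\<rho>. similarity G H \<rho> \<longrightarrow>
        (\<forall>n. homology_map G H \<rho> n \<in> iso (homology_group G n) (homology_group H n))) \<and>
     (\<forall>X. openin (unit_space G) X \<and> full G X \<longrightarrow>
        similarity (restriction G X) G id \<and>
        (\<forall>n. homology_map (restriction G X) G id n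
               \<in> iso (homology_group (restriction G X) n) (homology_group G n)))"
proof -
  have G: "Hausdorff_etale_groupoid G" and H: "Hausdorff_etale_groupoid H"
    using assms by (auto intro!: Hausdorff_etale_groupoidI simp: ample_groupoid_def)
  interpret G: Hausdorff_etale_groupoid G by (rule G)
  interpret H: Hausdorff_etale_groupoid H by (rule H)
  have zG: "zero_dimensional_space (unit_space G)" and zH: "zero_dimensional_space (unit_space H)"
    using assms(1,5) by (simp_all add: ample_groupoid_def ample_groupoid_axioms_def)
  note sG = assms(4) and sH = assms(8)
  note cover = homology_iso_common_cover[OF _ G zG sG H zH sH]
  \<comment> \<open>Composing the isomorphism with the equivalence from K' to H makes K a common
    cover. Weak Kakutani equivalence, isomorphic ampliations and stable isomorphism all have this
    shape.\<close>
  have through_iso: "homology_group G n \<cong> homology_group H n"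
    if K: "Hausdorff_etale_groupoid K" "etale_equivalence K G \<phi>" and K': "etale_equivalence K' H \<psi>"
      and iso: "isomorphic_groupoids K K'"
    for K :: "'c groupoid" and K' :: "'d groupoid" and \<phi> \<psi> n
  proof -
    obtain \<iota> where "groupoid_iso K K' \<iota>" using iso by (auto simp: isomorphic_groupoids_def)
    then have "etale_equivalence K K' \<iota>"
      by (rule etale_equivalence_iso[OF Hausdorff_etale_groupoid.axioms(1)[OF K(1)]])
    from etale_equivalence_compose[OF H.groupoid_axioms this K']
    show ?thesis by (rule cover[OF K])
  qed
  have similarity: "homology_map G H \<rho> n \<in> iso (homology_group G n) (homology_group H n)" if "similarity G H \<rho>" for \<rho> n
    by (rule similarity_homology_iso[OF G H that])
  have restriction: "similarity (restriction G X) G id"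
    "homology_map (restriction G X) G id n \<in> iso (homology_group (restriction G X) n) (homology_group G n)"
    if X: "openin (unit_space G) X" "full G X" for X n
  proof -
    note RX = G.Hausdorff_etale_restriction[OF X(1)]
    show sim: "similarity (restriction G X) G id"
      by (rule etale_equivalence_similarity[OF RX G G.etale_equivalence_restriction[OF X] zG sG])
    show "homology_map (restriction G X) G id n \<in> iso (homology_group (restriction G X) n) (homology_group G n)"
      by (rule similarity_homology_iso[OF RX G sim])
  qed
  have weakly: "homology_group G n \<cong> homology_group H n" if weak: "weakly_kakutani_equivalent G H" for n
  proof -
    obtain X Y where X: "openin (unit_space G) X" "full G X" and Y: "openin (unit_space H) Y" "full H Y"
      and iso: "isomorphic_groupoids (restriction G X) (restriction H Y)"
      using weak unfolding weakly_kakutani_equivalent_def by blast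
    show ?thesis
      by (rule through_iso[OF G.Hausdorff_etale_restriction[OF X(1)] G.etale_equivalence_restriction[OF X]
            H.etale_equivalence_restriction[OF Y] iso])
  qed
  have morita: "homology_group G n \<cong> homology_group H n" if equiv: "morita_equivalent TYPE('k) G H" for n
  proof -
    obtain K :: "'k groupoid" and \<phi> \<psi> where K: "etale_groupoid K" "Hausdorff_groupoid K"
      and w: "weak_equivalence K G \<phi>" "weak_equivalence K H \<psi>"
      using equiv unfolding morita_equivalent_def by blast
    note K' = Hausdorff_etale_groupoidI[OF K]
    show ?thesis
      by (rule cover[OF K' weak_equivalence_imp_etale_equivalence[OF K' G w(1)] weak_equivalence_imp_etale_equivalence[OF K' H w(2)]])
  qed
  have renault: "homology_group G n \<cong> homology_group H n" if equiv: "renault_equivalent TYPE('z) G H" for n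
  proof -
    obtain Z :: "'z topology" and r s lact ract where
      Z: "free_proper_left_space G Z r lact" "free_proper_right_space H Z s ract"
        "commuting_actions G H Z r s lact ract"
        "induces_homeomorphism Z (right_orbit H s ract) (unit_space G) r"
        "induces_homeomorphism Z (left_orbit G r lact) (unit_space H) s"
      using equiv unfolding renault_equivalent_def by blast
    obtain \<Phi> where \<Phi>: "ampliation G Z r" "etale_equivalence (pullback_groupoid Z r G) H \<Phi>"
      by (rule renault_common_cover[OF G H Z])
    show ?thesis
      by (rule cover[OF ampliation.Hausdorff_etale_ampliation[OF \<Phi>(1)] ampliation.etale_equivalence_ampliation[OF \<Phi>(1)] \<Phi>(2)])
  qed
  have ampliations: "homology_group G n \<cong> homology_group H n" if equiv: "isomorphic_ampliations TYPE('x) TYPE('y) G H" for n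
  proof -
    obtain X :: "'x topology" and \<psi> and Y :: "'y topology" and \<eta> where
      a: "ampliation_map X G \<psi>" "ampliation_map Y H \<eta>"
      and iso: "isomorphic_groupoids (pullback_groupoid X \<psi> G) (pullback_groupoid Y \<eta> H)"
      using equiv unfolding isomorphic_ampliations_def by blast
    have aX: "ampliation G X \<psi>" and aY: "ampliation H Y \<eta>"
      using a G H by (simp_all add: ampliation_map_def ampliation_def ampliation_axioms_def)
    show ?thesis
      by (rule through_iso[OF ampliation.Hausdorff_etale_ampliation[OF aX] ampliation.etale_equivalence_ampliation[OF aX]
            ampliation.etale_equivalence_ampliation[OF aY] iso])
  qed
  have stable: "homology_group G n \<cong> homology_group H n"
    if "isomorphic_groupoids (product_groupoid G full_equivalence_relation) (product_groupoid H full_equivalence_relation)" for n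
    by (rule through_iso[OF G.Hausdorff_etale_stabilisation G.etale_equivalence_stabilisation H.etale_equivalence_stabilisation that])
  have similar: "homology_group G n \<cong> homology_group H n" if "similar_groupoids G H" for n
    using that similarity is_isoI unfolding similar_groupoids_def by blast
  have kakutani: "weakly_kakutani_equivalent G H" if "kakutani_equivalent G H"
    using that unfolding kakutani_equivalent_def weakly_kakutani_equivalent_def by blast
  show ?thesis
  proof (intro conjI impI allI)
    fix n
    assume "similar_groupoids G H \<or> morita_equivalent TYPE('k) G H \<or> linking_equivalent TYPE('l) G H \<or>
      renault_equivalent TYPE('z) G H \<or> isomorphic_ampliations TYPE('x) TYPE('y) G H \<or>
      isomorphic_groupoids (product_groupoid G full_equivalence_relation)
        (product_groupoid H full_equivalence_relation) \<or>
      kakutani_equivalent G H \<or> weakly_kakutani_equivalent G H"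
    then show "homology_group G n \<cong> homology_group H n"
      using similar morita linking_homology_iso[OF G zG sG H zH sH] renault ampliations stable kakutani weakly
      by (elim disjE) blast+
  qed (use similarity restriction in blast)+
qed

end
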